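(* Let $\Gamma$ be a diagram of finite type, let $k$ be a vertex of $\Gamma$, and let $\Gamma' = \mu_k(\Gamma)$ be the mutation of $\Gamma$ at $k$. Then the associated Artin groups are isomorphic: $A_\Gamma \cong A_{\Gamma'}$.
   Context: **Diagrams.** Let $B$ be an $n\times n$ integer skew-symmetrisable matrix (there is a diagonal matrix $D$ with positive diagonal entries such that $DB$ is skew-symmetric). Its diagram $\Gamma(B)$ is the edge-weighted oriented graph on vertices $1,\dots,n$ with an arrow $i\to j$ if and only if $B_{ij}>0$; this arrow has weight $|B_{ij}B_{ji}|$. Two vertices are connected if there is an arrow between them in some direction. **Mutation.** For a vertex $k$, the matrix $\mu_k(B)=B'$ is given by $B'_{ij}=-B_{ij}$ if $i=k$ or $j=k$, and $B'_{ij}=B_{ij}+\frac{|B_{ik}|B_{kj}+B_{ik}|B_{kj}|}{2}$ otherwise. For $\Gamma=\Gamma(B)$, the mutated diagram is $\mu_k(\Gamma)=\Gamma(\mu_k(B))$; in finite type this depends only on $\Gamma$ and $k$ (Fomin–Zelevinsky). **Finite type.** $\Gamma$ is of finite type if $\Gamma=\Gamma(B)$ for $B$ the matrix of a seed of a cluster algebra with finitely many seeds. Equivalently (Fomin–Zelevinsky), every matrix $B'$ obtained from $B$ by a finite sequence of mutations satisfies $|B'_{ij}B'_{ji}|\le 3$ for all $i,j$. **The numbers $m_{ij}$.** For $i\ne j$ put $m_{ij}=2,3,4,6$ according to whether $i,j$ are not connected, or connected by an edge of weight $1$, $2$, $3$ respectively. **Alternating products.** $\langle x,y\rangle^m$ denotes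 the alternating word $xyxy\cdots$ of length $m$ beginning with $x$. **Chordless cycle tuples.** A tuple $(i_0,\dots,i_{d-1})$ of distinct vertices ($d\ge 3$) is a chordless cycle tuple if the induced subdiagram of $\Gamma$ on these vertices is a single cycle whose arrows are exactly $i_a\to i_{a+1}$ (subscripts mod $d$). For group elements $s_v$ indexed by vertices, put $$p(i_a,i_{a+1})=s_{i_{a+1}}^{-1}s_{i_{a+2}}^{-1}\cdots s_{i_{a-2}}^{-1}\,s_{i_{a-1}}\,s_{i_{a-2}}\cdots s_{i_{a+1}},\qquad t(i_a,i_{a+1})=[s_{i_a},p(i_a,i_{a+1})],$$ where $[x,y]=xyx^{-1}y^{-1}$. **The group $A_\Gamma$.** It is generated by $s_v$, one for each vertex $v$ of $\Gamma$, subject to: (T2) $\langle s_i,s_j\rangle^{m_{ij}}=\langle s_j,s_i\rangle^{m_{ij}}$ for all $i\neq j$; (T3) $t(i_0,i_1)=e$ for every chordless cycle tuple $(i_0,\dots,i_{d-1})$ such that either all edges of the cycle have weight $1$, or all edges have weight $1$ or $2$ and the edge $i_{d-1}\to i_0$ has weight $2$. *)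

theory Defs
  imports
    "HOL-Analysis.Finite_Cartesian_Product"
    "HOL-Library.Poly_Mapping"
    "HOL-Library.Countable"
    "HOL-Computational_Algebra.Fraction_Field"
    "HOL-Algebra.Group"
begin

section \<open>Skew-symmetrisable matrices, diagrams and mutation\<close>

text \<open>
  The vertices \<open>1, \<dots>, n\<close> are the elements of a finite type \<^typ>\<open>'v\<close> with \<open>n = CARD('v)\<close>;
  an \<open>n \<times> n\<close> integer matrix has type \<open>int ^ 'v ^ 'v\<close>.
\<close>

definition skew_symmetrisable :: "int ^ 'v ^ 'v::finite \<Rightarrow> bool" where
  "skew_symmetrisable B \<longleftrightarrow>
     (\<exists>d :: 'v \<Rightarrow> real. (\<forall>i. d i > 0) \<and>
        (\<forall>i j. d i * of_int (B $ i $ j) = - (d j * of_int (B $ j $ i))))"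

text \<open>
  A diagram is given by the weights of its arrows: \<open>\<Gamma> i j\<close> is the weight of the arrow
  \<open>i \<rightarrow> j\<close>, and \<open>\<Gamma> i j = 0\<close> means that there is no such arrow.  This loses nothing, as the
  arrows of the diagram of a skew-symmetrisable matrix have positive weight.
\<close>

type_synonym 'v diagram = "'v \<Rightarrow> 'v \<Rightarrow> nat"

definition diagram_of :: "int ^ 'v ^ 'v::finite \<Rightarrow> 'v diagram" where
  "diagram_of B = (\<lambda>i j. if B $ i $ j > 0 then nat \<bar>B $ i $ j * B $ j $ i\<bar> else 0)"

lemma diagram_of_arrow_iff:
  assumes "skew_symmetrisable B"
  shows "diagram_of B i j \<noteq> 0 \<longleftrightarrow> B $ i $ j > 0"
proof -
  have "B $ j $ i \<noteq> 0" if "B $ i $ j > 0"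
  proof
    assume z: "B $ j $ i = 0"
    from assms obtain d :: "'a \<Rightarrow> real"
      where d: "d i > 0" "d i * of_int (B $ i $ j) = - (d j * of_int (B $ j $ i))"
      unfolding skew_symmetrisable_def by blast
    with z that show False by simp
  qed
  then show ?thesis by (auto simp: diagram_of_def)
qed

text \<open>The division by 2 is exact, as \<open>\<bar>a\<bar> * b + a * \<bar>b\<bar>\<close> is \<open>0\<close> or \<open>\<plusminus>2ab\<close>.\<close>

definition mutate :: "'v \<Rightarrow> int ^ 'v ^ 'v \<Rightarrow> int ^ 'v ^ 'v::finite" where
  "mutate k B = (\<chi> i j.
     if i = k \<or> j = k then - (B $ i $ j)
     else B $ i $ j + (\<bar>B $ i $ k\<bar> * B $ k $ j + B $ i $ k * \<bar>B $ k $ j\<bar>) div 2)"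

text \<open>
  \<open>\<Gamma>' = \<mu>\<^sub>k(\<Gamma>)\<close>, as a relation: \<open>\<Gamma>'\<close> is computed from any matrix with diagram \<open>\<Gamma>\<close>, so that
  no independence of the choice of the matrix is built in.
\<close>

definition is_diagram_mutation :: "'v::finite \<Rightarrow> 'v diagram \<Rightarrow> 'v diagram \<Rightarrow> bool" where
  "is_diagram_mutation k \<Gamma> \<Gamma>' \<longleftrightarrow>
     (\<exists>B. skew_symmetrisable B \<and> \<Gamma> = diagram_of B \<and> \<Gamma>' = diagram_of (mutate k B))"


section \<open>Seeds and finite type\<close>

text \<open>
  Polynomials over \<open>\<rat>\<close> in the variables \<open>u\<^sub>0, u\<^sub>1, u\<^sub>2, \<dots>\<close> are finitely supported functions on
  monomials, which are finitely supported exponent vectors.  The vertex \<open>v\<close> owns the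
  indeterminate \<open>u\<^bsub>to_nat v\<^esub>\<close>; the other indeterminates never occur in a cluster, so that the
  seeds live in the field of rational functions in \<open>n\<close> independent variables.
\<close>

type_synonym ratfun = "((nat \<Rightarrow>\<^sub>0 nat) \<Rightarrow>\<^sub>0 rat) fract"

definition indeterminate :: "'v::finite \<Rightarrow> ratfun" where
  "indeterminate v =
     Fract (Poly_Mapping.single (Poly_Mapping.single (to_nat v) 1) 1) 1"

text \<open>A (labelled, coefficient-free) seed: a cluster together with an exchange matrix.\<close>

type_synonym 'v seed = "('v \<Rightarrow> ratfun) \<times> (int ^ 'v ^ 'v)"

definition seed_mutate :: "'v::finite \<Rightarrow> 'v seed \<Rightarrow> 'v seed" where
  "seed_mutate k = (\<lambda>(x, B).
     (x(k := ((\<Prod>i | B $ i $ k > 0. x i ^ nat (B $ i $ k)) +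
              (\<Prod>i | B $ i $ k < 0. x i ^ nat (- (B $ i $ k)))) / x k),
      mutate k B))"

inductive_set mutation_class :: "'v::finite seed \<Rightarrow> 'v seed set" for S where
  base: "S \<in> mutation_class S"
| step: "T \<in> mutation_class S \<Longrightarrow> seed_mutate k T \<in> mutation_class S"

text \<open>
  A cluster algebra is determined up to isomorphism by the matrix of any one of its seeds, the
  cluster of that seed being identified with the indeterminates.
\<close>

definition finite_type :: "'v::finite diagram \<Rightarrow> bool" where
  "finite_type \<Gamma> \<longleftrightarrow>
     (\<exists>B. skew_symmetrisable B \<and> \<Gamma> = diagram_of B \<and>
          finite (mutation_class (indeterminate, B)))"


section \<open>Groups given by generators and relations\<close>

text \<open>
  Words in the generators and their inverses: \<open>(v, True)\<close> is the generator \<open>s\<^sub>v\<close> and \<open>(v, False)\<close>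
  its inverse.  The group presented by a set \<open>R\<close> of relations \<open>u = w\<close> consists of the classes of
  words under the least congruence containing \<open>R\<close> and all cancellations.
\<close>

type_synonym 'v word = "('v \<times> bool) list"

definition gen :: "'v \<Rightarrow> 'v \<times> bool" where
  "gen v = (v, True)"

definition inv_letter :: "'v \<times> bool \<Rightarrow> 'v \<times> bool" where
  "inv_letter l = (fst l, \<not> snd l)"

definition inv_word :: "'v word \<Rightarrow> 'v word" where
  "inv_word w = rev (map inv_letter w)"

inductive pres_eq :: "('v word \<times> 'v word) set \<Rightarrow> 'v word \<Rightarrow> 'v word \<Rightarrow> bool"
  for R where
  relator: "(u, w) \<in> R \<Longrightarrow> pres_eq R u w"
| cancel: "pres_eq R [l, inv_letter l] []"
| refl: "pres_eq R u u"
| sym: "pres_eq R u w \<Longrightarrow> pres_eq R w u"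
| trans: "pres_eq R u v \<Longrightarrow> pres_eq R v w \<Longrightarrow> pres_eq R u w"
| append: "pres_eq R u u' \<Longrightarrow> pres_eq R w w' \<Longrightarrow> pres_eq R (u @ w) (u' @ w')"

definition word_class :: "('v word \<times> 'v word) set \<Rightarrow> 'v word \<Rightarrow> 'v word set" where
  "word_class R u = {w. pres_eq R u w}"

definition presented_group :: "('v word \<times> 'v word) set \<Rightarrow> 'v word set monoid" where
  "presented_group R =
     \<lparr>carrier = range (word_class R),
      monoid.mult = (\<lambda>X Y. {w. \<exists>u\<in>X. \<exists>v\<in>Y. pres_eq R (u @ v) w}),
      one = word_class R []\<rparr>"

lemma word_class_eq_iff: "word_class R u = word_class R w \<longleftrightarrow> pres_eq R u w"
  unfolding word_class_def by (auto intro: pres_eq.refl pres_eq.sym pres_eq.trans)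

lemma presented_group_mult:
  "word_class R u \<otimes>\<^bsub>presented_group R\<^esub> word_class R w = word_class R (u @ w)"
  unfolding presented_group_def word_class_def
  by (auto intro: pres_eq.refl pres_eq.trans pres_eq.append)

lemma inv_letter_inv_letter [simp]: "inv_letter (inv_letter l) = l"
  by (simp add: inv_letter_def)

lemma pres_eq_inv_word: "pres_eq R (inv_word u @ u) []"
proof (induction u)
  case Nil
  show ?case by (simp add: inv_word_def pres_eq.refl)
next
  case (Cons l u)
  have "pres_eq R [inv_letter l, l] []"
    using pres_eq.cancel[of R "inv_letter l"] by simp
  from pres_eq.append[OF pres_eq.append[OF pres_eq.refl[of R "inv_word u"] this]
      pres_eq.refl[of R u]]
  have "pres_eq R (inv_word (l # u) @ l # u) (inv_word u @ u)"
    by (simp add: inv_word_def)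
  with Cons.IH show ?case by (rule pres_eq.trans[rotated])
qed

lemma carrier_presented_group: "carrier (presented_group R) = range (word_class R)"
  by (simp add: presented_group_def)

lemma one_presented_group: "\<one>\<^bsub>presented_group R\<^esub> = word_class R []"
  by (simp add: presented_group_def)

lemma group_presented_group: "group (presented_group R)"
proof (rule groupI)
  show "\<one>\<^bsub>presented_group R\<^esub> \<in> carrier (presented_group R)"
    by (simp add: carrier_presented_group one_presented_group)
next
  fix x assume "x \<in> carrier (presented_group R)"
  then obtain u where u: "x = word_class R u" by (auto simp: carrier_presented_group)
  then show "\<one>\<^bsub>presented_group R\<^esub> \<otimes>\<^bsub>presented_group R\<^esub> x = x"
    by (simp add: one_presented_group presented_group_mult)
  have "word_class R (inv_word u) \<otimes>\<^bsub>presented_group R\<^esub> x = \<one>\<^bsub>presented_group R\<^esub>"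
    by (simp add: one_presented_group u presented_group_mult word_class_eq_iff pres_eq_inv_word)
  then show "\<exists>y\<in>carrier (presented_group R).
      y \<otimes>\<^bsub>presented_group R\<^esub> x = \<one>\<^bsub>presented_group R\<^esub>"
    unfolding carrier_presented_group by blast
qed (auto simp: carrier_presented_group presented_group_mult)


section \<open>The group of a diagram\<close>

text \<open>
  At most one of \<open>\<Gamma> i j\<close>, \<open>\<Gamma> j i\<close> is nonzero, so their sum is the weight of the edge between
  \<open>i\<close> and \<open>j\<close>.  Weights above \<open>3\<close> do not occur in finite type, and the value given for them is
  irrelevant.
\<close>

definition m_exponent :: "'v diagram \<Rightarrow> 'v \<Rightarrow> 'v \<Rightarrow> nat" where
  "m_exponent \<Gamma> i j =
     (let w = \<Gamma> i j + \<Gamma> j i in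
      if w = 0 then 2 else if w = 1 then 3 else if w = 2 then 4 else 6)"

fun alternating :: "'a \<Rightarrow> 'a \<Rightarrow> nat \<Rightarrow> 'a list" where
  "alternating x y 0 = []"
| "alternating x y (Suc m) = x # alternating y x m"

definition commutator_word :: "'v word \<Rightarrow> 'v word \<Rightarrow> 'v word" where
  "commutator_word x y = x @ y @ inv_word x @ inv_word y"

text \<open>A tuple \<open>(i\<^sub>0, \<dots>, i\<^bsub>d-1\<^esub>)\<close> is the list \<open>cs\<close> with \<open>cs ! a = i\<^sub>a\<close>.\<close>

definition chordless_cycle :: "'v diagram \<Rightarrow> 'v list \<Rightarrow> bool" where
  "chordless_cycle \<Gamma> cs \<longleftrightarrow>
     length cs \<ge> 3 \<and> distinct cs \<and>
     (\<forall>a < length cs. \<forall>b < length cs.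
        \<Gamma> (cs ! a) (cs ! b) \<noteq> 0 \<longleftrightarrow> b = (a + 1) mod length cs)"

text \<open>
  The words \<open>p(i\<^sub>a, i\<^bsub>a+1\<^esub>)\<close> and \<open>t(i\<^sub>a, i\<^bsub>a+1\<^esub>)\<close>; with subscripts mod \<open>d\<close>, the vertices
  \<open>i\<^bsub>a+1\<^esub>, \<dots>, i\<^bsub>a-2\<^esub>\<close> are \<open>i\<^bsub>a+b\<^esub>\<close> for \<open>b = 1, \<dots>, d - 2\<close>, and \<open>i\<^bsub>a-1\<^esub> = i\<^bsub>a+(d-1)\<^esub>\<close>.
\<close>

definition p_word :: "'v list \<Rightarrow> nat \<Rightarrow> 'v word" where
  "p_word cs a =
     (let d = length cs; s = (\<lambda>b. gen (cs ! ((a + b) mod d))) in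
      map (\<lambda>b. inv_letter (s b)) [1..<d-1] @ [s (d - 1)] @ map s (rev [1..<d-1]))"

definition t_word :: "'v list \<Rightarrow> nat \<Rightarrow> 'v word" where
  "t_word cs a = commutator_word [gen (cs ! a)] (p_word cs a)"

definition T3_cycle :: "'v diagram \<Rightarrow> 'v list \<Rightarrow> bool" where
  "T3_cycle \<Gamma> cs \<longleftrightarrow>
     chordless_cycle \<Gamma> cs \<and>
     (let d = length cs; weight = (\<lambda>a. \<Gamma> (cs ! a) (cs ! ((a + 1) mod d))) in
      (\<forall>a<d. weight a = 1) \<or> ((\<forall>a<d. weight a \<in> {1, 2}) \<and> weight (d - 1) = 2))"

definition artin_relations :: "'v diagram \<Rightarrow> ('v word \<times> 'v word) set" where
  "artin_relations \<Gamma> =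
     {(alternating (gen i) (gen j) (m_exponent \<Gamma> i j),
       alternating (gen j) (gen i) (m_exponent \<Gamma> i j)) | i j. i \<noteq> j} \<union>
     {(t_word cs 0, []) | cs. T3_cycle \<Gamma> cs}"

definition artin_group :: "'v diagram \<Rightarrow> 'v word set monoid" where
  "artin_group \<Gamma> = presented_group (artin_relations \<Gamma>)"

end

theory Submission
  imports Defs
begin

text \<open>
  Let \<open>\<Gamma>' = \<mu>\<^sub>k(\<Gamma>)\<close>. The isomorphism between the two groups sends the generator \<open>s\<^sub>v\<close> of
  one group to \<open>s\<^sub>k s\<^sub>v s\<^sub>k\<^sup>-\<^sup>1\<close> if the diagram of the other group has an arrow \<open>v \<rightarrow> k\<close>, and to \<open>s\<^sub>v\<close>
  otherwise. This recipe is available in both directions. Mutation reverses the arrows at \<open>k\<close>, so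
  for a neighbour \<open>v\<close> of \<open>k\<close> exactly one of the two maps conjugates \<open>s\<^sub>v\<close>, while for every other
  \<open>v\<close> conjugation by \<open>s\<^sub>k\<close> fixes \<open>s\<^sub>v\<close>: both composites are conjugation by \<open>s\<^sub>k\<close>
  (\<open>mutation_hom_composite\<close>). Hence both maps are bijective as soon as they are homomorphisms, that
  is, as soon as the elements \<open>t\<^sub>v\<close> obtained from the generators of one group satisfy the relations
  of the other one (\<open>t_satisfies\<close>).

  The relations can change only where exactly one of two vertices is conjugated although both are
  joined to \<open>k\<close>, that is, along a path \<open>i \<rightarrow> k \<rightarrow> j\<close>. In finite type there are very few weights for
  such a path and for the edge between \<open>i\<close> and \<open>j\<close>, if any (\<open>oriented_path_weights\<close>,
  \<open>oriented_triangle_weights\<close>), and in each case the braid relation of \<open>t\<^sub>i\<close> and \<open>t\<^sub>j\<close> follows from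
  those of \<open>s\<^sub>i\<close>, \<open>s\<^sub>j\<close>, \<open>s\<^sub>k\<close> and the relation of the triangle. For a chordless cycle of the mutated
  diagram there are three situations. If it avoids \<open>k\<close> and has at most one neighbour
  of \<open>k\<close>, all its generators are conjugated by one element. If it avoids \<open>k\<close> but has two neighbours of \<open>k\<close>, these
  are consecutive, and the other diagram has the cycle with \<open>k\<close> inserted between them. If it passes
  through \<open>k\<close>, the other diagram has the cycle with \<open>k\<close> left out; a triangle then degenerates to a
  single pair of commuting generators, or else has weights \<open>2, 2, 1\<close> and is a triangle again. In
  every case the relation of the one cycle is rewritten into that of the other by moving \<open>s\<^sub>k\<close> past
  the generators that commute with it and by the braid relations of \<open>s\<^sub>k\<close> with its two neighbours.

  That a vertex meets a cycle only in these ways rests on the fact that finite type admits no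
  chordless cycle whose arrows are not cyclically oriented: an oriented stretch of such a cycle can
  be shortened by mutation until a triangle with a source and a sink remains, and one more mutation
  produces an edge of weight at least \<open>4\<close> (\<open>path_attachment\<close>).

  All of this uses finite type only through the bound \<open>\<bar>b\<^sub>i\<^sub>j b\<^sub>j\<^sub>i\<bar> \<le> 3\<close> for all matrices in the mutation
  class. The bound holds because of the following. Cluster variables are quotients of polynomials,
  and seeds can be evaluated at positive reals; evaluated seeds mutate by the same formula, which is
  an involution. If \<open>\<bar>b\<^sub>i\<^sub>j b\<^sub>j\<^sub>i\<bar> \<ge> 4\<close> in some seed, one evaluates so that all variables of that seed
  become \<open>1\<close> and mutates alternately at \<open>i\<close> and \<open>j\<close>: suitably scaled logarithms of the new variables
  then increase strictly, so there are infinitely many seeds (\<open>finite_type_imp_two_finite\<close>).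
\<close>

section \<open>Matrix mutation\<close>

lemma exchange_term:
  fixes a b :: int
  shows "(\<bar>a\<bar> * b + a * \<bar>b\<bar>) div 2 =
    (if a > 0 \<and> b > 0 then a * b else if a < 0 \<and> b < 0 then - (a * b) else 0)"
proof -
  consider "a > 0 \<and> b > 0" | "a < 0 \<and> b < 0" | "\<bar>a\<bar> * b + a * \<bar>b\<bar> = 0" "\<not> (a > 0 \<and> b > 0)" "\<not> (a < 0 \<and> b < 0)"
    by (cases "a = 0"; cases "b = 0"; cases "a > 0"; cases "b > 0") auto
  then show ?thesis
  proof cases
    case 1
    then have "\<bar>a\<bar> * b + a * \<bar>b\<bar> = 2 * (a * b)" by simp
    with 1 show ?thesis by simp
  next
    case 2
    then have "\<bar>a\<bar> * b + a * \<bar>b\<bar> = 2 * (- (a * b))" by simp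
    with 2 show ?thesis by (simp only: nonzero_mult_div_cancel_left) simp
  qed auto
qed

lemma mutate_entry:
  "mutate k B $ i $ j =
    (if i = k \<or> j = k then - (B $ i $ j)
     else if B $ i $ k > 0 \<and> B $ k $ j > 0 then B $ i $ j + B $ i $ k * B $ k $ j
     else if B $ i $ k < 0 \<and> B $ k $ j < 0 then B $ i $ j - B $ i $ k * B $ k $ j
     else B $ i $ j)"
  by (simp add: mutate_def exchange_term)

lemma mutate_mutate: "mutate k (mutate k B) = B" if "B $ k $ k = 0"
  using that by (auto simp: vec_eq_iff mutate_entry)

lemma skew_symmetrisable_sgn:
  assumes "skew_symmetrisable B"
  shows "B $ i $ j > 0 \<longleftrightarrow> B $ j $ i < 0"
proof -
  from assms obtain d :: "'a \<Rightarrow> real" where d: "\<And>i. d i > 0"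
    and e: "\<And>i j. d i * of_int (B $ i $ j) = - (d j * of_int (B $ j $ i))"
    unfolding skew_symmetrisable_def by blast
  have "B $ i $ j > 0 \<longleftrightarrow> d i * of_int (B $ i $ j) > 0"
    using d[of i] by (simp add: zero_less_mult_iff)
  also have "\<dots> \<longleftrightarrow> B $ j $ i < 0"
    using d[of j] e[of i j] by (simp add: mult_less_0_iff)
  finally show ?thesis .
qed

lemma skew_symmetrisable_diag: "skew_symmetrisable B \<Longrightarrow> B $ i $ i = 0"
  using skew_symmetrisable_sgn[of B i i] by linarith

lemma skew_symmetrisable_zero: "skew_symmetrisable B \<Longrightarrow> B $ i $ j = 0 \<longleftrightarrow> B $ j $ i = 0"
  using skew_symmetrisable_sgn[of B i j] skew_symmetrisable_sgn[of B j i] by linarith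

lemma symmetriser_product:
  fixes d :: "'v::finite \<Rightarrow> real"
  assumes e: "\<And>i j. d i * of_int (B $ i $ j) = - (d j * of_int (B $ j $ i))"
  shows "d i * of_int (B $ i $ k * B $ k $ j) = d j * of_int (B $ j $ k * B $ k $ i)"
proof -
  have "d i * of_int (B $ i $ k * B $ k $ j) = - (d k * of_int (B $ k $ i)) * of_int (B $ k $ j)"
    using e[of i k] by (metis (no_types, lifting) mult.assoc of_int_mult)
  also have "\<dots> = - (d k * of_int (B $ k $ j)) * of_int (B $ k $ i)" by simp
  also have "\<dots> = d j * of_int (B $ j $ k * B $ k $ i)" using e[of k j] by (simp add: mult.assoc)
  finally show ?thesis .
qed

lemma symmetriser_mutate:
  fixes d :: "'v::finite \<Rightarrow> real"
  assumes "skew_symmetrisable B"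
    and e: "\<And>i j. d i * of_int (B $ i $ j) = - (d j * of_int (B $ j $ i))"
  shows "d i * of_int (mutate k B $ i $ j) = - (d j * of_int (mutate k B $ j $ i))"
proof -
  have p: "d i * (of_int (B $ i $ k) * of_int (B $ k $ j)) = d j * (of_int (B $ j $ k) * of_int (B $ k $ i))"
    using symmetriser_product[OF e, of i k j] by simp
  have s: "B $ k $ j < 0 \<longleftrightarrow> B $ j $ k > 0" "B $ k $ i < 0 \<longleftrightarrow> B $ i $ k > 0"
     "B $ k $ j > 0 \<longleftrightarrow> B $ j $ k < 0" "B $ k $ i > 0 \<longleftrightarrow> B $ i $ k < 0"
    using skew_symmetrisable_sgn[OF assms(1)] by auto
  show ?thesis using e[of i j] p
    by (auto simp: mutate_entry s distrib_left right_diff_distrib)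
qed

lemma skew_symmetrisable_mutate:
  assumes "skew_symmetrisable B"
  shows "skew_symmetrisable (mutate k B)"
  using assms symmetriser_mutate[OF assms] unfolding skew_symmetrisable_def by blast

text \<open>
  The property of matrices through which finite type is used: Fomin and Zelevinsky call such
  matrices 2-finite.
\<close>

definition two_finite :: "int ^ 'v ^ 'v::finite \<Rightarrow> bool" where
  "two_finite B \<longleftrightarrow> skew_symmetrisable B \<and>
     (\<forall>ks i j. \<bar>fold mutate ks B $ i $ j * fold mutate ks B $ j $ i\<bar> \<le> 3)"

lemma skew_symmetrisable_fold_mutate:
  "skew_symmetrisable B \<Longrightarrow> skew_symmetrisable (fold mutate ks B)"
  by (induction ks arbitrary: B) (auto intro: skew_symmetrisable_mutate)

lemma two_finite_mutate: "two_finite B \<Longrightarrow> two_finite (mutate k B)"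
  unfolding two_finite_def
  by (metis fold_simps(2) skew_symmetrisable_mutate)

section \<open>Mutation of diagrams\<close>

text \<open>
  If \<open>D\<close> symmetrises \<open>B\<close>, then \<open>D^(1/2) B D^(-1/2)\<close> is skew-symmetric with entries of absolute value
  \<open>sqrt \<bar>b\<^sub>i\<^sub>j b\<^sub>j\<^sub>i\<bar>\<close>. These entries are given by the diagram alone, and mutation commutes with
  the conjugation by the diagonal matrix. So mutation of diagrams depends on the diagram only.
\<close>

definition symmetrised :: "'v diagram \<Rightarrow> 'v \<Rightarrow> 'v \<Rightarrow> real" where
  "symmetrised G i j = sqrt (real (G i j)) - sqrt (real (G j i))"

lemma symmetrised_diagram_of:
  fixes d :: "'v::finite \<Rightarrow> real"
  assumes "skew_symmetrisable B" and d: "\<And>i. d i > 0"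
    and e: "\<And>i j. d i * of_int (B $ i $ j) = - (d j * of_int (B $ j $ i))"
  shows "symmetrised (diagram_of B) i j = sqrt (d i / d j) * of_int (B $ i $ j)"
proof -
  have pos: "sqrt (real (diagram_of B i j)) = sqrt (d i / d j) * of_int (B $ i $ j)"
    if "B $ i $ j > 0" for i j
  proof -
    have neg: "B $ j $ i < 0" using that skew_symmetrisable_sgn[OF assms(1)] by blast
    have "real (diagram_of B i j) = - (of_int (B $ i $ j) * of_int (B $ j $ i))"
    proof -
      have "B $ i $ j * B $ j $ i < 0" using that neg by (rule mult_pos_neg)
      then have "real (nat \<bar>B $ i $ j * B $ j $ i\<bar>) = - of_int (B $ i $ j * B $ j $ i)"
        by (simp add: of_nat_nat)
      then show ?thesis using that by (simp add: diagram_of_def)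
    qed
    also have "\<dots> = (sqrt (d i / d j) * of_int (B $ i $ j))^2"
      using e[of i j] d[of i] d[of j]
      by (simp add: power_mult_distrib field_simps power2_eq_square)
    finally show ?thesis using that d[of i] d[of j] by (simp add: real_sqrt_unique)
  qed
  have sym: "sqrt (d i / d j) * of_int (B $ i $ j) = - (sqrt (d j / d i) * of_int (B $ j $ i))"
  proof -
    have "sqrt (d i / d j) = d i / (sqrt (d i) * sqrt (d j))"
      "sqrt (d j / d i) = d j / (sqrt (d i) * sqrt (d j))"
      using d[of i] d[of j] by (simp_all add: real_sqrt_divide field_simps)
    then show ?thesis using e[of i j] by (metis minus_divide_left times_divide_eq_left)
  qed
  consider "B $ i $ j > 0" | "B $ i $ j < 0" | "B $ i $ j = 0" by linarith
  then show ?thesis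
  proof cases
    case 1
    then have "B $ j $ i < 0" using skew_symmetrisable_sgn[OF assms(1)] by blast
    then have "diagram_of B j i = 0" by (simp add: diagram_of_def)
    with pos[OF 1] show ?thesis by (simp add: symmetrised_def)
  next
    case 2
    then have "B $ j $ i > 0" using skew_symmetrisable_sgn[OF assms(1)] by blast
    moreover have "diagram_of B i j = 0" using 2 by (simp add: diagram_of_def)
    ultimately show ?thesis using pos[of j i] sym by (simp add: symmetrised_def)
  next
    case 3
    then show ?thesis using skew_symmetrisable_zero[OF assms(1)]
      by (simp add: symmetrised_def diagram_of_def)
  qed
qed

lemma symmetrised_inject:
  assumes "skew_symmetrisable B" "skew_symmetrisable C"
    and "symmetrised (diagram_of B) = symmetrised (diagram_of C)"
  shows "diagram_of B = diagram_of C"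
proof (intro ext)
  fix i j
  have "real (diagram_of B i j) = (if symmetrised (diagram_of B) i j > 0 then
      (symmetrised (diagram_of B) i j)^2 else 0)" if "skew_symmetrisable B" for B :: "int^'a^'a"
    using skew_symmetrisable_sgn[OF that, of i j] skew_symmetrisable_sgn[OF that, of j i]
    by (auto simp: symmetrised_def diagram_of_def)
  then have "real (diagram_of B i j) = real (diagram_of C i j)" using assms by simp
  then show "diagram_of B i j = diagram_of C i j" by simp
qed

lemma symmetrised_mutate:
  assumes "skew_symmetrisable B"
  defines "S \<equiv> symmetrised (diagram_of B)"
  shows "symmetrised (diagram_of (mutate k B)) i j =
    (if i = k \<or> j = k then - S i j
     else if S i k > 0 \<and> S k j > 0 then S i j + S i k * S k j
     else if S i k < 0 \<and> S k j < 0 then S i j - S i k * S k j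
     else S i j)"
proof -
  from assms obtain d :: "'a \<Rightarrow> real" where d: "\<And>i. d i > 0"
    and e: "\<And>i j. d i * of_int (B $ i $ j) = - (d j * of_int (B $ j $ i))"
    unfolding skew_symmetrisable_def by blast
  note sk = skew_symmetrisable_mutate[OF assms(1), of k]
  note e' = symmetriser_mutate[OF assms(1) e]
  have S: "S i j = sqrt (d i / d j) * of_int (B $ i $ j)" for i j
    unfolding S_def by (rule symmetrised_diagram_of[OF assms(1) d e])
  have S': "symmetrised (diagram_of (mutate k B)) i j = sqrt (d i / d j) * of_int (mutate k B $ i $ j)"
    by (rule symmetrised_diagram_of[OF sk d e'])
  have sg: "S i j > 0 \<longleftrightarrow> B $ i $ j > 0" "S i j < 0 \<longleftrightarrow> B $ i $ j < 0" for i j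
  proof -
    have "d i / d j > 0" using d[of i] d[of j] by simp
    then show "S i j > 0 \<longleftrightarrow> B $ i $ j > 0" "S i j < 0 \<longleftrightarrow> B $ i $ j < 0"
      unfolding S by (simp_all add: zero_less_mult_iff mult_less_0_iff)
  qed
  have m: "S i k * S k j = sqrt (d i / d j) * of_int (B $ i $ k * B $ k $ j)"
    using d[of i] d[of j] d[of k] unfolding S by (simp add: real_sqrt_divide)
  show ?thesis unfolding sg m unfolding S' S by (simp add: mutate_entry algebra_simps)
qed

lemma diagram_of_mutate_cong:
  assumes "skew_symmetrisable B" "skew_symmetrisable C" "diagram_of B = diagram_of C"
  shows "diagram_of (mutate k B) = diagram_of (mutate k C)"
  using assms(3)
  by (intro symmetrised_inject skew_symmetrisable_mutate assms ext)
     (simp add: symmetrised_mutate assms(1,2))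

text \<open>
  The matrix that witnesses finite type and the one that witnesses the mutation may differ; along
  any sequence of mutations they have the same diagrams, so that the weight bound passes from one to
  the other (\<open>two_finite_cong\<close>).
\<close>

lemma diagram_of_fold_mutate_cong:
  assumes "skew_symmetrisable B" "skew_symmetrisable C" "diagram_of B = diagram_of C"
  shows "diagram_of (fold mutate ks B) = diagram_of (fold mutate ks C)"
  using assms
  by (induction ks arbitrary: B C) (auto intro: skew_symmetrisable_mutate diagram_of_mutate_cong)

lemma weight_eq_diagram_of:
  assumes "skew_symmetrisable B"
  shows "nat \<bar>B $ i $ j * B $ j $ i\<bar> = diagram_of B i j + diagram_of B j i"
  using skew_symmetrisable_sgn[OF assms, of i j] skew_symmetrisable_sgn[OF assms, of j i]
  by (auto simp: diagram_of_def mult.commute not_less)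

lemma two_finite_cong:
  assumes "two_finite B" "skew_symmetrisable C" "diagram_of B = diagram_of C"
  shows "two_finite C"
proof -
  have B: "skew_symmetrisable B" using assms(1) by (simp add: two_finite_def)
  have "\<bar>fold mutate ks C $ i $ j * fold mutate ks C $ j $ i\<bar> =
      \<bar>fold mutate ks B $ i $ j * fold mutate ks B $ j $ i\<bar>" for ks i j
  proof -
    have "nat \<bar>fold mutate ks C $ i $ j * fold mutate ks C $ j $ i\<bar> =
      nat \<bar>fold mutate ks B $ i $ j * fold mutate ks B $ j $ i\<bar>"
      using diagram_of_fold_mutate_cong[OF B assms(2,3)]
      by (simp add: weight_eq_diagram_of skew_symmetrisable_fold_mutate B assms(2))
    then show ?thesis by linarith
  qed
  with assms show ?thesis by (simp add: two_finite_def)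
qed

section \<open>Evaluation of seeds at positive reals\<close>

definition monomial_value :: "(nat \<Rightarrow> real) \<Rightarrow> (nat \<Rightarrow>\<^sub>0 nat) \<Rightarrow> real" where
  "monomial_value u m = Prod_any (\<lambda>i. u i ^ Poly_Mapping.lookup m i)"

definition poly_value :: "(nat \<Rightarrow> real) \<Rightarrow> ((nat \<Rightarrow>\<^sub>0 nat) \<Rightarrow>\<^sub>0 rat) \<Rightarrow> real" where
  "poly_value u p = Sum_any (\<lambda>m. of_rat (Poly_Mapping.lookup p m) * monomial_value u m)"

lemma monomial_value_zero: "monomial_value u 0 = 1"
  by (simp add: monomial_value_def)

lemma monomial_value_add: "monomial_value u (m + n) = monomial_value u m * monomial_value u n"
proof -
  have f: "finite {i. u i ^ Poly_Mapping.lookup m i \<noteq> 1}" for m :: "nat \<Rightarrow>\<^sub>0 nat"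
    by (rule finite_subset[OF _ Poly_Mapping.finite_lookup[of m]]) (auto intro: ccontr)
  show ?thesis
    unfolding monomial_value_def Poly_Mapping.lookup_add power_add by (rule Prod_any.distrib[OF f f])
qed

lemma monomial_value_single: "monomial_value u (Poly_Mapping.single i 1) = u i"
proof -
  have "(\<lambda>j. u j ^ Poly_Mapping.lookup (Poly_Mapping.single i 1) j) = (\<lambda>j. if j = i then u j else 1)"
    by (auto simp: Poly_Mapping.lookup_single when_def)
  then show ?thesis unfolding monomial_value_def by (simp only: Prod_any.delta)
qed

lemma poly_value_zero: "poly_value u 0 = 0"
  by (simp add: poly_value_def)

lemma poly_value_add: "poly_value u (p + q) = poly_value u p + poly_value u q"
proof -
  have f: "finite {m. of_rat (Poly_Mapping.lookup p m) * monomial_value u m \<noteq> 0}"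
    for p :: "(nat \<Rightarrow>\<^sub>0 nat) \<Rightarrow>\<^sub>0 rat"
    by (rule finite_subset[OF _ Poly_Mapping.finite_lookup[of p]]) auto
  show ?thesis
    unfolding poly_value_def Poly_Mapping.lookup_add of_rat_add distrib_right by (rule Sum_any.distrib[OF f f])
qed

lemma poly_value_single: "poly_value u (Poly_Mapping.single m c) = of_rat c * monomial_value u m"
proof -
  have "(\<lambda>n. of_rat (Poly_Mapping.lookup (Poly_Mapping.single m c) n) * monomial_value u n) =
      (\<lambda>n. (of_rat c * monomial_value u n) when n = m)"
    by (auto simp: Poly_Mapping.lookup_single when_def)
  then show ?thesis unfolding poly_value_def by (simp only: Sum_any_when_equal)
qed

text \<open>
  Building a polynomial up by single terms reduces multiplicativity of the evaluation to that of
  monomials.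
\<close>

lemma poly_induct:
  fixes p :: "('a \<Rightarrow>\<^sub>0 'b::comm_monoid_add)"
  assumes "P 0" and "\<And>m c q. P q \<Longrightarrow> P (q + Poly_Mapping.single m c)"
  shows "P p"
proof (induction p rule: update_induct)
  case const
  show ?case by (fact assms(1))
next
  case (update f a b)
  have "Poly_Mapping.update a b f = f + Poly_Mapping.single a b"
    using update(1) by (intro poly_mapping_eqI)
      (auto simp: Poly_Mapping.lookup_update Poly_Mapping.lookup_add Poly_Mapping.lookup_single when_def Poly_Mapping.in_keys_iff)
  with assms(2)[OF update(3)] show ?case by simp
qed

lemma poly_value_mult: "poly_value u (p * q) = poly_value u p * poly_value u q"
proof (induction p rule: poly_induct)
  case 1
  then show ?case by (simp add: poly_value_zero)
next
  case (2 m c p)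
  have "poly_value u (Poly_Mapping.single m c * q) =
      poly_value u (Poly_Mapping.single m c) * poly_value u q"
  proof (induction q rule: poly_induct)
    case 1
    then show ?case by (simp only: mult_zero_right poly_value_zero)
  next
    case (2 n d q)
    have "poly_value u (Poly_Mapping.single m c * Poly_Mapping.single n d) =
        poly_value u (Poly_Mapping.single m c) * poly_value u (Poly_Mapping.single n d)"
      by (simp only: mult_single poly_value_single monomial_value_add of_rat_mult ac_simps)
    with 2 show ?case by (simp only: distrib_left poly_value_add)
  qed
  with 2 show ?case by (simp only: distrib_right poly_value_add)
qed

lemma poly_value_one: "poly_value u 1 = 1"
  using poly_value_single[of u 0 1] by (simp add: monomial_value_zero)

text \<open>
  A rational function has a value only where some denominator of it does not vanish, so evaluation
  is a partial function and is treated as a relation.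
\<close>

definition has_value :: "(nat \<Rightarrow> real) \<Rightarrow> ratfun \<Rightarrow> real \<Rightarrow> bool" where
  "has_value u f r \<longleftrightarrow>
     (\<exists>p q. f = Fract p q \<and> poly_value u q \<noteq> 0 \<and> r = poly_value u p / poly_value u q)"

lemma has_value_unique:
  assumes "has_value u f r" "has_value u f s"
  shows "r = s"
proof -
  from assms obtain p q p' q' where
    f: "f = Fract p q" "f = Fract p' q'" and q: "poly_value u q \<noteq> 0" "poly_value u q' \<noteq> 0"
    and rs: "r = poly_value u p / poly_value u q" "s = poly_value u p' / poly_value u q'"
    unfolding has_value_def by blast
  have "q \<noteq> 0" "q' \<noteq> 0" using q poly_value_zero by auto
  then have "p * q' = p' * q" using f eq_fract(1)[of q q' p p'] by simp
  then have "poly_value u (p * q') = poly_value u (p' * q)" by (rule arg_cong)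
  then have "poly_value u p * poly_value u q' = poly_value u p' * poly_value u q"
    by (simp only: poly_value_mult)
  then show ?thesis unfolding rs using frac_eq_eq[OF q] by blast
qed

lemma has_value_one: "has_value u 1 1"
  unfolding has_value_def One_fract_def
  by (rule exI[of _ 1], rule exI[of _ 1]) (simp add: poly_value_one)

lemma has_value_indeterminate: "has_value u (indeterminate v) (u (to_nat v))"
  unfolding has_value_def indeterminate_def
  by (rule exI[of _ "Poly_Mapping.single (Poly_Mapping.single (to_nat v) 1) 1"], rule exI[of _ 1])
     (simp only: poly_value_one poly_value_single monomial_value_single, simp)

lemma has_value_add:
  assumes "has_value u f r" "has_value u g s"
  shows "has_value u (f + g) (r + s)"
proof -
  from assms obtain p q p' q' where
    f: "f = Fract p q" "g = Fract p' q'" and q: "poly_value u q \<noteq> 0" "poly_value u q' \<noteq> 0"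
    and rs: "r = poly_value u p / poly_value u q" "s = poly_value u p' / poly_value u q'"
    unfolding has_value_def by blast
  have nz: "q \<noteq> 0" "q' \<noteq> 0" using q poly_value_zero by auto
  show ?thesis unfolding has_value_def
    by (rule exI[of _ "p * q' + p' * q"], rule exI[of _ "q * q'"])
       (use nz q in \<open>simp add: f rs poly_value_mult poly_value_add add_frac_eq\<close>)
qed

lemma has_value_mult:
  assumes "has_value u f r" "has_value u g s"
  shows "has_value u (f * g) (r * s)"
proof -
  from assms obtain p q p' q' where
    f: "f = Fract p q" "g = Fract p' q'" and q: "poly_value u q \<noteq> 0" "poly_value u q' \<noteq> 0"
    and rs: "r = poly_value u p / poly_value u q" "s = poly_value u p' / poly_value u q'"
    unfolding has_value_def by blast
  show ?thesis unfolding has_value_def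
    by (rule exI[of _ "p * p'"], rule exI[of _ "q * q'"])
       (use q in \<open>simp add: f rs poly_value_mult\<close>)
qed

lemma has_value_divide:
  assumes "has_value u f r" "has_value u g s" "s \<noteq> 0"
  shows "has_value u (f / g) (r / s)"
proof -
  from assms obtain p q p' q' where
    f: "f = Fract p q" "g = Fract p' q'" and q: "poly_value u q \<noteq> 0" "poly_value u q' \<noteq> 0"
    and rs: "r = poly_value u p / poly_value u q" "s = poly_value u p' / poly_value u q'"
    unfolding has_value_def by blast
  show ?thesis unfolding has_value_def
    by (rule exI[of _ "p * q'"], rule exI[of _ "q * p'"])
       (use q assms(3) in \<open>simp add: f rs poly_value_mult\<close>)
qed

lemma has_value_power: "has_value u f r \<Longrightarrow> has_value u (f ^ n) (r ^ n)"
  by (induction n) (auto intro: has_value_one has_value_mult)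

lemma has_value_prod:
  "finite A \<Longrightarrow> (\<And>i. i \<in> A \<Longrightarrow> has_value u (f i) (r i)) \<Longrightarrow> has_value u (prod f A) (prod r A)"
  by (induction A rule: finite_induct) (auto intro: has_value_one has_value_mult)

text \<open>
  The exchange relation of seeds read over the reals. It involves no subtraction, so positive
  clusters remain positive and the division is always by a nonzero number.
\<close>

definition real_seed_mutate ::
  "'v::finite \<Rightarrow> ('v \<Rightarrow> real) \<times> (int ^ 'v ^ 'v) \<Rightarrow> ('v \<Rightarrow> real) \<times> (int ^ 'v ^ 'v)" where
  "real_seed_mutate k = (\<lambda>(y, B).
     (y(k := ((\<Prod>i | B $ i $ k > 0. y i ^ nat (B $ i $ k)) +
              (\<Prod>i | B $ i $ k < 0. y i ^ nat (- (B $ i $ k)))) / y k),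
      mutate k B))"

definition seed_value ::
  "(nat \<Rightarrow> real) \<Rightarrow> 'v seed \<Rightarrow> ('v \<Rightarrow> real) \<times> (int ^ 'v ^ 'v::finite) \<Rightarrow> bool" where
  "seed_value u T Y \<longleftrightarrow> snd T = snd Y \<and> (\<forall>v. has_value u (fst T v) (fst Y v))"

lemma seed_value_unique: "seed_value u T Y \<Longrightarrow> seed_value u T Z \<Longrightarrow> Y = Z"
  unfolding seed_value_def by (auto intro!: prod_eqI has_value_unique)

lemma seed_value_mutate:
  assumes "seed_value u T Y" "\<And>v. fst Y v > 0"
  shows "seed_value u (seed_mutate k T) (real_seed_mutate k Y)"
proof -
  have v: "has_value u (fst T v) (fst Y v)" and B: "snd T = snd Y" for v
    using assms(1) by (auto simp: seed_value_def)
  have nz: "fst Y k \<noteq> 0" using assms(2)[of k] by simp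
  show ?thesis unfolding seed_value_def
    by (auto simp: seed_mutate_def real_seed_mutate_def case_prod_beta B
        intro!: has_value_divide has_value_add has_value_prod has_value_power v nz)
qed

lemma snd_real_seed_mutate: "snd (real_seed_mutate k Y) = mutate k (snd Y)"
  by (simp add: real_seed_mutate_def case_prod_beta)

lemma real_seed_mutate_pos:
  assumes "\<And>v. fst Y v > 0"
  shows "fst (real_seed_mutate k Y) v > 0"
  using assms
  by (auto simp: real_seed_mutate_def case_prod_beta intro!: divide_pos_pos add_pos_pos prod_pos)

lemma fold_real_seed_mutate_pos:
  "(\<And>v. fst Y v > 0) \<Longrightarrow> fst (fold real_seed_mutate ks Y) v > 0"
proof (induction ks arbitrary: Y)
  case (Cons k ks)
  show ?case using Cons.IH[OF real_seed_mutate_pos[OF Cons.prems]] by simp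
qed simp

lemma snd_fold_real_seed_mutate: "snd (fold real_seed_mutate ks Y) = fold mutate ks (snd Y)"
  by (induction ks arbitrary: Y) (auto simp: snd_real_seed_mutate)

text \<open>
  The two exchange monomials do not involve the variable at \<open>k\<close>, as \<open>b\<^sub>k\<^sub>k = 0\<close>, and mutation at \<open>k\<close>
  only interchanges them.
\<close>

lemma real_seed_mutate_involution:
  assumes "\<And>v. fst Y v > 0" "snd Y $ k $ k = 0"
  shows "real_seed_mutate k (real_seed_mutate k Y) = Y"
proof -
  obtain y B where Y: "Y = (y, B)" by fastforce
  let ?pos = "\<Prod>i | B $ i $ k > 0. y i ^ nat (B $ i $ k)"
  let ?neg = "\<Prod>i | B $ i $ k < 0. y i ^ nat (- (B $ i $ k))"
  have y: "y v > 0" for v using assms Y by auto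
  have kk: "B $ k $ k = 0" using assms Y by auto
  have "?pos > 0" "?neg > 0" using y by (auto intro: prod_pos)
  then have "?pos + ?neg \<noteq> 0" by linarith
  moreover have "(\<Prod>i | mutate k B $ i $ k > 0. (y(k := c)) i ^ nat (mutate k B $ i $ k)) = ?neg" for c
    by (rule prod.cong) (auto simp: mutate_entry kk)
  moreover have "(\<Prod>i | mutate k B $ i $ k < 0. (y(k := c)) i ^ nat (- (mutate k B $ i $ k))) = ?pos" for c
    by (rule prod.cong) (auto simp: mutate_entry kk)
  ultimately show ?thesis
    using mutate_mutate[OF kk] y[of k]
    by (simp add: Y real_seed_mutate_def add.commute)
qed

lemma fold_real_seed_mutate_reverse:
  assumes "\<And>v. fst Y v > 0" "skew_symmetrisable (snd Y)"
  shows "fold real_seed_mutate ks (fold real_seed_mutate (rev ks) Y) = Y"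
  using assms
proof (induction ks arbitrary: Y rule: rev_induct)
  case (snoc k ks)
  have "fold real_seed_mutate ks (fold real_seed_mutate (rev ks) (real_seed_mutate k Y)) = real_seed_mutate k Y"
    by (rule snoc.IH)
      (use snoc.prems real_seed_mutate_pos[OF snoc.prems(1)] in
        \<open>auto simp: snd_real_seed_mutate skew_symmetrisable_mutate\<close>)
  then show ?case
    using real_seed_mutate_involution[of Y k] snoc.prems
    by (simp add: skew_symmetrisable_diag)
qed simp

text \<open>
  The real seeds reachable from \<open>(y, B)\<close> are the values of the seeds of the cluster algebra at the
  point whose coordinates are given by \<open>y\<close>.
\<close>

lemma finite_real_seeds:
  fixes B :: "int ^ 'v ^ 'v::finite"
  assumes "finite (mutation_class (indeterminate, B))" "\<And>v. y v > 0"
  shows "finite (range (\<lambda>ks. fold real_seed_mutate ks (y, B)))"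
proof -
  \<comment> \<open>With this choice the indeterminate of each vertex \<open>v\<close> takes the value \<open>y v\<close>.\<close>
  define u where "u n = y (from_nat n)" for n
  have "\<exists>T \<in> mutation_class (indeterminate, B). seed_value u T (fold real_seed_mutate ks (y, B))" for ks
  proof (induction ks rule: rev_induct)
    case Nil
    have "seed_value u (indeterminate, B) (y, B)"
    proof -
      have "has_value u (indeterminate v) (y v)" for v :: 'v
        using has_value_indeterminate[of u v] by (simp add: u_def)
      then show ?thesis by (simp add: seed_value_def)
    qed
    then show ?case using mutation_class.base by auto
  next
    case (snoc k ks)
    then obtain T where T: "T \<in> mutation_class (indeterminate, B)"
      "seed_value u T (fold real_seed_mutate ks (y, B))" by blast
    have "seed_value u (seed_mutate k T) (real_seed_mutate k (fold real_seed_mutate ks (y, B)))"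
      by (rule seed_value_mutate[OF T(2) fold_real_seed_mutate_pos]) (use assms(2) in auto)
    then show ?case using mutation_class.step[OF T(1)] by auto
  qed
  then have "range (\<lambda>ks. fold real_seed_mutate ks (y, B)) \<subseteq>
      (\<lambda>T. THE Y. seed_value u T Y) ` mutation_class (indeterminate, B)"
    by (auto simp: image_iff) (metis seed_value_unique the_equality)
  then show ?thesis using assms(1) finite_surj by blast
qed

section \<open>Growth in rank two\<close>

lemma mutate_pair:
  fixes B :: "int ^ 'v ^ 'v::finite"
  assumes "skew_symmetrisable B" "i \<noteq> j"
  shows "mutate i B $ i $ j = - (B $ i $ j)" "mutate i B $ j $ i = - (B $ j $ i)"
    "mutate j B $ i $ j = - (B $ i $ j)" "mutate j B $ j $ i = - (B $ j $ i)"
  by (simp_all add: mutate_entry)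

text \<open>
  With all variables other than those at \<open>i\<close> and \<open>j\<close> equal to \<open>1\<close>, the exchange relation is that of
  rank two, whatever the other matrix entries are.
\<close>

lemma real_seed_mutate_rank2:
  fixes B :: "int ^ 'v ^ 'v::finite"
  assumes "skew_symmetrisable B" "B $ j $ i \<noteq> 0" "\<And>v. v \<noteq> i \<Longrightarrow> v \<noteq> j \<Longrightarrow> y v = 1"
  shows "fst (real_seed_mutate i (y, B)) = y(i := (y j ^ nat \<bar>B $ j $ i\<bar> + 1) / y i)"
proof -
  have ii: "B $ i $ i = 0" by (rule skew_symmetrisable_diag[OF assms(1)])
  have one: "(\<Prod>v\<in>A. y v ^ f v) = (if j \<in> A then y j ^ f j else 1)" if "i \<notin> A" for A f
  proof -
    have "(\<Prod>v\<in>A. y v ^ f v) = (\<Prod>v\<in>A. if v = j then y j ^ f j else 1)"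
    proof (rule prod.cong[OF HOL.refl])
      fix v assume "v \<in> A"
      then have "v \<noteq> i" using that by auto
      then show "y v ^ f v = (if v = j then y j ^ f j else 1)" using assms(3)[of v] by simp
    qed
    then show ?thesis by (simp add: prod.delta)
  qed
  show ?thesis
  proof (cases "B $ j $ i > 0")
    case True
    then show ?thesis by (simp add: real_seed_mutate_def one ii add.commute)
  next
    case False
    then show ?thesis using assms(2) by (simp add: real_seed_mutate_def one ii add.commute)
  qed
qed

text \<open>
  From \<open>y y' = x\<^sup>c + 1\<close> one gets \<open>ln y' + ln y > c ln x\<close>. After scaling the logarithms by \<open>sqrt b\<close> and
  \<open>sqrt c\<close> this becomes \<open>\<eta>' + \<eta> > sqrt (b c) \<xi> \<ge> 2 \<xi>\<close>, as long as \<open>\<xi> \<ge> 0\<close>. So growth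
  propagates: \<open>\<eta> \<le> \<xi>\<close> implies \<open>\<xi> < \<eta>'\<close>.
\<close>

lemma rank2_growth:
  fixes y y' :: real and b c :: int
  assumes "y > 0" "x > 0" "y' = (x ^ nat \<bar>c\<bar> + 1) / y"
    and bc: "\<bar>b * c\<bar> \<ge> 4" and le: "sqrt \<bar>b\<bar> * ln y \<le> sqrt \<bar>c\<bar> * ln x" and nn: "ln x \<ge> 0"
  shows "sqrt \<bar>c\<bar> * ln x < sqrt \<bar>b\<bar> * ln y'"
proof -
  have c: "c \<noteq> 0" "b \<noteq> 0" using bc by auto
  have "\<bar>c\<bar> * ln x = ln (x ^ nat \<bar>c\<bar>)" using assms(2) by (simp add: ln_realpow)
  also have "\<dots> < ln (x ^ nat \<bar>c\<bar> + 1)" using assms(2) by (simp add: add_pos_pos)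
  also have "\<dots> = ln y' + ln y"
  proof -
    have "x ^ nat \<bar>c\<bar> + 1 > 0" using assms(2) by (simp add: add_pos_pos)
    then show ?thesis using assms(1) unfolding assms(3) by (simp only: ln_divide_pos)
  qed
  finally have 1: "\<bar>c\<bar> * ln x < ln y' + ln y" .
  have "4 \<le> real_of_int \<bar>b * c\<bar>" using bc by linarith
  then have "2 \<le> sqrt \<bar>b * c\<bar>" by (intro real_le_rsqrt) simp
  then have 2: "2 \<le> sqrt \<bar>b\<bar> * sqrt \<bar>c\<bar>" by (simp add: abs_mult real_sqrt_mult)
  have "2 * (sqrt \<bar>c\<bar> * ln x) \<le> (sqrt \<bar>b\<bar> * sqrt \<bar>c\<bar>) * (sqrt \<bar>c\<bar> * ln x)"
    using 2 nn by (intro mult_right_mono) auto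
  also have "\<dots> = sqrt \<bar>b\<bar> * (\<bar>c\<bar> * ln x)" by (simp add: mult.assoc[symmetric])
  also have "\<dots> < sqrt \<bar>b\<bar> * (ln y' + ln y)" using 1 c by simp
  finally show ?thesis using le by (simp add: distrib_left)
qed

text \<open>
  The invariant \<open>grows\<close> holds at the start because all logarithms are \<open>0\<close> there. Mutating at \<open>i\<close> and
  then at \<open>j\<close> restores the signs of \<open>b\<^sub>i\<^sub>j\<close> and \<open>b\<^sub>j\<^sub>i\<close> and strictly increases the variable at \<open>j\<close>.
\<close>

lemma infinite_rank2_orbit:
  fixes B :: "int ^ 'v ^ 'v::finite"
  assumes sk: "skew_symmetrisable B" and big: "\<bar>B $ i $ j * B $ j $ i\<bar> \<ge> 4"
  shows "infinite (range (\<lambda>ks. fold real_seed_mutate ks ((\<lambda>v. 1), B)))"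
proof -
  let ?b = "B $ i $ j" and ?c = "B $ j $ i"
  have ij: "i \<noteq> j" using big skew_symmetrisable_diag[OF sk] by auto
  define Y where "Y n = ((real_seed_mutate j \<circ> real_seed_mutate i) ^^ n) ((\<lambda>v. 1), B)" for n
  define grows where "grows Z \<longleftrightarrow> skew_symmetrisable (snd Z) \<and> snd Z $ i $ j = ?b \<and> snd Z $ j $ i = ?c \<and>
     (\<forall>v. fst Z v > 0) \<and> (\<forall>v. v \<noteq> i \<longrightarrow> v \<noteq> j \<longrightarrow> fst Z v = 1) \<and>
     0 \<le> ln (fst Z j) \<and> sqrt \<bar>?b\<bar> * ln (fst Z i) \<le> sqrt \<bar>?c\<bar> * ln (fst Z j)" for Z :: "('v \<Rightarrow> real) \<times> (int ^ 'v ^ 'v)"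
  have nz: "?b \<noteq> 0" "?c \<noteq> 0" using big by auto
  have step: "grows (real_seed_mutate j (real_seed_mutate i Z)) \<and>
      ln (fst Z j) < ln (fst (real_seed_mutate j (real_seed_mutate i Z)) j)" if Z: "grows Z" for Z
  proof -
    obtain y C where ZC: "Z = (y, C)" by fastforce
    have C: "skew_symmetrisable C" "C $ i $ j = ?b" "C $ j $ i = ?c"
      and y: "\<And>v. y v > 0" "\<And>v. v \<noteq> i \<Longrightarrow> v \<noteq> j \<Longrightarrow> y v = 1" "0 \<le> ln (y j)"
      "sqrt \<bar>?b\<bar> * ln (y i) \<le> sqrt \<bar>?c\<bar> * ln (y j)"
      using Z unfolding grows_def ZC by auto
    define y1 where "y1 = y(i := (y j ^ nat \<bar>?c\<bar> + 1) / y i)"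
    have r1: "real_seed_mutate i (y, C) = (y1, mutate i C)"
      using real_seed_mutate_rank2[OF C(1), of j i y] nz C y
      by (intro prod_eqI) (auto simp: y1_def snd_real_seed_mutate)
    have C1: "skew_symmetrisable (mutate i C)" "mutate i C $ i $ j = - ?b" "mutate i C $ j $ i = - ?c"
      using C mutate_pair[OF C(1) ij] by (simp_all add: skew_symmetrisable_mutate)
    have y1: "y1 v > 0" "v \<noteq> i \<Longrightarrow> v \<noteq> j \<Longrightarrow> y1 v = 1" for v
      using y(1) y(2) by (auto simp: y1_def intro!: divide_pos_pos add_pos_pos)
    define y2 where "y2 = y1(j := (y1 i ^ nat \<bar>?b\<bar> + 1) / y1 j)"
    have r2: "real_seed_mutate j (y1, mutate i C) = (y2, mutate j (mutate i C))"
      using real_seed_mutate_rank2[OF C1(1), of i j y1] nz C1 y1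
      by (intro prod_eqI) (auto simp: y2_def snd_real_seed_mutate)
    have y2: "y2 v > 0" "v \<noteq> i \<Longrightarrow> v \<noteq> j \<Longrightarrow> y2 v = 1" for v
      using y1 by (auto simp: y2_def intro!: divide_pos_pos add_pos_pos)
    have bc: "\<bar>?b * ?c\<bar> \<ge> 4" "\<bar>?c * ?b\<bar> \<ge> 4" using big by (simp_all add: mult.commute)
    have g1: "sqrt \<bar>?c\<bar> * ln (y j) < sqrt \<bar>?b\<bar> * ln (y1 i)"
      by (rule rank2_growth[OF y(1) y(1) _ bc(1) y(4) y(3)]) (simp add: y1_def)
    have "0 \<le> sqrt \<bar>?c\<bar> * ln (y j)" using y(3) by simp
    with g1 have "0 < sqrt \<bar>?b\<bar> * ln (y1 i)" by linarith
    then have p1: "0 < ln (y1 i)" using nz by (simp add: zero_less_mult_iff)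
    have y1j: "y1 j = y j" using ij by (simp add: y1_def)
    have g2: "sqrt \<bar>?b\<bar> * ln (y1 i) < sqrt \<bar>?c\<bar> * ln (y2 j)"
      by (rule rank2_growth[OF y1(1)[of j] y1(1)[of i] _ bc(2)]) (use g1 p1 y1j in \<open>auto simp: y2_def\<close>)
    have y2i: "y2 i = y1 i" using ij by (simp add: y2_def)
    have "sqrt \<bar>?c\<bar> * ln (y j) < sqrt \<bar>?c\<bar> * ln (y2 j)" using g1 g2 by linarith
    then have lt: "ln (y j) < ln (y2 j)" using nz by simp
    have "1 \<le> y2 j" using lt y(3) y2(1)[of j] by (simp flip: ln_ge_zero_iff)
    then have "grows (y2, mutate j (mutate i C))"
      unfolding grows_def using C1 mutate_pair[OF C1(1) ij] y2 lt y(3) g2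
      by (simp add: skew_symmetrisable_mutate y2i)
    with lt show ?thesis unfolding ZC r1 r2 by simp
  qed
  have invY: "grows (Y n)" for n
  proof (induction n)
    case 0
    show ?case using sk by (simp add: Y_def grows_def)
  next
    case (Suc n)
    then show ?case using step by (simp add: Y_def)
  qed
  have "strict_mono (\<lambda>n. ln (fst (Y n) j))"
    unfolding strict_mono_Suc_iff using step[OF invY] by (simp add: Y_def)
  then have "inj (\<lambda>n. ln (fst (Y n) j))" by (rule strict_mono_imp_inj_on)
  then have "inj Y" unfolding inj_def by metis
  then have inf: "infinite (range Y)" by (simp add: range_inj_infinite)
  have "\<exists>ks. Y n = fold real_seed_mutate ks ((\<lambda>v. 1), B)" for n
  proof (induction n)
    case 0
    show ?case by (rule exI[of _ "[]"]) (simp add: Y_def)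
  next
    case (Suc n)
    then obtain ks where "Y n = fold real_seed_mutate ks ((\<lambda>v. 1), B)" by blast
    then show ?case by (intro exI[of _ "ks @ [i, j]"]) (simp add: Y_def)
  qed
  then have "range Y \<subseteq> range (\<lambda>ks. fold real_seed_mutate ks ((\<lambda>v. 1), B))" by blast
  with inf show ?thesis using infinite_super by blast
qed

text \<open>
  A matrix with a large product of opposite entries need not be the initial one. As real seed
  mutation is an involution, mutating the constant cluster \<open>1\<close> backwards gives the point at which the
  initial indeterminates have to be evaluated.
\<close>

theorem finite_type_imp_two_finite:
  fixes B :: "int ^ 'v ^ 'v::finite"
  assumes sk: "skew_symmetrisable B" and fin: "finite (mutation_class (indeterminate, B))"
  shows "two_finite B"
  unfolding two_finite_def
proof (intro conjI allI sk)
  fix ks and i j :: 'v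
  let ?C = "fold mutate ks B"
  show "\<bar>?C $ i $ j * ?C $ j $ i\<bar> \<le> 3"
  proof (rule ccontr)
    assume "\<not> ?thesis"
    then have big: "\<bar>?C $ i $ j * ?C $ j $ i\<bar> \<ge> 4" by simp
    have skC: "skew_symmetrisable ?C" by (rule skew_symmetrisable_fold_mutate[OF sk])
    let ?Z = "((\<lambda>v. 1), ?C) :: ('v \<Rightarrow> real) \<times> (int ^ 'v ^ 'v)"
    define y where "y = fst (fold real_seed_mutate (rev ks) ?Z)"
    have pos: "y v > 0" for v unfolding y_def by (rule fold_real_seed_mutate_pos) simp
    have undo: "fold mutate (rev ks) (fold mutate ks B) = B" using sk
    proof (induction ks arbitrary: B)
      case (Cons k ks)
      then show ?case
        by (simp add: skew_symmetrisable_mutate mutate_mutate skew_symmetrisable_diag)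
    qed simp
    have "fold real_seed_mutate (rev ks) ?Z = (y, B)"
      by (rule prod_eqI) (simp_all add: y_def snd_fold_real_seed_mutate undo)
    then have Z: "fold real_seed_mutate ks (y, B) = ?Z"
      using fold_real_seed_mutate_reverse[of ?Z ks] skC by simp
    have "range (\<lambda>js. fold real_seed_mutate js ?Z) \<subseteq> range (\<lambda>js. fold real_seed_mutate js (y, B))"
    proof (rule image_subsetI)
      fix js
      show "fold real_seed_mutate js ?Z \<in> range (\<lambda>js. fold real_seed_mutate js (y, B))"
        unfolding Z[symmetric] by (rule range_eqI[of _ _ "ks @ js"]) simp
    qed
    from finite_subset[OF this finite_real_seeds[OF fin pos]] infinite_rank2_orbit[OF skC big]
    show False by (rule notE[rotated])
  qed
qed

section \<open>Local structure of two-finite diagrams\<close>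

lemma two_finite_skew: "two_finite B \<Longrightarrow> skew_symmetrisable B"
  by (simp add: two_finite_def)

lemma two_finite_bound: "two_finite B \<Longrightarrow> \<bar>B $ i $ j * B $ j $ i\<bar> \<le> 3"
  unfolding two_finite_def by (metis fold_simps(1))

text \<open>
  Around a triangle the symmetrising factors cancel. For the weights this says that their product is
  a perfect square.
\<close>

lemma skew_symmetrisable_triple:
  assumes "skew_symmetrisable B"
  shows "B $ i $ k * B $ k $ j * B $ j $ i = - (B $ k $ i * B $ j $ k * B $ i $ j)"
proof -
  from assms obtain d :: "'a \<Rightarrow> real" where d: "\<And>i. d i > 0"
    and e: "\<And>i j. d i * of_int (B $ i $ j) = - (d j * of_int (B $ j $ i))"
    unfolding skew_symmetrisable_def by blast
  let ?b = "\<lambda>i j. real_of_int (B $ i $ j)"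
  have "(d i * d k * d j) * (?b i k * ?b k j * ?b j i) = (d i * ?b i k) * (d k * ?b k j) * (d j * ?b j i)"
    by (simp only: ac_simps)
  also have "\<dots> = - (d k * ?b k i) * - (d j * ?b j k) * - (d i * ?b i j)"
    by (simp only: e[of i k] e[of k j] e[of j i])
  also have "\<dots> = (d i * d k * d j) * - (?b k i * ?b j k * ?b i j)"
    by (simp only: minus_mult_minus mult_minus_right ac_simps)
  finally have "?b i k * ?b k j * ?b j i = - (?b k i * ?b j k * ?b i j)"
    by (rule mult_left_cancel[THEN iffD1, rotated]) (use d[of i] d[of j] d[of k] in simp)
  then have "real_of_int (B $ i $ k * B $ k $ j * B $ j $ i) = real_of_int (- (B $ k $ i * B $ j $ k * B $ i $ j))"
    by simp
  then show ?thesis by (simp only: of_int_eq_iff)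
qed

lemma diagram_of_pos:
  "skew_symmetrisable B \<Longrightarrow> diagram_of B i j \<noteq> 0 \<Longrightarrow> B $ i $ j > 0 \<and> B $ j $ i < 0 \<and>
     int (diagram_of B i j) = B $ i $ j * - (B $ j $ i)"
  using diagram_of_arrow_iff[of B i j] skew_symmetrisable_sgn[of B i j]
  by (auto simp: diagram_of_def abs_mult)

lemma diagram_of_antisym:
  "skew_symmetrisable B \<Longrightarrow> diagram_of B i j \<noteq> 0 \<Longrightarrow> diagram_of B j i = 0"
  using skew_symmetrisable_sgn[of B j i] diagram_of_arrow_iff[of B i j]
  by (simp add: diagram_of_def)

lemma diagram_of_irrefl: "skew_symmetrisable B \<Longrightarrow> diagram_of B i i = 0"
  by (simp add: diagram_of_def skew_symmetrisable_diag)

lemma small_factors: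
  fixes a a' :: int
  assumes "a > 0" "a' > 0" "a * a' \<le> 3"
  shows "a \<in> {1,2,3} \<and> a' \<in> {1,2,3}"
proof -
  have "a \<le> a * a'" "a' \<le> a * a'" using assms by simp_all
  with assms have "a \<le> 3" "a' \<le> 3" "a \<ge> 1" "a' \<ge> 1" by linarith+
  then show ?thesis by simp presburger
qed

text \<open>
  The last three bounds are those on the entry opposite to each of the three vertices after mutation
  there. They exclude the weights \<open>3, 3, 1\<close>, the only other ones whose product is a square.
\<close>

lemma oriented_triangle_arith:
  fixes a a' b b' c c' :: int
  assumes "a > 0" "a' > 0" "b > 0" "b' > 0" "c > 0" "c' > 0"
    and "a * a' \<le> 3" "b * b' \<le> 3" "c * c' \<le> 3"
    and "a * b * c = a' * b' * c'"
    and "\<bar>(a * b - c') * (c - a' * b')\<bar> \<le> 3"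
    and "\<bar>(b * c - a') * (a - b' * c')\<bar> \<le> 3"
    and "\<bar>(c * a - b') * (b - c' * a')\<bar> \<le> 3"
  shows "(a * a' = 1 \<and> b * b' = 1 \<and> c * c' = 1 \<and> a * b = c' \<and> a' * b' = c) \<or>
    (a * a' = 1 \<and> b * b' = 2 \<and> c * c' = 2 \<and> a * b = c' \<and> a' * b' = c) \<or>
    (a * a' = 2 \<and> b * b' = 1 \<and> c * c' = 2 \<and> a * b = c' \<and> a' * b' = c) \<or>
    (a * a' = 2 \<and> b * b' = 2 \<and> c * c' = 1 \<and> a * b > c' \<and> (a * b - c') * (a' * b' - c) = 1)"
proof -
  have w: "a \<in> {1,2,3} \<and> a' \<in> {1,2,3}" "b \<in> {1,2,3} \<and> b' \<in> {1,2,3}" "c \<in> {1,2,3} \<and> c' \<in> {1,2,3}"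
    by (rule small_factors; fact)+
  have "(a, a') \<in> set [(1,1), (1,2), (1,3), (2,1), (3,1)]"
    "(b, b') \<in> set [(1,1), (1,2), (1,3), (2,1), (3,1)]"
    "(c, c') \<in> set [(1,1), (1,2), (1,3), (2,1), (3,1)]"
  proof -
    have "(x, x') \<in> set [(1,1), (1,2), (1,3), (2,1), (3,1)]"
      if "x \<in> {1,2,3} \<and> x' \<in> {1,2,3}" "x * x' \<le> 3" for x x' :: int
      using that by auto
    with w show "(a, a') \<in> set [(1,1), (1,2), (1,3), (2,1), (3,1)]"
      "(b, b') \<in> set [(1,1), (1,2), (1,3), (2,1), (3,1)]"
      "(c, c') \<in> set [(1,1), (1,2), (1,3), (2,1), (3,1)]"
      using assms(7-9) by blast+
  qed
  \<comment> \<open>A finite check over all factorisations of the three weights.\<close>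
  moreover have "\<forall>(a, a') \<in> set [(1,1), (1,2), (1,3), (2,1), (3,1)].
    \<forall>(b, b') \<in> set [(1,1), (1,2), (1,3), (2,1), (3,1)].
    \<forall>(c, c') \<in> set [(1,1), (1,2), (1,3), (2,1), (3,1)].
    a * b * c = a' * b' * c' \<longrightarrow> \<bar>(a * b - c') * (c - a' * b')\<bar> \<le> 3 \<longrightarrow>
    \<bar>(b * c - a') * (a - b' * c')\<bar> \<le> 3 \<longrightarrow> \<bar>(c * a - b') * (b - c' * a')\<bar> \<le> 3 \<longrightarrow>
    (a * a' = 1 \<and> b * b' = 1 \<and> c * c' = 1 \<and> a * b = c' \<and> a' * b' = c) \<or>
    (a * a' = 1 \<and> b * b' = 2 \<and> c * c' = 2 \<and> a * b = c' \<and> a' * b' = c) \<or>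
    (a * a' = 2 \<and> b * b' = 1 \<and> c * c' = 2 \<and> a * b = c' \<and> a' * b' = c) \<or>
    (a * a' = 2 \<and> b * b' = 2 \<and> c * c' = 1 \<and> a * b > c' \<and> (a * b - c') * (a' * b' - c) = (1 :: int))"
    by code_simp
  ultimately show ?thesis using assms(10-13) by (simp only: Ball_def split_paired_All case_prod_conv)
qed

lemma mutate_triangle_entries:
  assumes "skew_symmetrisable B" "B $ i $ k > 0" "B $ k $ j > 0" "i \<noteq> k" "j \<noteq> k"
  shows "mutate k B $ i $ j = B $ i $ j + B $ i $ k * B $ k $ j"
    and "mutate k B $ j $ i = B $ j $ i - B $ k $ i * B $ j $ k"
proof -
  have "B $ k $ i < 0" "B $ j $ k < 0" using assms skew_symmetrisable_sgn by blast+
  with assms show "mutate k B $ i $ j = B $ i $ j + B $ i $ k * B $ k $ j"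
    "mutate k B $ j $ i = B $ j $ i - B $ k $ i * B $ j $ k"
    by (simp_all add: mutate_entry mult.commute)
qed

text \<open>
  The entries of the mutated matrix opposite to \<open>k\<close> are differences such as \<open>b\<^sub>i\<^sub>k b\<^sub>k\<^sub>j - \<bar>b\<^sub>i\<^sub>j\<bar>\<close>. The edge
  disappears, unless it has weight \<open>1\<close> and the other two have weight \<open>2\<close>; then it is turned around.
\<close>

lemma oriented_triangle_weights:
  fixes B :: "int ^ 'v ^ 'v::finite" and i j k :: 'v
  assumes tf: "two_finite B"
  defines "G \<equiv> diagram_of B" and "H \<equiv> diagram_of (mutate k B)"
  assumes "G i k \<noteq> 0" "G k j \<noteq> 0" "G j i \<noteq> 0"
  shows "(G i k, G k j, G j i, H i j, H j i) \<in> {(1,1,1,0,0), (1,2,2,0,0), (2,1,2,0,0), (2,2,1,1,0)}"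
proof -
  note sk = two_finite_skew[OF tf]
  note P = diagram_of_pos[OF sk, folded G_def]
  let ?a = "B $ i $ k" and ?a' = "- (B $ k $ i)" and ?b = "B $ k $ j" and ?b' = "- (B $ j $ k)"
    and ?c = "B $ j $ i" and ?c' = "- (B $ i $ j)"
  have ne: "i \<noteq> k" "j \<noteq> k" "j \<noteq> i" using assms diagram_of_irrefl[OF sk] by auto
  note sgn = P[OF assms(4)] P[OF assms(5)] P[OF assms(6)]
  have pos: "?a > 0" "?a' > 0" "?b > 0" "?b' > 0" "?c > 0" "?c' > 0" using sgn by auto
  have m: "\<bar>mutate l B $ x $ y * mutate l B $ y $ x\<bar> \<le> 3" for l x y
    by (rule two_finite_bound[OF two_finite_mutate[OF tf]])
  have w: "?a * ?a' \<le> 3" "?b * ?b' \<le> 3" "?c * ?c' \<le> 3"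
    using two_finite_bound[OF tf, of i k] two_finite_bound[OF tf, of k j] two_finite_bound[OF tf, of j i]
    by linarith+
  have t: "?a * ?b * ?c = ?a' * ?b' * ?c'"
    using skew_symmetrisable_triple[OF sk, of i k j] by simp
  have Hk: "mutate k B $ i $ j = ?a * ?b - ?c'" "mutate k B $ j $ i = ?c - ?a' * ?b'"
    using mutate_triangle_entries[OF sk, of i k j] sgn ne by auto
  have Hj: "mutate j B $ k $ i = ?b * ?c - ?a'" "mutate j B $ i $ k = ?a - ?b' * ?c'"
    using mutate_triangle_entries[OF sk, of k j i] sgn ne by auto
  have Hi: "mutate i B $ j $ k = ?c * ?a - ?b'" "mutate i B $ k $ j = ?b - ?c' * ?a'"
    using mutate_triangle_entries[OF sk, of j i k] sgn ne by auto
  note * = oriented_triangle_arith[OF pos w t m[of k i j, unfolded Hk] m[of j k i, unfolded Hj] m[of i j k, unfolded Hi]]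
  have G: "int (G i k) = ?a * ?a'" "int (G k j) = ?b * ?b'" "int (G j i) = ?c * ?c'" using sgn by auto
  have H: "H i j = (if ?a * ?b > ?c' then nat \<bar>(?a * ?b - ?c') * (?c - ?a' * ?b')\<bar> else 0)"
    "H j i = (if ?c > ?a' * ?b' then nat \<bar>(?c - ?a' * ?b') * (?a * ?b - ?c')\<bar> else 0)"
    unfolding H_def diagram_of_def Hk by auto
  have one: "x * y = 1 \<Longrightarrow> x > 0 \<Longrightarrow> x = 1 \<and> y = 1" for x y :: int
    by (simp add: zmult_eq_1_iff)
  from * show ?thesis
  proof (elim disjE conjE)
    assume h: "?a * ?a' = 1" "?b * ?b' = 1" "?c * ?c' = 1" "?a * ?b = ?c'" "?a' * ?b' = ?c"
    have "G i k = 1" "G k j = 1" "G j i = 1" using G h by linarith+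
    moreover have "H i j = 0" "H j i = 0" unfolding H using h by (simp_all only: less_irrefl if_False)
    ultimately show ?thesis by simp
  next
    assume h: "?a * ?a' = 1" "?b * ?b' = 2" "?c * ?c' = 2" "?a * ?b = ?c'" "?a' * ?b' = ?c"
    have "G i k = 1" "G k j = 2" "G j i = 2" using G h by linarith+
    moreover have "H i j = 0" "H j i = 0" unfolding H using h by (simp_all only: less_irrefl if_False)
    ultimately show ?thesis by simp
  next
    assume h: "?a * ?a' = 2" "?b * ?b' = 1" "?c * ?c' = 2" "?a * ?b = ?c'" "?a' * ?b' = ?c"
    have "G i k = 2" "G k j = 1" "G j i = 2" using G h by linarith+
    moreover have "H i j = 0" "H j i = 0" unfolding H using h by (simp_all only: less_irrefl if_False)
    ultimately show ?thesis by simp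
  next
    assume h: "?a * ?a' = 2" "?b * ?b' = 2" "?c * ?c' = 1" "?c' < ?a * ?b" "(?a * ?b - ?c') * (?a' * ?b' - ?c) = 1"
    have g: "G i k = 2" "G k j = 2" "G j i = 1" using G h by linarith+
    have e: "?a * ?b - ?c' = 1" "?a' * ?b' - ?c = 1" using one[OF h(5)] h(4) by simp_all
    then have e2: "?c - ?a' * ?b' = -1" by linarith
    have "H i j = 1" unfolding H e e2 using h(4) by simp
    moreover have "H j i = 0" unfolding H using e2 by (intro if_not_P) linarith
    ultimately show ?thesis using g by simp
  qed
qed

text \<open>
  The new entry is the sum of two positive integers in one direction and of two negative ones in the
  other, so the weight of the new edge would be at least \<open>4\<close>.
\<close>

lemma oriented_path_no_shortcut:
  assumes tf: "two_finite B"
  defines "G \<equiv> diagram_of B"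
  assumes "G i k \<noteq> 0" "G k j \<noteq> 0"
  shows "G i j = 0"
proof (rule ccontr)
  assume ij: "G i j \<noteq> 0"
  note sk = two_finite_skew[OF tf]
  note P = diagram_of_pos[OF sk, folded G_def]
  note sgn = P[OF assms(3)] P[OF assms(4)] P[OF ij]
  have ne: "i \<noteq> k" "j \<noteq> k" "j \<noteq> i" using assms ij diagram_of_irrefl[OF sk] by auto
  have "B $ i $ k * B $ k $ j > 0" "B $ k $ i * B $ j $ k > 0"
    using sgn by (auto intro: mult_pos_pos mult_neg_neg)
  moreover have "B $ i $ j > 0" "B $ j $ i < 0" using sgn by auto
  moreover have "mutate k B $ i $ j = B $ i $ j + B $ i $ k * B $ k $ j"
    "mutate k B $ j $ i = B $ j $ i - B $ k $ i * B $ j $ k"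
    using mutate_triangle_entries[OF sk, of i k j] sgn ne by auto
  ultimately have "mutate k B $ i $ j \<ge> 2" "- (mutate k B $ j $ i) \<ge> 2" by linarith+
  then have "2 * 2 \<le> mutate k B $ i $ j * - (mutate k B $ j $ i)" by (intro mult_mono) auto
  with two_finite_bound[OF two_finite_mutate[OF tf], of k i j] show False by linarith
qed

lemma diagram_mutate_incident:
  assumes "skew_symmetrisable B"
  shows "diagram_of (mutate k B) i k = diagram_of B k i" "diagram_of (mutate k B) k i = diagram_of B i k"
  using skew_symmetrisable_sgn[OF assms, of i k] skew_symmetrisable_sgn[OF assms, of k i]
  by (auto simp: diagram_of_def mutate_entry mult.commute)

lemma diagram_mutate_other:
  assumes sk: "skew_symmetrisable B" and ne: "i \<noteq> k" "j \<noteq> k"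
    and "\<not> (diagram_of B i k \<noteq> 0 \<and> diagram_of B k j \<noteq> 0)"
    and "\<not> (diagram_of B j k \<noteq> 0 \<and> diagram_of B k i \<noteq> 0)"
  shows "diagram_of (mutate k B) i j = diagram_of B i j"
proof -
  have "\<not> (B $ i $ k > 0 \<and> B $ k $ j > 0)" "\<not> (B $ i $ k < 0 \<and> B $ k $ j < 0)"
    "\<not> (B $ j $ k > 0 \<and> B $ k $ i > 0)" "\<not> (B $ j $ k < 0 \<and> B $ k $ i < 0)"
    using assms(4,5) skew_symmetrisable_sgn[OF sk] unfolding diagram_of_arrow_iff[OF sk] by blast+
  then have "mutate k B $ i $ j = B $ i $ j" "mutate k B $ j $ i = B $ j $ i"
    using ne by (auto simp: mutate_entry)
  then show ?thesis by (simp add: diagram_of_def)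
qed

text \<open>
  The new edge \<open>i \<rightarrow> j\<close> has the product of the two weights as its weight, and closes an oriented
  triangle in the mutated diagram. The classification of triangles there excludes the weight \<open>3\<close>.
\<close>

lemma oriented_path_weights:
  fixes B :: "int ^ 'v ^ 'v::finite" and i j k :: 'v
  assumes tf: "two_finite B"
  defines "G \<equiv> diagram_of B" and "H \<equiv> diagram_of (mutate k B)"
  assumes ik: "G i k \<noteq> 0" and kj: "G k j \<noteq> 0" and ji: "G j i = 0"
  shows "G i j = 0 \<and> H j i = 0 \<and> (G i k, G k j, H i j) \<in> {(1,1,1), (1,2,2), (2,1,2)}"
proof -
  note sk = two_finite_skew[OF tf]
  note tf' = two_finite_mutate[OF tf, of k]
  note P = diagram_of_pos[OF sk, folded G_def]
  have ij: "G i j = 0" using oriented_path_no_shortcut[OF tf] ik kj unfolding G_def by blast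
  note sgn = P[OF ik] P[OF kj]
  have ne: "i \<noteq> k" "j \<noteq> k" "j \<noteq> i" using assms diagram_of_irrefl[OF sk] diagram_of_antisym[OF sk, of i k] by auto
  have z: "B $ i $ j = 0" "B $ j $ i = 0"
    using ij ji diagram_of_arrow_iff[OF sk, of i j] diagram_of_arrow_iff[OF sk, of j i]
      skew_symmetrisable_sgn[OF sk, of i j] skew_symmetrisable_sgn[OF sk, of j i]
    unfolding G_def by (auto simp: not_less order.order_iff_strict)
  have m: "mutate k B $ i $ j = B $ i $ k * B $ k $ j" "mutate k B $ j $ i = - (B $ k $ i * B $ j $ k)"
    using mutate_triangle_entries[OF sk, of i k j] sgn ne z by auto
  have pos: "B $ i $ k * B $ k $ j > 0" "B $ k $ i * B $ j $ k > 0"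
    using sgn by (auto intro: mult_pos_pos mult_neg_neg)
  have Hij: "H i j = nat ((B $ i $ k * B $ k $ j) * (B $ k $ i * B $ j $ k))"
    unfolding H_def diagram_of_def m
    using mult_pos_pos[OF pos] pos(1) by (simp only: mult_minus_right abs_minus abs_of_pos if_True)
  have Hji: "H j i = 0" unfolding H_def diagram_of_def m using pos by simp
  have "int (H i j) = int (G i k) * int (G k j)"
  proof -
    have "int (H i j) = (B $ i $ k * B $ k $ j) * (B $ k $ i * B $ j $ k)"
      unfolding Hij using mult_pos_pos[OF pos] by simp
    then show ?thesis using sgn by (simp add: ac_simps)
  qed
  then have prod: "H i j = G i k * G k j" by (metis of_nat_eq_iff of_nat_mult)
  have Hnz: "H i j \<noteq> 0" using prod ik kj by simp
  have H2: "H j k \<noteq> 0" "H k i \<noteq> 0"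
    using ik kj diagram_mutate_incident[OF sk, of k] unfolding G_def H_def by simp_all
  have "(H i j, H j k, H k i) \<in> {(1,1,1), (1,2,2), (2,1,2), (2,2,1)}"
    using oriented_triangle_weights[OF tf', of i j k, folded H_def] Hnz H2 by auto
  moreover have "H j k = G k j" "H k i = G i k"
    using diagram_mutate_incident[OF sk, of k] unfolding G_def H_def by simp_all
  ultimately show ?thesis using ij Hji prod by auto
qed

section \<open>Chordless paths and cycles\<close>

fun arcs :: "'a list \<Rightarrow> ('a \<times> 'a) set" where
  "arcs (x # y # zs) = insert (x, y) (arcs (y # zs))"
| "arcs _ = {}"

lemma arcs_append: "arcs (xs @ a # ys) = arcs (xs @ [a]) \<union> arcs (a # ys)"
proof (induction xs rule: arcs.induct)
  case ("2_2" v)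
  show ?case by (cases ys) auto
qed auto

lemma arcs_snoc: "arcs (xs @ [a, b]) = insert (a, b) (arcs (xs @ [a]))"
  by (subst arcs_append) auto

lemma arcs_in_set: "(x, y) \<in> arcs xs \<Longrightarrow> x \<in> set (butlast xs) \<and> y \<in> set (tl xs)"
proof (induction xs rule: arcs.induct)
  case (1 u v zs)
  then show ?case by (cases zs) auto
qed auto

lemma arcs_nth: "(x, y) \<in> arcs xs \<longleftrightarrow> (\<exists>a. Suc a < length xs \<and> x = xs ! a \<and> y = xs ! Suc a)"
proof (induction xs rule: arcs.induct)
  case (1 u v zs)
  have "(\<exists>a. Suc a < length (u # v # zs) \<and> x = (u # v # zs) ! a \<and> y = (u # v # zs) ! Suc a) \<longleftrightarrow>
      (x = u \<and> y = v) \<or> (\<exists>a. Suc a < length (v # zs) \<and> x = (v # zs) ! a \<and> y = (v # zs) ! Suc a)"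
    (is "?L \<longleftrightarrow> _ \<or> ?R")
  proof
    assume ?L
    then obtain a where "Suc a < length (u # v # zs) \<and> x = (u # v # zs) ! a \<and> y = (u # v # zs) ! Suc a" by blast
    then show "(x = u \<and> y = v) \<or> ?R" by (cases a) auto
  next
    assume "(x = u \<and> y = v) \<or> ?R"
    then show ?L
    proof
      assume "x = u \<and> y = v"
      then show ?L by (intro exI[of _ 0]) simp
    next
      assume ?R
      then obtain a where "Suc a < length (v # zs) \<and> x = (v # zs) ! a \<and> y = (v # zs) ! Suc a" by blast
      then show ?L by (intro exI[of _ "Suc a"]) simp
    qed
  qed
  with 1 show ?case by simp
qed auto

text \<open>
  In a chordless cycle the arrows are described by the list of consecutive pairs, closed up by
  repeating the first vertex at the end. In this form rotation and the insertion or removal of a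
  vertex are plain list manipulations, without index arithmetic modulo the length.
\<close>

lemma chordless_cycle_iff:
  "chordless_cycle G cs \<longleftrightarrow> length cs \<ge> 3 \<and> distinct cs \<and>
     (\<forall>x \<in> set cs. \<forall>y \<in> set cs. G x y \<noteq> 0 \<longleftrightarrow> (x, y) \<in> arcs (cs @ [hd cs]))"
proof (cases "length cs \<ge> 3 \<and> distinct cs")
  case True
  let ?d = "length cs"
  have d: "?d > 0" "cs \<noteq> []" "distinct cs" using True by auto
  have nxt: "(cs @ [hd cs]) ! Suc a = cs ! ((a + 1) mod ?d)" if "a < ?d" for a
  proof (cases "Suc a < ?d")
    case False
    then have "Suc a = ?d" using that by simp
    then show ?thesis using d by (simp add: nth_append hd_conv_nth)
  qed (simp add: nth_append)
  have "(cs ! a, cs ! b) \<in> arcs (cs @ [hd cs]) \<longleftrightarrow> b = (a + 1) mod ?d" if "a < ?d" "b < ?d" for a b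
  proof -
    have "(cs ! a, cs ! b) \<in> arcs (cs @ [hd cs]) \<longleftrightarrow>
        (\<exists>c < ?d. cs ! a = cs ! c \<and> cs ! b = cs ! ((c + 1) mod ?d))"
    proof -
      have e: "(cs @ [hd cs]) ! c = cs ! c" if "c < ?d" for c using that by (simp add: nth_append)
      show ?thesis unfolding arcs_nth length_append_singleton Suc_less_eq
        by (simp only: nxt e cong: conj_cong)
    qed
    also have "\<dots> \<longleftrightarrow> cs ! b = cs ! ((a + 1) mod ?d)"
      using that d by (auto simp: nth_eq_iff_index_eq)
    also have "\<dots> \<longleftrightarrow> b = (a + 1) mod ?d"
      using that d by (simp add: nth_eq_iff_index_eq)
    finally show ?thesis .
  qed
  then have "(\<forall>x \<in> set cs. \<forall>y \<in> set cs. G x y \<noteq> 0 \<longleftrightarrow> (x, y) \<in> arcs (cs @ [hd cs])) \<longleftrightarrow>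
      (\<forall>a < ?d. \<forall>b < ?d. G (cs ! a) (cs ! b) \<noteq> 0 \<longleftrightarrow> b = (a + 1) mod ?d)"
    unfolding all_set_conv_all_nth by simp
  then show ?thesis unfolding chordless_cycle_def by simp
qed (auto simp: chordless_cycle_def)

lemma arcs_rotate: "arcs ((ys @ xs) @ [hd (ys @ xs)]) = arcs ((xs @ ys) @ [hd (xs @ ys)])"
proof (cases "xs = [] \<or> ys = []")
  case False
  then obtain x xs' y ys' where "xs = x # xs'" "ys = y # ys'" by (meson neq_Nil_conv)
  then show ?thesis
    using arcs_append[of "x # xs'" y "ys' @ [x]"] arcs_append[of "y # ys'" x "xs' @ [y]"] by auto
qed auto

lemma chordless_cycle_append_commute: "chordless_cycle G (xs @ ys) \<longleftrightarrow> chordless_cycle G (ys @ xs)"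
  unfolding chordless_cycle_iff arcs_rotate[of xs ys] by auto

lemma chordless_cycle_rotate: "chordless_cycle G (rotate n cs) \<longleftrightarrow> chordless_cycle G cs"
  using chordless_cycle_append_commute[of G "take (n mod length cs) cs" "drop (n mod length cs) cs"]
  by (simp add: rotate_drop_take)

definition chordless_path :: "'v diagram \<Rightarrow> 'v list \<Rightarrow> bool" where
  "chordless_path G xs \<longleftrightarrow> distinct xs \<and>
     (\<forall>x \<in> set xs. \<forall>y \<in> set xs. G x y \<noteq> 0 \<longleftrightarrow> (x, y) \<in> arcs xs)"

lemma chordless_path_of_cycle:
  assumes "chordless_cycle G (ps @ q # qs)" "ps \<noteq> []"
  shows "chordless_path G ps"
  unfolding chordless_path_def
proof (intro conjI ballI)
  have dist: "distinct (ps @ q # qs)" using assms by (simp add: chordless_cycle_iff)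
  then show "distinct ps" by simp
  fix x y assume xy: "x \<in> set ps" "y \<in> set ps"
  obtain ps' p where ps: "ps = ps' @ [p]" using assms(2) by (metis append_butlast_last_id)
  have "arcs ((ps @ q # qs) @ [hd ps]) = arcs (ps @ [q]) \<union> arcs (q # qs @ [hd ps])"
    using arcs_append[of ps q "qs @ [hd ps]"] by simp
  also have "arcs (ps @ [q]) = insert (p, q) (arcs ps)" using arcs_snoc[of ps' p q] ps by simp
  finally have "(x, y) \<in> arcs ((ps @ q # qs) @ [hd ps]) \<longleftrightarrow> (x, y) \<in> arcs ps"
    using xy dist arcs_in_set[of x y "q # qs @ [hd ps]"] by (auto simp: butlast_append)
  then show "G x y \<noteq> 0 \<longleftrightarrow> (x, y) \<in> arcs ps"
    using assms xy by (auto simp: chordless_cycle_iff)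
qed

definition adjacent :: "'v diagram \<Rightarrow> 'v \<Rightarrow> 'v \<Rightarrow> bool" where
  "adjacent G x y \<longleftrightarrow> G x y \<noteq> 0 \<or> G y x \<noteq> 0"

text \<open>
  Mutation at an inner vertex \<open>u\<close> of an oriented path creates the arrow from its predecessor to its
  successor and changes no other edge between the remaining vertices.
\<close>

lemma chordless_path_contract:
  fixes B :: "int ^ 'v ^ 'v::finite"
  assumes tf: "two_finite B" and p: "chordless_path (diagram_of B) (x # u # h # R)"
  shows "chordless_path (diagram_of (mutate u B)) (x # h # R)"
proof -
  let ?G = "diagram_of B" and ?H = "diagram_of (mutate u B)"
  note sk = two_finite_skew[OF tf]
  have dist: "distinct (x # u # h # R)" using p by (simp add: chordless_path_def)
  have G: "?G a b \<noteq> 0 \<longleftrightarrow> (a, b) = (x, u) \<or> (a, b) = (u, h) \<or> (a, b) \<in> arcs (h # R)"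
    if "a \<in> set (x # u # h # R)" "b \<in> set (x # u # h # R)" for a b
  proof -
    have "?G a b \<noteq> 0 \<longleftrightarrow> (a, b) \<in> arcs (x # u # h # R)"
      using p that unfolding chordless_path_def by blast
    then show ?thesis by simp
  qed
  have sub: "a \<in> set (h # R)" "b \<in> set R" if "(a, b) \<in> arcs (h # R)" for a b
    using arcs_in_set[OF that] in_set_butlastD[of a "h # R"] by simp_all
  have notin: "(a, x) \<notin> arcs (h # R)" "(x, a) \<notin> arcs (h # R)"
    "(a, u) \<notin> arcs (h # R)" "(u, a) \<notin> arcs (h # R)" for a
    using sub[of a x] sub[of x a] sub[of a u] sub[of u a] dist by auto
  have xu: "?G x u \<noteq> 0" "?G u h \<noteq> 0" "?G h x = 0"
    using G[of x u] G[of u h] G[of h x] dist notin by simp_all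
  have H1: "?H x h \<noteq> 0" "?H h x = 0"
    using oriented_path_weights[OF tf xu] by auto
  have "?H a b \<noteq> 0 \<longleftrightarrow> (a, b) \<in> insert (x, h) (arcs (h # R))"
    if ab: "a \<in> insert x (set (h # R))" "b \<in> insert x (set (h # R))" for a b
  proof (cases "(a, b) = (x, h) \<or> (a, b) = (h, x)")
    case True
    then show ?thesis using H1 notin dist by auto
  next
    case False
    have ne: "a \<noteq> u" "b \<noteq> u" using ab dist by auto
    have au: "c = x" if "?G c u \<noteq> 0" "c \<in> insert x (set (h # R))" for c
      using that G[of c u] notin dist by auto
    have ub: "c = h" if "?G u c \<noteq> 0" "c \<in> insert x (set (h # R))" for c
      using that G[of u c] notin dist by auto
    have "?H a b = ?G a b"
      by (rule diagram_mutate_other[OF sk ne]) (use au ub ab False in blast)+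
    then show ?thesis using G[of a b] ab False ne by auto
  qed
  with dist show ?thesis by (simp add: chordless_path_def)
qed

text \<open>
  Together with \<open>k\<close> the path forms a chordless cycle, which has to be cyclically oriented. Contracting
  the inner vertices one by one leaves a triangle \<open>x\<close>, \<open>y\<close>, \<open>k\<close>; if it is not cyclically oriented, it
  has an oriented path of length two together with a parallel arrow.
\<close>

lemma path_attachment:
  fixes B :: "int ^ 'v ^ 'v::finite"
  assumes "two_finite B" and "chordless_path (diagram_of B) (x # us @ [y])"
    and "k \<notin> set (x # us @ [y])" and "\<forall>u \<in> set us. \<not> adjacent (diagram_of B) k u"
    and "adjacent (diagram_of B) k x" "adjacent (diagram_of B) k y"
  shows "diagram_of B y k \<noteq> 0 \<and> diagram_of B k x \<noteq> 0"
  using assms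
proof (induction us arbitrary: B)
  case Nil
  let ?G = "diagram_of B"
  have xy: "?G x y \<noteq> 0" using Nil.prems(2) by (auto simp: chordless_path_def)
  note N = oriented_path_no_shortcut[OF Nil.prems(1)]
  from Nil.prems(5,6) show ?case
    using N[of x y k] N[of k x y] N[of x k y] xy unfolding adjacent_def by metis
next
  case (Cons u us)
  let ?G = "diagram_of B" and ?H = "diagram_of (mutate u B)"
  note sk = two_finite_skew[OF Cons.prems(1)]
  obtain h R where hR: "us @ [y] = h # R" by (cases us) auto
  have p: "chordless_path ?H (x # us @ [y])"
    using chordless_path_contract[of B x u h R] Cons.prems(1,2) hR by simp
  have dist: "distinct (x # u # us @ [y])" using Cons.prems(2) by (simp add: chordless_path_def)
  have ku: "?G k u = 0" "?G u k = 0" using Cons.prems(4) by (auto simp: adjacent_def)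
  have same: "?H k v = ?G k v \<and> ?H v k = ?G v k" if "v \<noteq> u" for v
  proof -
    have "k \<noteq> u" using Cons.prems(3) by auto
    with that ku show ?thesis by (auto intro!: diagram_mutate_other[OF sk])
  qed
  have ne: "x \<noteq> u" "y \<noteq> u" "\<forall>v \<in> set us. v \<noteq> u" using dist by auto
  have "?H y k \<noteq> 0 \<and> ?H k x \<noteq> 0"
    by (rule Cons.IH[OF two_finite_mutate[OF Cons.prems(1)] p])
       (use Cons.prems(3-6) same ne in \<open>auto simp: adjacent_def\<close>)
  then show ?case using same ne by auto
qed

text \<open>
  Two neighbours of \<open>k\<close> on the cycle with no further neighbour between them bound an oriented arc, and
  \<open>path_attachment\<close> directs the edges at \<open>k\<close>: out of \<open>k\<close> to the beginning of the arc, into \<open>k\<close> from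
  its end. For two arcs that share an endpoint this is contradictory at that endpoint, unless one of
  the arcs is too long to be chordless, its ends being adjacent through the rest of the cycle. Hence
  there are exactly two neighbours and they are consecutive, with the arrow \<open>a \<rightarrow> b\<close> between them
  closing the rotated list.
\<close>

lemma cycle_attachment:
  fixes B :: "int ^ 'v ^ 'v::finite"
  assumes tf: "two_finite B" and c: "chordless_cycle (diagram_of B) cs" and k: "k \<notin> set cs"
  shows "(\<exists>x. \<forall>v \<in> set cs. adjacent (diagram_of B) k v \<longrightarrow> v = x) \<or>
    (\<exists>n b zs a. rotate n cs = b # zs @ [a] \<and> diagram_of B b k \<noteq> 0 \<and> diagram_of B k a \<noteq> 0 \<and>
       (\<forall>z \<in> set zs. \<not> adjacent (diagram_of B) k z))"
proof (rule disjCI)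
  let ?G = "diagram_of B"
  let ?adj = "adjacent ?G k"
  note sk = two_finite_skew[OF tf]
  assume "\<not> (\<exists>n b zs a. rotate n cs = b # zs @ [a] \<and> ?G b k \<noteq> 0 \<and> ?G k a \<noteq> 0 \<and> (\<forall>z \<in> set zs. \<not> ?adj z))"
  then have goal: "\<And>n b zs a. rotate n cs = b # zs @ [a] \<Longrightarrow> ?G b k \<noteq> 0 \<Longrightarrow> ?G k a \<noteq> 0 \<Longrightarrow>
    (\<forall>z \<in> set zs. \<not> ?adj z) \<Longrightarrow> False" by blast
  show "\<exists>x. \<forall>v \<in> set cs. ?adj v \<longrightarrow> v = x"
  proof (rule ccontr)
    assume none: "\<nexists>x. \<forall>v \<in> set cs. ?adj v \<longrightarrow> v = x"
    then obtain x where x: "x \<in> set cs" "?adj x" by blast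
    from none obtain q where q: "q \<in> set cs" "?adj q" "q \<noteq> x" by blast
    from x(1) obtain c1 c2 where cs: "cs = c1 @ x # c2" by (meson split_list)
    define n where "n = length c1"
    have rn: "rotate n cs = x # c2 @ c1" by (simp add: n_def cs rotate_append)
    have "\<exists>y \<in> set (c2 @ c1). ?adj y" using q unfolding cs by auto
    from split_list_first_prop[OF this] obtain us y ws where
      spl: "c2 @ c1 = us @ y # ws" and y: "?adj y" and us: "\<forall>u \<in> set us. \<not> ?adj u" by blast
    have rcs: "rotate n cs = x # us @ y # ws" using rn spl by simp
    have rot: "rotate (n + length ps) cs = qs @ ps" if "x # us @ y # ws = ps @ qs" for ps qs
      using rcs that by (metis add.commute rotate_append rotate_rotate)
    have cyc: "chordless_cycle ?G (qs @ ps)" if "x # us @ y # ws = ps @ qs" for ps qs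
      using rot[OF that] chordless_cycle_rotate[of ?G "n + length ps" cs] c by simp
    have kn: "k \<notin> set (x # us @ y # ws)" using k unfolding rcs[symmetric] by simp
    show False
    proof (cases "ws = []")
      case True
      have "length (x # us @ y # ws) \<ge> 3" using cyc[of "[]"] by (simp add: chordless_cycle_iff)
      then obtain v vs where v: "us = v # vs" using True by (cases us) auto
      have "chordless_path ?G [y, x]"
        using cyc[of "x # us" "y # ws"] by (intro chordless_path_of_cycle[of _ _ v vs]) (simp_all add: v True)
      then have "?G x k \<noteq> 0 \<and> ?G k y \<noteq> 0"
        using path_attachment[OF tf, of y "[]" x k] kn x(2) y by auto
      moreover have "rotate n cs = x # us @ [y]" using rcs True by simp
      ultimately show False using goal us by blast
    next
      case False
      then obtain w ws' where w: "ws = w # ws'" by (meson neq_Nil_conv)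
      have "chordless_path ?G (x # us @ [y])"
        using cyc[of "[]" "x # us @ y # ws"] by (intro chordless_path_of_cycle[of _ _ w ws']) (simp_all add: w)
      then have yx: "?G y k \<noteq> 0 \<and> ?G k x \<noteq> 0"
        using path_attachment[OF tf, of x us y k] kn x(2) y us by auto
      show False
      proof (cases "\<exists>z \<in> set ws. ?adj z")
        case True
        from split_list_first_prop[OF this] obtain us2 z ws2 where
          ws: "ws = us2 @ z # ws2" and z: "?adj z" and us2: "\<forall>u \<in> set us2. \<not> ?adj u" by blast
        obtain w v where wv: "ws2 @ x # us = w # v" by (cases ws2) auto
        have "chordless_path ?G (y # us2 @ [z])"
          using cyc[of "x # us" "y # ws"]
          by (intro chordless_path_of_cycle[of _ _ w v]) (simp_all add: ws wv[symmetric])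
        then have "?G z k \<noteq> 0 \<and> ?G k y \<noteq> 0"
          using path_attachment[OF tf, of y us2 z k] kn y z us2 ws by auto
        then show False using yx diagram_of_antisym[OF sk, of k y] by auto
      next
        case nows: False
        show False
        proof (cases us)
          case Nil
          have "rotate (n + length [x]) cs = y # ws @ [x]" using rot[of "[x]" "y # ws"] Nil by simp
          then show False using goal yx nows by blast
        next
          case (Cons v vs)
          have "chordless_path ?G (y # ws @ [x])"
            using cyc[of "x # us" "y # ws"]
            by (intro chordless_path_of_cycle[of _ _ v vs]) (simp_all add: Cons)
          then have "?G x k \<noteq> 0 \<and> ?G k y \<noteq> 0"
            using path_attachment[OF tf, of y ws x k] kn y x nows by auto
          then show False using yx diagram_of_antisym[OF sk, of k y] by auto
        qed
      qed
    qed
  qed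
qed

lemma arcs_notin: "x \<notin> set xs \<Longrightarrow> (x, y) \<notin> arcs xs \<and> (y, x) \<notin> arcs xs"
proof -
  have "set (butlast xs) \<subseteq> set xs" "set (tl xs) \<subseteq> set xs"
    by (auto dest: in_set_butlastD simp: list.set_sel(2)) (cases xs; simp)
  then show "x \<notin> set xs \<Longrightarrow> ?thesis"
    using arcs_in_set[of x y xs] arcs_in_set[of y x xs] by blast
qed

lemma arcs_closed: "arcs ((x # xs @ [y]) @ [hd (x # xs @ [y])]) = insert (y, x) (arcs (x # xs @ [y]))"
  using arcs_snoc[of "x # xs" y x] by simp

lemma chordless_cycleD:
  assumes "chordless_cycle G (x # xs @ [y])" "u \<in> set (x # xs @ [y])" "v \<in> set (x # xs @ [y])"
  shows "G u v \<noteq> 0 \<longleftrightarrow> (u, v) = (y, x) \<or> (u, v) \<in> arcs (x # xs @ [y])"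
proof -
  have "G u v \<noteq> 0 \<longleftrightarrow> (u, v) \<in> arcs ((x # xs @ [y]) @ [hd (x # xs @ [y])])"
    using assms unfolding chordless_cycle_iff by blast
  then show ?thesis unfolding arcs_closed by simp
qed

lemma chordless_cycleI:
  assumes "xs \<noteq> []" "distinct (x # xs @ [y])"
    and "\<And>u v. u \<in> set (x # xs @ [y]) \<Longrightarrow> v \<in> set (x # xs @ [y]) \<Longrightarrow>
      G u v \<noteq> 0 \<longleftrightarrow> (u, v) = (y, x) \<or> (u, v) \<in> arcs (x # xs @ [y])"
  shows "chordless_cycle G (x # xs @ [y])"
  unfolding chordless_cycle_iff arcs_closed
proof (intro conjI ballI)
  show "3 \<le> length (x # xs @ [y])" using assms(1) by (cases xs) auto
qed (use assms(2,3) in auto)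

text \<open>
  The triangle \<open>a \<rightarrow> b \<rightarrow> k \<rightarrow> a\<close> cannot have weight \<open>1\<close> on \<open>a \<rightarrow> b\<close> and weight \<open>2\<close> on the other two edges:
  mutation would reverse the edge \<open>a \<rightarrow> b\<close>, and the rest of the cycle would become a chordless cycle
  that is not cyclically oriented. So the edge disappears, and the path \<open>a \<rightarrow> k \<rightarrow> b\<close> takes its place.
\<close>

lemma cycle_insert:
  fixes C :: "int ^ 'v ^ 'v::finite" and a b k :: 'v
  defines "H \<equiv> diagram_of C" and "G \<equiv> diagram_of (mutate k C)"
  assumes tf: "two_finite C" and cyc: "chordless_cycle H (b # zs @ [a])"
    and k: "k \<notin> set (b # zs @ [a])" and bk: "H b k \<noteq> 0" and ka: "H k a \<noteq> 0"
    and zs: "\<forall>z \<in> set zs. \<not> adjacent H k z"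
  shows "chordless_cycle G (b # (zs @ [a]) @ [k])"
    and "(G k b, G a k, H a b) \<in> {(1,1,1), (1,2,2), (2,1,2)}"
    and "G a b = 0" "G b a = 0"
    and "\<And>x y. x \<in> set (b # zs @ [a]) \<Longrightarrow> y \<in> set (b # zs @ [a]) \<Longrightarrow> (x, y) \<noteq> (a, b) \<Longrightarrow>
      (x, y) \<noteq> (b, a) \<Longrightarrow> G x y = H x y"
proof -
  note sk = two_finite_skew[OF tf]
  note tf' = two_finite_mutate[OF tf, of k]
  note sk' = two_finite_skew[OF tf']
  note anti = diagram_of_antisym[OF sk, folded H_def]
  note inc = diagram_mutate_incident[OF sk, of k, folded G_def H_def]
  have dist: "distinct (b # zs @ [a])" and len: "length (b # zs @ [a]) \<ge> 3"
    using cyc by (simp_all add: chordless_cycle_iff)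
  note cD = chordless_cycleD[OF cyc]
  have ab: "H a b \<noteq> 0" using cD[of a b] by simp
  have tri: "(H b k, H k a, H a b, G b a, G a b) \<in> {(1,1,1,0,0), (1,2,2,0,0), (2,1,2,0,0), (2,2,1,1,0)}"
    using oriented_triangle_weights[OF tf, of b k a, folded H_def G_def] bk ka ab by blast
  have xk: "H x k \<noteq> 0 \<longleftrightarrow> x = b" "H k x \<noteq> 0 \<longleftrightarrow> x = a" if "x \<in> set (b # zs @ [a])" for x
    using that zs bk ka anti[OF bk] anti[OF ka] by (auto simp: adjacent_def)
  show same: "G x y = H x y" if "x \<in> set (b # zs @ [a])" "y \<in> set (b # zs @ [a])"
     "(x, y) \<noteq> (a, b)" "(x, y) \<noteq> (b, a)" for x y
    unfolding G_def H_def
    by (rule diagram_mutate_other[OF sk], fold H_def) (use that xk k in auto)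
  obtain us y where us: "zs = us @ [y]" using len by (cases zs rule: rev_cases) auto
  have arcs1: "arcs (b # zs @ [a]) = insert (y, a) (arcs (b # zs))"
    using arcs_snoc[of "b # us" y a] us by simp
  show ba0: "G b a = 0"
  proof (rule ccontr)
    assume ba: "G b a \<noteq> 0"
    have p: "chordless_path H (b # zs)"
      using chordless_path_of_cycle[of H "b # zs" a "[]"] cyc by simp
    have "chordless_path G (b # us @ [y])"
      unfolding chordless_path_def
    proof (intro conjI ballI)
      show "distinct (b # us @ [y])" using dist us by simp
      fix u v assume uv: "u \<in> set (b # us @ [y])" "v \<in> set (b # us @ [y])"
      then have "G u v = H u v" using same[of u v] dist us by auto
      moreover have "H u v \<noteq> 0 \<longleftrightarrow> (u, v) \<in> arcs (b # us @ [y])"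
        using p uv unfolding chordless_path_def us by blast
      ultimately show "G u v \<noteq> 0 \<longleftrightarrow> (u, v) \<in> arcs (b # us @ [y])" by simp
    qed
    moreover have "\<not> adjacent G a u" if "u \<in> set us" for u
    proof -
      have "u \<noteq> b" "u \<noteq> y" "u \<noteq> a" "u \<in> set (b # zs @ [a])" using that dist us by auto
      moreover have "a \<notin> set (b # zs)" using dist by auto
      ultimately show ?thesis
        using same[of u a] same[of a u] cD[of u a] cD[of a u] arcs_notin[of a "b # zs"]
        unfolding adjacent_def arcs1 by auto
    qed
    moreover have "adjacent G a b" using ba by (simp add: adjacent_def)
    moreover have "G y a \<noteq> 0" using same[of y a] cD[of y a] dist us arcs1 by auto
    then have "adjacent G a y" by (simp add: adjacent_def)
    moreover have "a \<notin> set (b # us @ [y])" using dist us by auto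
    ultimately have "G y a \<noteq> 0 \<and> G a b \<noteq> 0"
      by (intro path_attachment[OF tf', folded G_def]) auto
    then have "G a b \<noteq> 0" ..
    with ba show False using diagram_of_antisym[OF sk', folded G_def, of a b] by simp
  qed
  show ab0: "G a b = 0" using tri by auto
  show "(G k b, G a k, H a b) \<in> {(1,1,1), (1,2,2), (2,1,2)}"
    using tri ba0 inc by auto
  have ac: "arcs (b # (zs @ [a]) @ [k]) = insert (a, k) (arcs (b # zs @ [a]))"
    using arcs_snoc[of "b # zs" a k] by simp
  have nab: "(a, b) \<notin> arcs (b # zs @ [a])"
    using arcs_in_set[of a b "b # zs @ [a]"] dist by auto
  have nba: "(b, a) \<notin> arcs (b # zs @ [a])"
    using cD[of b a] anti[OF ab] by simp
  \<comment> \<open>It remains to compare arrows with consecutive pairs, separately for pairs involving \<open>k\<close> and the pair \<open>a\<close>, \<open>b\<close>.\<close>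
  have kk: "G k k = 0" using diagram_of_irrefl[OF sk'] by (simp add: G_def)
  show "chordless_cycle G (b # (zs @ [a]) @ [k])"
  proof (rule chordless_cycleI)
    fix u v assume "u \<in> set (b # (zs @ [a]) @ [k])" "v \<in> set (b # (zs @ [a]) @ [k])"
    then have uv: "u = k \<or> u \<in> set (b # zs @ [a])" "v = k \<or> v \<in> set (b # zs @ [a])" by auto
    have nk: "(k, w) \<notin> arcs (b # zs @ [a])" "(w, k) \<notin> arcs (b # zs @ [a])" for w
      using arcs_notin[OF k] by auto
    have kab: "k \<noteq> a" "k \<noteq> b" using k by auto
    show "G u v \<noteq> 0 \<longleftrightarrow> (u, v) = (k, b) \<or> (u, v) \<in> arcs (b # (zs @ [a]) @ [k])"
    proof (cases "u = k")
      case True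
      then show ?thesis unfolding ac using uv nk kk inc xk(1)[of v] kab by auto
    next
      case u: False
      show ?thesis
      proof (cases "v = k")
        case True
        then show ?thesis unfolding ac using u uv nk inc xk(2)[of u] by auto
      next
        case v: False
        with u uv have uv': "u \<in> set (b # zs @ [a])" "v \<in> set (b # zs @ [a])" by auto
        show ?thesis
        proof (cases "(u, v) = (a, b) \<or> (u, v) = (b, a)")
          case True
          then show ?thesis unfolding ac using ab0 ba0 nab nba u v by auto
        next
          case False
          then show ?thesis unfolding ac using same[OF uv'] cD[OF uv'] u v by auto
        qed
      qed
    qed
  qed (use dist k in auto)
qed

text \<open>
  The converse of \<open>cycle_insert\<close>: a cycle of length at least four through \<open>k\<close> loses \<open>k\<close>, and the arrow
  created between the neighbours of \<open>k\<close> closes it again.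
\<close>

lemma cycle_remove:
  fixes C :: "int ^ 'v ^ 'v::finite" and i j k :: 'v
  defines "H \<equiv> diagram_of C" and "G \<equiv> diagram_of (mutate k C)"
  assumes tf: "two_finite C" and cyc: "chordless_cycle H (k # (j # zs) @ [i])" and ne: "zs \<noteq> []"
  shows "chordless_cycle G (j # zs @ [i])"
    and "(H i k, H k j, G i j) \<in> {(1,1,1), (1,2,2), (2,1,2)}" and "G j i = 0"
    and "\<And>x y. x \<in> set (j # zs @ [i]) \<Longrightarrow> y \<in> set (j # zs @ [i]) \<Longrightarrow> (x, y) \<noteq> (i, j) \<Longrightarrow>
      (x, y) \<noteq> (j, i) \<Longrightarrow> G x y = H x y"
proof -
  note sk = two_finite_skew[OF tf]
  have dist: "distinct (k # j # zs @ [i])" using cyc by (simp add: chordless_cycle_iff)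
  have cD: "H u v \<noteq> 0 \<longleftrightarrow> (u, v) = (i, k) \<or> (u, v) = (k, j) \<or> (u, v) \<in> arcs (j # zs @ [i])"
    if "u \<in> set (k # j # zs @ [i])" "v \<in> set (k # j # zs @ [i])" for u v
    using chordless_cycleD[OF cyc, of u v] that by simp
  have nk: "(k, w) \<notin> arcs (j # zs @ [i])" "(w, k) \<notin> arcs (j # zs @ [i])" for w
    using arcs_notin[of k "j # zs @ [i]"] dist by auto
  obtain z zs' where z: "zs = z # zs'" using ne by (cases zs) auto
  have nji: "(j, i) \<notin> arcs (j # zs @ [i])"
    using dist arcs_notin[of j "z # zs' @ [i]"] by (auto simp: z)
  have nij: "(i, j) \<notin> arcs (j # zs @ [i])"
    using arcs_in_set[of i j "j # zs @ [i]"] dist by auto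
  have ikj: "H i k \<noteq> 0" "H k j \<noteq> 0" "H j i = 0"
    using cD[of i k] cD[of k j] cD[of j i] dist nji by auto
  have w: "H i j = 0 \<and> G j i = 0 \<and> (H i k, H k j, G i j) \<in> {(1,1,1), (1,2,2), (2,1,2)}"
    using oriented_path_weights[OF tf, of i k j, folded H_def G_def] ikj by blast
  then show "(H i k, H k j, G i j) \<in> {(1,1,1), (1,2,2), (2,1,2)}" and ji0: "G j i = 0" by auto
  have xk: "H x k \<noteq> 0 \<longleftrightarrow> x = i" "H k x \<noteq> 0 \<longleftrightarrow> x = j" if "x \<in> set (j # zs @ [i])" for x
    using that cD[of x k] cD[of k x] dist nk by auto
  show same: "G x y = H x y" if "x \<in> set (j # zs @ [i])" "y \<in> set (j # zs @ [i])"
     "(x, y) \<noteq> (i, j)" "(x, y) \<noteq> (j, i)" for x y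
    unfolding G_def H_def
    by (rule diagram_mutate_other[OF sk], fold H_def) (use that xk dist in auto)
  show "chordless_cycle G (j # zs @ [i])"
  proof (rule chordless_cycleI)
    fix u v assume uv: "u \<in> set (j # zs @ [i])" "v \<in> set (j # zs @ [i])"
    then have uvk: "u \<noteq> k" "v \<noteq> k" using dist by auto
    show "G u v \<noteq> 0 \<longleftrightarrow> (u, v) = (i, j) \<or> (u, v) \<in> arcs (j # zs @ [i])"
    proof (cases "(u, v) = (i, j) \<or> (u, v) = (j, i)")
      case True
      then show ?thesis using w ji0 nji dist by auto
    next
      case False
      then show ?thesis using same[OF uv] cD[of u v] uv uvk by auto
    qed
  qed (use ne dist in auto)
qed

text \<open>
  Since no arrow joins vertices of a chordless cycle other than those of the cycle itself, the
  conditions on the weights can be stated for all pairs of its vertices. Only the condition on the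
  last edge depends on the vertex at which the cycle is read.
\<close>

lemma T3_cycle_iff:
  "T3_cycle G cs \<longleftrightarrow> chordless_cycle G cs \<and>
     ((\<forall>x \<in> set cs. \<forall>y \<in> set cs. G x y \<le> 1) \<or>
      (\<forall>x \<in> set cs. \<forall>y \<in> set cs. G x y \<le> 2) \<and> G (last cs) (hd cs) = 2)"
proof (cases "chordless_cycle G cs")
  case True
  let ?d = "length cs"
  have d: "?d \<ge> 3" "cs \<noteq> []" using True by (auto simp: chordless_cycle_def)
  have E: "G (cs ! a) (cs ! b) \<noteq> 0 \<longleftrightarrow> b = (a + 1) mod ?d" if "a < ?d" "b < ?d" for a b
    using True that by (auto simp: chordless_cycle_def)
  let ?w = "\<lambda>a. G (cs ! a) (cs ! ((a + 1) mod ?d))"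
  have le: "(\<forall>a < ?d. 0 < ?w a \<and> ?w a \<le> m) \<longleftrightarrow> (\<forall>x \<in> set cs. \<forall>y \<in> set cs. G x y \<le> m)" for m
    unfolding all_set_conv_all_nth
  proof (intro iffI allI impI)
    fix a b assume w: "\<forall>a < ?d. 0 < ?w a \<and> ?w a \<le> m" and ab: "a < ?d" "b < ?d"
    show "G (cs ! a) (cs ! b) \<le> m"
    proof (cases "b = (a + 1) mod ?d")
      case True
      then show ?thesis using w ab by blast
    next
      case False
      then have "G (cs ! a) (cs ! b) = 0" using E[OF ab] by blast
      then show ?thesis by simp
    qed
  next
    fix a assume w: "\<forall>a < ?d. \<forall>b < ?d. G (cs ! a) (cs ! b) \<le> m" and a: "a < ?d"
    have b: "(a + 1) mod ?d < ?d" using d by (intro mod_less_divisor) simp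
    show "0 < ?w a \<and> ?w a \<le> m" using E[OF a b] w a b by blast
  qed
  have "?d - 1 + 1 = ?d" using d by linarith
  then have "?w (?d - 1) = G (last cs) (hd cs)"
    using d by (simp add: last_conv_nth hd_conv_nth)
  moreover have "(\<forall>a < ?d. ?w a = 1) \<longleftrightarrow> (\<forall>a < ?d. 0 < ?w a \<and> ?w a \<le> 1)"
    by (intro all_cong1 imp_cong HOL.refl) linarith
  moreover have "(\<forall>a < ?d. ?w a \<in> {1, 2}) \<longleftrightarrow> (\<forall>a < ?d. 0 < ?w a \<and> ?w a \<le> 2)"
    by (intro all_cong1 imp_cong HOL.refl) auto
  ultimately show ?thesis using True unfolding T3_cycle_def Let_def le by simp
qed (simp add: T3_cycle_def)

section \<open>Conjugation and braid relations\<close>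

context group
begin

definition conjugate :: "'a \<Rightarrow> 'a \<Rightarrow> 'a" where
  "conjugate g x = g \<otimes> x \<otimes> inv g"

definition commutes :: "'a \<Rightarrow> 'a \<Rightarrow> bool" where
  "commutes x y \<longleftrightarrow> x \<otimes> y = y \<otimes> x"

fun alternating_product :: "'a \<Rightarrow> 'a \<Rightarrow> nat \<Rightarrow> 'a" where
  "alternating_product x y 0 = \<one>"
| "alternating_product x y (Suc m) = x \<otimes> alternating_product y x m"

definition braid :: "nat \<Rightarrow> 'a \<Rightarrow> 'a \<Rightarrow> bool" where
  "braid m x y \<longleftrightarrow> alternating_product x y m = alternating_product y x m"

lemma commutes_sym: "commutes x y \<longleftrightarrow> commutes y x"
  by (auto simp: commutes_def)

lemma braid_sym: "braid m x y \<longleftrightarrow> braid m y x"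
  by (auto simp: braid_def)

lemma conjugate_closed [simp]:
  "g \<in> carrier G \<Longrightarrow> x \<in> carrier G \<Longrightarrow> conjugate g x \<in> carrier G"
  by (simp add: conjugate_def)

lemma conjugate_conjugate:
  "g \<in> carrier G \<Longrightarrow> h \<in> carrier G \<Longrightarrow> x \<in> carrier G \<Longrightarrow>
    conjugate g (conjugate h x) = conjugate (g \<otimes> h) x"
  by (simp add: conjugate_def m_assoc inv_mult_group)

lemma conjugate_one [simp]: "x \<in> carrier G \<Longrightarrow> conjugate \<one> x = x"
  by (simp add: conjugate_def)

lemma conjugate_of_one [simp]: "g \<in> carrier G \<Longrightarrow> conjugate g \<one> = \<one>"
  by (simp add: conjugate_def)

lemma conjugate_cancel [simp]:
  assumes "g \<in> carrier G" "x \<in> carrier G"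
  shows "conjugate g (conjugate (inv g) x) = x" "conjugate (inv g) (conjugate g x) = x"
  using assms by (simp_all add: conjugate_conjugate)

lemma mult_inv_cancel:
  assumes "g \<in> carrier G" "x \<in> carrier G"
  shows "g \<otimes> (inv g \<otimes> x) = x" "inv g \<otimes> (g \<otimes> x) = x"
  using assms by (simp_all add: m_assoc[symmetric])

lemma conjugate_mult:
  "g \<in> carrier G \<Longrightarrow> x \<in> carrier G \<Longrightarrow> y \<in> carrier G \<Longrightarrow>
    conjugate g (x \<otimes> y) = conjugate g x \<otimes> conjugate g y"
  by (simp add: conjugate_def m_assoc mult_inv_cancel)

lemma conjugate_eq_iff:
  assumes "g \<in> carrier G" "x \<in> carrier G" "y \<in> carrier G"
  shows "conjugate g x = conjugate g y \<longleftrightarrow> x = y"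
  using assms conjugate_cancel(2)[of g x] conjugate_cancel(2)[of g y] by metis

lemma inv_conjugate:
  "g \<in> carrier G \<Longrightarrow> x \<in> carrier G \<Longrightarrow> inv (conjugate g x) = conjugate g (inv x)"
  by (simp add: conjugate_def inv_mult_group m_assoc)

lemma conjugate_by_conjugate:
  "g \<in> carrier G \<Longrightarrow> x \<in> carrier G \<Longrightarrow> y \<in> carrier G \<Longrightarrow>
    conjugate (conjugate g x) y = conjugate g (conjugate x (conjugate (inv g) y))"
  by (simp add: conjugate_def m_assoc inv_mult_group)

lemma conjugate_fixes_iff:
  assumes "g \<in> carrier G" "x \<in> carrier G"
  shows "conjugate g x = x \<longleftrightarrow> commutes g x"
  using assms inv_solve_right'[of x "g \<otimes> x" g]
  unfolding conjugate_def commutes_def by (auto simp: m_assoc)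

lemma conjugate_self [simp]: "g \<in> carrier G \<Longrightarrow> conjugate g g = g"
  by (simp add: conjugate_fixes_iff commutes_def)

lemma commutes_conjugate:
  "g \<in> carrier G \<Longrightarrow> x \<in> carrier G \<Longrightarrow> y \<in> carrier G \<Longrightarrow>
    commutes (conjugate g x) (conjugate g y) \<longleftrightarrow> commutes x y"
  unfolding commutes_def by (simp add: conjugate_mult[symmetric] conjugate_eq_iff)

lemma commutes_conjugate_left:
  assumes "g \<in> carrier G" "x \<in> carrier G" "y \<in> carrier G"
  shows "commutes (conjugate g x) y \<longleftrightarrow> commutes x (conjugate (inv g) y)"
  using commutes_conjugate[of g x "conjugate (inv g) y"] assms by simp

lemma commutes_conjugate_right:
  assumes "g \<in> carrier G" "x \<in> carrier G" "y \<in> carrier G"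
  shows "commutes x (conjugate g y) \<longleftrightarrow> commutes (conjugate (inv g) x) y"
  using commutes_conjugate_left[of g y x] commutes_sym assms by metis

lemma commutes_inv:
  assumes "g \<in> carrier G" "x \<in> carrier G" "commutes g x"
  shows "commutes (inv g) x"
  using assms conjugate_fixes_iff[of g x] conjugate_fixes_iff[of "inv g" x] conjugate_cancel(2)[of g x]
  by simp

lemma alternating_product_closed [simp]:
  "x \<in> carrier G \<Longrightarrow> y \<in> carrier G \<Longrightarrow> alternating_product x y m \<in> carrier G"
  by (induction m arbitrary: x y) auto

lemma alternating_product_conjugate:
  "g \<in> carrier G \<Longrightarrow> x \<in> carrier G \<Longrightarrow> y \<in> carrier G \<Longrightarrow>
    alternating_product (conjugate g x) (conjugate g y) m = conjugate g (alternating_product x y m)"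
  by (induction m arbitrary: x y) (auto simp: conjugate_mult)

lemma braid_conjugate:
  "g \<in> carrier G \<Longrightarrow> x \<in> carrier G \<Longrightarrow> y \<in> carrier G \<Longrightarrow>
    braid m (conjugate g x) (conjugate g y) \<longleftrightarrow> braid m x y"
  unfolding braid_def by (simp add: alternating_product_conjugate conjugate_eq_iff)

lemma braid_2: "x \<in> carrier G \<Longrightarrow> y \<in> carrier G \<Longrightarrow> braid 2 x y \<longleftrightarrow> commutes x y"
  by (simp add: braid_def commutes_def numeral_2_eq_2)

lemma braid_3:
  assumes "x \<in> carrier G" "y \<in> carrier G"
  shows "braid 3 x y \<longleftrightarrow> x \<otimes> (y \<otimes> x) = y \<otimes> (x \<otimes> y)"
  using assms by (simp add: braid_def numeral_3_eq_3)

lemma braid_4: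
  assumes "x \<in> carrier G" "y \<in> carrier G"
  shows "braid 4 x y \<longleftrightarrow> x \<otimes> (y \<otimes> (x \<otimes> y)) = y \<otimes> (x \<otimes> (y \<otimes> x))"
  using assms by (simp add: braid_def eval_nat_numeral)

lemma braid_3_conjugate:
  assumes c: "x \<in> carrier G" "y \<in> carrier G" and b: "braid 3 x y"
  shows "conjugate x y = conjugate (inv y) x"
proof -
  have "y \<otimes> (x \<otimes> (y \<otimes> inv x)) = (x \<otimes> (y \<otimes> x)) \<otimes> inv x"
    using b c by (simp add: braid_3 m_assoc)
  also have "\<dots> = x \<otimes> y" using c by (simp add: m_assoc)
  finally have "inv y \<otimes> (y \<otimes> (x \<otimes> (y \<otimes> inv x))) = inv y \<otimes> (x \<otimes> y)" by simp
  then show ?thesis using c by (simp add: mult_inv_cancel conjugate_def m_assoc)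
qed

text \<open>
  The square of \<open>x y\<close> is central in the group generated by \<open>x\<close> and \<open>y\<close>; this is the form in which
  relations of length four are used below.
\<close>

lemma braid_4_central:
  assumes c: "x \<in> carrier G" "y \<in> carrier G" and b: "braid 4 x y"
  shows "commutes (x \<otimes> (y \<otimes> (x \<otimes> y))) y" "commutes (x \<otimes> (y \<otimes> (x \<otimes> y))) x"
proof -
  note e = b[unfolded braid_4[OF c]]
  have "(x \<otimes> (y \<otimes> (x \<otimes> y))) \<otimes> y = (y \<otimes> (x \<otimes> (y \<otimes> x))) \<otimes> y" by (simp only: e)
  also have "\<dots> = y \<otimes> (x \<otimes> (y \<otimes> (x \<otimes> y)))" using c by (simp add: m_assoc)
  finally show "commutes (x \<otimes> (y \<otimes> (x \<otimes> y))) y" by (simp only: commutes_def)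
  have "(x \<otimes> (y \<otimes> (x \<otimes> y))) \<otimes> x = x \<otimes> (y \<otimes> (x \<otimes> (y \<otimes> x)))"
    using c by (simp add: m_assoc)
  then show "commutes (x \<otimes> (y \<otimes> (x \<otimes> y))) x" by (simp only: commutes_def e)
qed

text \<open>
  This lemma and the next one transport the relation of a triangle with weights \<open>2, 2, 1\<close>. Writing
  \<open>y = x w x\<^sup>-\<^sup>1\<close> with \<open>w\<close> commuting with \<open>z\<close>, the element in question is \<open>w\<close> conjugated by \<open>x z x\<close>, and so
  also by \<open>x z x z\<close>, which commutes with \<open>z\<close>.
\<close>

lemma braid_4_commutes_twice:
  assumes c: "x \<in> carrier G" "y \<in> carrier G" "z \<in> carrier G"
    and b: "braid 4 x z" and yz: "commutes z (conjugate (inv x) y)"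
  shows "commutes z (conjugate x (conjugate z y))"
proof -
  let ?w = "conjugate (inv x) y" and ?c = "x \<otimes> (z \<otimes> (x \<otimes> z))"
  have "conjugate x (conjugate z y) = conjugate (x \<otimes> (z \<otimes> x)) ?w"
    using c by (simp add: conjugate_conjugate m_assoc)
  also have "\<dots> = conjugate (x \<otimes> (z \<otimes> x)) (conjugate z ?w)"

    using yz c conjugate_fixes_iff[of z ?w] by simp
  also have "\<dots> = conjugate ?c ?w" using c by (simp add: conjugate_conjugate m_assoc)
  finally have e: "conjugate x (conjugate z y) = conjugate ?c ?w" .
  have "conjugate ?c z = z" using braid_4_central[OF _ _ b] c by (simp add: conjugate_fixes_iff)
  then have "commutes z (conjugate ?c ?w) \<longleftrightarrow> commutes z ?w"
    using commutes_conjugate[of ?c z ?w] c by simp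
  with yz e show ?thesis by simp
qed

lemma braid_4_commutes_twice_inv:
  assumes c: "x \<in> carrier G" "y \<in> carrier G" "z \<in> carrier G"
    and b: "braid 4 x z" and yz: "commutes z (conjugate x y)"
  shows "commutes z (conjugate (inv x) (conjugate (inv z) y))"
proof -
  let ?w = "conjugate x y" and ?c = "z \<otimes> (x \<otimes> (z \<otimes> x))"
  have "conjugate (inv x) (conjugate (inv z) y) = conjugate (inv x) (conjugate (inv z) (conjugate (inv x) ?w))"
    using c by simp
  also have "\<dots> = conjugate (inv x) (conjugate (inv z) (conjugate (inv x) (conjugate (inv z) ?w)))"
    using yz c conjugate_fixes_iff[of "inv z" ?w] commutes_inv[of z ?w] by simp
  also have "\<dots> = conjugate (inv ?c) ?w"
    using c by (simp add: conjugate_conjugate inv_mult_group m_assoc)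
  finally have e: "conjugate (inv x) (conjugate (inv z) y) = conjugate (inv ?c) ?w" .
  have "commutes ?c z"
    using braid_4_central(2)[of z x] b c braid_sym by blast
  then have "conjugate (inv ?c) z = z" using c commutes_inv[of ?c z] by (simp add: conjugate_fixes_iff)
  then have "commutes z (conjugate (inv ?c) ?w) \<longleftrightarrow> commutes z ?w"
    using commutes_conjugate[of "inv ?c" z ?w] c by simp
  with yz e show ?thesis by simp
qed

text \<open>
  The braid relation across the triangle with weights \<open>2, 2, 1\<close>, where mutation turns the edge of
  weight \<open>1\<close> around. The key identity is \<open>(z y)\<^sup>-\<^sup>1 y (z y) = z y z\<^sup>-\<^sup>1\<close>.
\<close>

lemma braid_4_braid_3:
  assumes c: "x \<in> carrier G" "y \<in> carrier G" "z \<in> carrier G"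
    and b4: "braid 4 z y" and b3: "braid 3 x y" and zx: "commutes z (conjugate (inv y) x)"
  shows "braid 3 (conjugate z x) y"
proof -
  let ?w = "conjugate (inv y) x"
  have "conjugate (inv (z \<otimes> y)) y = conjugate z y"
  proof -
    have "(z \<otimes> y) \<otimes> (z \<otimes> (y \<otimes> inv z)) = (z \<otimes> (y \<otimes> (z \<otimes> y))) \<otimes> inv z" using c by (simp add: m_assoc)
    also have "\<dots> = (y \<otimes> (z \<otimes> (y \<otimes> z))) \<otimes> inv z" using b4 c by (simp add: braid_4)
    also have "\<dots> = y \<otimes> (z \<otimes> y)" using c by (simp add: m_assoc)
    finally have "inv (z \<otimes> y) \<otimes> ((z \<otimes> y) \<otimes> (z \<otimes> (y \<otimes> inv z))) = inv (z \<otimes> y) \<otimes> (y \<otimes> (z \<otimes> y))" by simp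
    then have "z \<otimes> (y \<otimes> inv z) = inv (z \<otimes> y) \<otimes> (y \<otimes> (z \<otimes> y))"
      using c mult_inv_cancel(2)[of "z \<otimes> y" "z \<otimes> (y \<otimes> inv z)"] by simp
    then show ?thesis using c by (simp add: conjugate_def m_assoc)
  qed
  moreover have "conjugate (inv (z \<otimes> y)) (conjugate z x) = ?w"
    using c by (simp add: inv_mult_group conjugate_conjugate[symmetric])
  ultimately have "braid 3 (conjugate z x) y \<longleftrightarrow> braid 3 ?w (conjugate z y)"
    using braid_conjugate[of "inv (z \<otimes> y)" "conjugate z x" y 3] c by simp
  also have "\<dots> \<longleftrightarrow> braid 3 (conjugate z ?w) (conjugate z y)"
    using zx c conjugate_fixes_iff[of z ?w] by simp
  also have "\<dots> \<longleftrightarrow> braid 3 ?w y" using c by (simp add: braid_conjugate)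
  also have "\<dots> \<longleftrightarrow> braid 3 x y"
    using braid_conjugate[of y ?w y 3] c by simp
  finally show ?thesis using b3 by simp
qed

text \<open>
  The word \<open>p(i\<^sub>0, i\<^sub>1)\<close> is the last generator of the cycle conjugated successively by the inverses of
  the inner ones.
\<close>

definition chain :: "('v \<Rightarrow> 'a) \<Rightarrow> 'v list \<Rightarrow> 'a \<Rightarrow> 'a" where
  "chain f us x = foldr (\<lambda>u. conjugate (inv (f u))) us x"

lemma chain_simps [simp]:
  "chain f [] x = x" "chain f (u # us) x = conjugate (inv (f u)) (chain f us x)"
  "chain f (us @ vs) x = chain f us (chain f vs x)"
  by (simp_all add: chain_def)

lemma chain_closed [simp]:
  "(\<And>u. f u \<in> carrier G) \<Longrightarrow> x \<in> carrier G \<Longrightarrow> chain f us x \<in> carrier G"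
  by (induction us) simp_all

lemma chain_cong: "(\<And>u. u \<in> set us \<Longrightarrow> f u = h u) \<Longrightarrow> chain f us x = chain h us x"
  by (induction us) simp_all

lemma conjugate_swap:
  assumes "g \<in> carrier G" "h \<in> carrier G" "x \<in> carrier G" "commutes g h"
  shows "conjugate (inv h) (conjugate g x) = conjugate g (conjugate (inv h) x)"
proof -
  have "inv h \<otimes> g = g \<otimes> inv h"
    using assms commutes_inv[of h g] commutes_sym[of g h] by (simp add: commutes_def)
  then show ?thesis using assms by (simp add: conjugate_conjugate)
qed

lemma chain_conjugate:
  assumes "\<And>u. f u \<in> carrier G" "g \<in> carrier G" "x \<in> carrier G"
    and "\<And>u. u \<in> set us \<Longrightarrow> commutes g (f u)"
  shows "chain f us (conjugate g x) = conjugate g (chain f us x)"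
  using assms(4) by (induction us) (simp_all add: assms(1-3) conjugate_swap)

text \<open>
  Conjugation by a common element is an automorphism, so it may be applied to all generators of a
  cycle relation at once.
\<close>

lemma chain_all_conjugate:
  assumes "\<And>u. f u \<in> carrier G" "g \<in> carrier G" "x \<in> carrier G"
    and "\<And>u. u \<in> set us \<Longrightarrow> h u = conjugate g (f u)"
  shows "chain h us (conjugate g x) = conjugate g (chain f us x)"
  using assms(4)
  by (induction us) (simp_all add: assms(1-3) inv_conjugate conjugate_by_conjugate)

definition cycle_relation :: "('v \<Rightarrow> 'a) \<Rightarrow> 'v list \<Rightarrow> bool" where
  "cycle_relation f cs \<longleftrightarrow> commutes (f (hd cs)) (chain f (butlast (tl cs)) (f (last cs)))"

lemma cycle_relation_Cons [simp]:
  "cycle_relation f (v # us @ [w]) \<longleftrightarrow> commutes (f v) (chain f us (f w))"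
  by (simp add: cycle_relation_def)

end

section \<open>The mutated generators\<close>

definition (in group) satisfies_artin :: "'v diagram \<Rightarrow> ('v \<Rightarrow> 'a) \<Rightarrow> bool" where
  "satisfies_artin D f \<longleftrightarrow>
     (\<forall>i j. i \<noteq> j \<longrightarrow> braid (m_exponent D i j) (f i) (f j)) \<and>
     (\<forall>cs. T3_cycle D cs \<longrightarrow> cycle_relation f cs)"

lemma m_exponent_sym: "m_exponent D i j = m_exponent D j i"
  by (simp add: m_exponent_def add.commute)

lemma m_exponent_cong: "D i j + D j i = E x y + E y x \<Longrightarrow> m_exponent D i j = m_exponent E x y"
  by (simp add: m_exponent_def)

lemma list_Cons_snoc: "length cs \<ge> 2 \<Longrightarrow> \<exists>v us w. cs = v # us @ [w]"
  by (cases cs; cases "tl cs" rule: rev_cases) auto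

text \<open>
  The known relations are those of the mutated diagram \<open>D\<close>, and those of \<open>H\<close> are to be derived for the
  elements \<open>t\<close>. As mutation at \<open>k\<close> is an involution, every finite-type mutation has this form, in
  either direction.
\<close>

locale mutated_generators = group G for G (structure) +
  fixes C :: "int ^ 'v ^ 'v::finite" and k :: 'v and s :: "'v \<Rightarrow> 'a"
  assumes two_finite: "two_finite C"
    and s_closed [simp]: "s v \<in> carrier G"
    and relations: "satisfies_artin (diagram_of (mutate k C)) s"
begin

abbreviation H :: "'v diagram" where "H \<equiv> diagram_of C"
abbreviation D :: "'v diagram" where "D \<equiv> diagram_of (mutate k C)"

definition t :: "'v \<Rightarrow> 'a" where
  "t v = (if D v k \<noteq> 0 then conjugate (s k) (s v) else s v)"

lemma skew: "skew_symmetrisable C" and two_finite': "two_finite (mutate k C)"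
  and skew': "skew_symmetrisable (mutate k C)" and mutate_back: "mutate k (mutate k C) = C"
  using two_finite_skew[OF two_finite] two_finite_mutate[OF two_finite, of k]
  by (auto intro: two_finite_skew mutate_mutate skew_symmetrisable_diag)

lemmas H_antisym = diagram_of_antisym[OF skew]
lemmas D_antisym = diagram_of_antisym[OF skew']
lemmas D_irrefl [simp] = diagram_of_irrefl[OF skew']
lemmas D_incident = diagram_mutate_incident[OF skew, of k]

lemma t_closed [simp]: "t v \<in> carrier G"
  by (simp add: t_def)

lemma t_k [simp]: "t k = s k"
  by (simp add: t_def)

lemma t_other: "D v k = 0 \<Longrightarrow> t v = s v"
  by (simp add: t_def)

lemma t_conjugate: "D v k \<noteq> 0 \<Longrightarrow> t v = conjugate (s k) (s v)"
  by (simp add: t_def)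

lemma D_braid: "i \<noteq> j \<Longrightarrow> braid (m_exponent D i j) (s i) (s j)"
  using relations by (simp add: satisfies_artin_def)

lemma D_cycle: "T3_cycle D cs \<Longrightarrow> cycle_relation s cs"
  using relations by (simp add: satisfies_artin_def)

lemma D_commutes: "i \<noteq> j \<Longrightarrow> D i j = 0 \<Longrightarrow> D j i = 0 \<Longrightarrow> commutes (s i) (s j)"
  using D_braid[of i j] by (simp add: m_exponent_def braid_2)

lemma D_braid_3: "D i j = 1 \<Longrightarrow> braid 3 (s i) (s j) \<and> braid 3 (s j) (s i)"
  using D_braid[of i j] D_antisym[of i j] braid_sym
  by (cases "i = j") (auto simp: m_exponent_def)

lemma D_braid_4: "D i j = 2 \<Longrightarrow> braid 4 (s i) (s j) \<and> braid 4 (s j) (s i)"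
  using D_braid[of i j] D_antisym[of i j] braid_sym
  by (cases "i = j") (auto simp: m_exponent_def)

text \<open>
  For triangles of weights \<open>1, 2, 2\<close> the relation is available only at the two vertices at which an
  edge of weight \<open>2\<close> ends.
\<close>

lemma D_triangle:
  assumes "D x y \<noteq> 0" "D y z \<noteq> 0" "D z x \<noteq> 0" "D x y \<le> 2" "D y z \<le> 2" "D z x \<le> 2"
    and "D x y = 1 \<and> D y z = 1 \<and> D z x = 1 \<or> D z x = 2"
  shows "commutes (s x) (conjugate (inv (s y)) (s z))"
proof -
  have ne: "x \<noteq> y" "y \<noteq> z" "z \<noteq> x" using assms(1-3) by auto
  note z = D_antisym[OF assms(1)] D_antisym[OF assms(2)] D_antisym[OF assms(3)]
  have "chordless_cycle D (x # [y] @ [z])"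
    by (rule chordless_cycleI) (use ne z assms(1-3) in auto)
  then have "T3_cycle D [x, y, z]"
    using assms z unfolding T3_cycle_iff by auto
  from D_cycle[OF this] show ?thesis using cycle_relation_Cons[of s x "[y]" z] by simp
qed

text \<open>
  The one case of the braid relations in which the two generators are not conjugated alike. If \<open>i\<close>
  and \<open>j\<close> are not joined, one of the edges at \<open>k\<close> has weight \<open>1\<close>; the braid relation of length three
  there moves the conjugation over to the other generator, and what remains is the relation along
  the other edge. If they are joined, either the relation of the triangle says that the two elements
  commute, or the weights are \<open>2, 2, 1\<close> and \<open>braid_4_braid_3\<close> applies.
\<close>

lemma braid_mixed:
  assumes "i \<noteq> j" and ik: "D i k \<noteq> 0" and kj: "D k j \<noteq> 0"
  shows "braid (m_exponent H i j) (conjugate (s k) (s i)) (s j)"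
proof (cases "D j i = 0")
  case True
  note w = oriented_path_weights[OF two_finite' ik kj True, unfolded mutate_back]
  have ne: "k \<noteq> j" "i \<noteq> k" using ik kj D_irrefl by metis+
  have "commutes (s i) (s j)" using D_commutes[OF assms(1)] True w by simp
  then have cm: "conjugate (inv (s i)) (s j) = s j" "conjugate (s j) (s i) = s i"
    using conjugate_fixes_iff[of "inv (s i)" "s j"] conjugate_fixes_iff[of "s j" "s i"]
      commutes_inv[of "s i" "s j"] commutes_sym by auto
  show ?thesis
  proof (cases "D i k = 1")
    case 1: True
    have "m_exponent H i j = m_exponent D k j"
      by (rule m_exponent_cong) (use w 1 D_antisym[OF kj] in auto)
    moreover have "conjugate (s k) (s i) = conjugate (inv (s i)) (s k)"
      using D_braid_3[OF 1] by (intro braid_3_conjugate) auto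
    ultimately show ?thesis
      using braid_conjugate[of "inv (s i)" "s k" "s j" "m_exponent D k j"] cm D_braid[OF ne(1)]
      by simp
  next
    case False
    then have 1: "D k j = 1" using w by auto
    have "m_exponent H i j = m_exponent D i k"
      by (rule m_exponent_cong) (use w 1 D_antisym[OF ik] in auto)
    moreover have "conjugate (s j) (s k) = conjugate (inv (s k)) (s j)"
      using D_braid_3[OF 1] by (intro braid_3_conjugate) auto
    moreover have "braid m (conjugate (s k) (s i)) (s j) \<longleftrightarrow> braid m (s i) (conjugate (inv (s k)) (s j))" for m
      using braid_conjugate[of "s k" "s i" "conjugate (inv (s k)) (s j)" m] by simp
    ultimately show ?thesis
      using braid_conjugate[of "s j" "s i" "s k" "m_exponent D i k"] cm D_braid[OF ne(2)]
      by simp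
  qed
next
  case False
  note w = oriented_triangle_weights[OF two_finite' ik kj False, unfolded mutate_back]
  show ?thesis
  proof (cases "H i j = 0")
    case True
    have "commutes (s i) (conjugate (inv (s k)) (s j))"
      by (rule D_triangle) (use w True in auto)
    then have "commutes (conjugate (s k) (s i)) (s j)" by (simp add: commutes_conjugate_left)
    moreover have "m_exponent H i j = 2" using w True by (auto simp: m_exponent_def)
    ultimately show ?thesis by (simp add: braid_2)
  next
    case H1: False
    have v: "D i k = 2" "D k j = 2" "D j i = 1" "H i j = 1" "H j i = 0" using w H1 by auto
    have "commutes (s k) (conjugate (inv (s j)) (s i))"
      by (rule D_triangle) (use v in auto)
    then have "braid 3 (conjugate (s k) (s i)) (s j)"
      using D_braid_4[OF v(2)] D_braid_3[OF v(3)] by (intro braid_4_braid_3) auto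
    then show ?thesis using v by (simp add: m_exponent_def)
  qed
qed

lemma t_conjugate_unlinked: "D k v = 0 \<Longrightarrow> t v = conjugate (s k) (s v)"
  using D_commutes[of k v] conjugate_fixes_iff[of "s k" "s v"]
  by (cases "v = k") (auto simp: t_def)

lemma H_D_same:
  assumes "i \<noteq> k" "j \<noteq> k" "\<not> (D i k \<noteq> 0 \<and> D k j \<noteq> 0)" "\<not> (D j k \<noteq> 0 \<and> D k i \<noteq> 0)"
  shows "D i j = H i j"
  by (rule diagram_mutate_other[OF skew assms(1,2)]) (use assms(3,4) D_incident in auto)

lemma t_braid:
  assumes "i \<noteq> j"
  shows "braid (m_exponent H i j) (t i) (t j)"
proof -
  have incident: "m_exponent H i k = m_exponent D i k" for i
    by (rule m_exponent_cong) (use D_incident in simp)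
  have inc: "braid (m_exponent H i k) (t i) (t k)" if "i \<noteq> k" for i
  proof (cases "D i k \<noteq> 0")
    case True
    then show ?thesis
      using D_braid[OF that] braid_conjugate[of "s k" "s i" "s k"]
      by (simp add: incident t_conjugate)
  next
    case False
    then show ?thesis using D_braid[OF that] by (simp add: incident t_other)
  qed
  show ?thesis
  proof (cases "i = k \<or> j = k")
    case True
    then show ?thesis
      using inc[of i] inc[of j] assms m_exponent_sym[of H i j] braid_sym by metis
  next
    case ne: False
    show ?thesis
    proof (cases "(D i k \<noteq> 0 \<and> D k j \<noteq> 0) \<or> (D j k \<noteq> 0 \<and> D k i \<noteq> 0)")
      case True
      then show ?thesis
      proof
        assume *: "D i k \<noteq> 0 \<and> D k j \<noteq> 0"
        then have "t i = conjugate (s k) (s i)" "t j = s j"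
          using D_antisym[of k j] by (auto intro: t_conjugate t_other)
        then show ?thesis using braid_mixed[OF assms] * by simp
      next
        assume *: "D j k \<noteq> 0 \<and> D k i \<noteq> 0"
        then have "t j = conjugate (s k) (s j)" "t i = s i"
          using D_antisym[of k i] by (auto intro: t_conjugate t_other)
        then show ?thesis using braid_mixed[of j i] assms * m_exponent_sym[of H i j] braid_sym by auto
      qed
    next
      case False
      then have "D i j = H i j" "D j i = H j i" using H_D_same[of i j] H_D_same[of j i] ne by auto
      then have m: "m_exponent H i j = m_exponent D i j" by (simp add: m_exponent_def)
      show ?thesis
      proof (cases "D i k \<noteq> 0 \<or> D j k \<noteq> 0")
        case True
        then have "t i = conjugate (s k) (s i)" "t j = conjugate (s k) (s j)"
          using False D_antisym t_conjugate_unlinked t_conjugate by metis+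
        then show ?thesis using D_braid[OF assms] by (simp add: m braid_conjugate)
      next
        case no: False
        then show ?thesis using D_braid[OF assms] by (simp add: m t_other)
      qed
    qed
  qed
qed

lemma cycle_relation_uniform:
  assumes "\<And>v. v \<in> set cs \<Longrightarrow> f v = conjugate g (s v)" "g \<in> carrier G" "cs = v # us @ [w]"
    and "cycle_relation s cs"
  shows "cycle_relation f cs"
proof -
  have "chain f us (f w) = conjugate g (chain s us (s w))"
    using assms(1,3) chain_all_conjugate[of s g "s w" us f] assms(2) by simp
  then show ?thesis using assms commutes_conjugate[of g "s v" "chain s us (s w)"]
    by simp
qed

text \<open>
  Generators of vertices not joined to \<open>k\<close> are fixed by conjugation with \<open>s\<^sub>k\<close>. So with at most one
  neighbour of \<open>k\<close> on the cycle, either no generator or every generator may be regarded as conjugated.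
\<close>

lemma t_cycle_one_neighbour:
  assumes T3: "T3_cycle H cs" and k: "k \<notin> set cs"
    and one: "\<forall>v \<in> set cs. adjacent H k v \<longrightarrow> v = x"
  shows "cycle_relation t cs"
proof -
  have cyc: "chordless_cycle H cs" using T3 by (simp add: T3_cycle_iff)
  have same: "D u v = H u v" if "u \<in> set cs" "v \<in> set cs" for u v
  proof (rule H_D_same)
    have "adjacent H k u \<Longrightarrow> adjacent H k v \<Longrightarrow> u = v" using one that by blast
    then show "\<not> (D u k \<noteq> 0 \<and> D k v \<noteq> 0)" "\<not> (D v k \<noteq> 0 \<and> D k u \<noteq> 0)"
      using D_antisym D_incident unfolding adjacent_def by metis+
  qed (use that k in auto)
  have len: "length cs \<ge> 3" using cyc by (simp add: chordless_cycle_iff)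
  then obtain v rest where "cs = v # rest" by (cases cs) auto
  moreover with len obtain us w where "rest = us @ [w]" by (cases rest rule: rev_cases) auto
  ultimately have cs: "cs = v # us @ [w]" by simp
  have "last cs \<in> set cs" "hd cs \<in> set cs" by (simp_all add: cs)
  then have "T3_cycle D cs" using T3 same unfolding T3_cycle_iff chordless_cycle_iff by auto
  then have rel: "cycle_relation s cs" by (rule D_cycle)
  show ?thesis
  proof (cases "\<exists>u \<in> set cs. D k u \<noteq> 0")
    case True
    then obtain u where u: "u \<in> set cs" "D k u \<noteq> 0" by blast
    have "D v k = 0" if "v \<in> set cs" for v
    proof (rule ccontr)
      assume "D v k \<noteq> 0"
      moreover have "adjacent H k v \<Longrightarrow> adjacent H k u \<Longrightarrow> u = v" using one that u by blast
      ultimately show False using u D_antisym[of k u] D_incident by (auto simp: adjacent_def)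
    qed
    then have "t v = conjugate \<one> (s v)" if "v \<in> set cs" for v using that by (simp add: t_other)
    then show ?thesis using cycle_relation_uniform[OF _ one_closed cs rel] by blast
  next
    case False
    then have "t v = conjugate (s k) (s v)" if "v \<in> set cs" for v
      using that t_conjugate_unlinked by blast
    then show ?thesis using cycle_relation_uniform[OF _ s_closed cs rel] by blast
  qed
qed

lemma commutes_unlinked: "v \<noteq> k \<Longrightarrow> \<not> adjacent H k v \<Longrightarrow> commutes (s k) (s v)"
  using D_commutes[of k v] D_incident by (auto simp: adjacent_def)

lemma t_unlinked: "\<not> adjacent H k v \<Longrightarrow> t v = s v"
  using D_incident by (auto simp: adjacent_def t_def)

text \<open>
  In \<open>D\<close> the vertex \<open>k\<close> is inserted between \<open>a\<close> and \<open>b\<close>, and among the vertices of the cycle only \<open>a\<close> has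
  its generator conjugated. The argument depends on where \<open>a\<close> is in the list \<open>cs\<close>, since the cycle
  relation is written from a fixed starting vertex. If \<open>a\<close> is first or inside, the conjugations by
  \<open>s\<^sub>k\<close> in \<open>t\<^sub>a\<close> can be moved to where the letters \<open>s\<^sub>k\<close> stand in the longer relation. If \<open>a\<close> is last, this
  needs a relation of length three between \<open>s\<^sub>k\<close> and one of \<open>s\<^sub>a\<close>, \<open>s\<^sub>b\<close>, and the edge that has weight \<open>1\<close>
  decides whether the longer cycle is read from \<open>b\<close> or from \<open>k\<close>.
\<close>

lemma t_cycle_two_neighbours:
  assumes T3: "T3_cycle H cs" and k: "k \<notin> set cs"
    and rot: "rotate n cs = b # zs @ [a]" and bk: "H b k \<noteq> 0" and ka: "H k a \<noteq> 0"
    and zs: "\<forall>z \<in> set zs. \<not> adjacent H k z"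
  shows "cycle_relation t cs"
proof -
  have cyc: "chordless_cycle H (b # zs @ [a])"
    using T3 chordless_cycle_rotate[of H n cs] by (simp add: T3_cycle_iff rot)
  have set: "set cs = set (b # zs @ [a])" using rot by (metis set_rotate)
  have k': "k \<notin> set (b # zs @ [a])" using k set by simp
  note ins = cycle_insert[OF two_finite cyc k' bk ka zs]
  have len: "length (b # zs @ [a]) \<ge> 3" using cyc by (simp add: chordless_cycle_iff)
  have ta: "t a = conjugate (s k) (s a)" using ka D_incident by (simp add: t_conjugate)
  have tb: "t b = s b" using H_antisym[OF bk] D_incident by (simp add: t_other)
  have tz: "t z = s z" if "z \<in> set zs" for z using zs that by (simp add: t_unlinked)
  have cz: "commutes (s k) (s z)" if "z \<in> set zs" for z
    using zs that k' by (auto intro: commutes_unlinked)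
  have dist: "distinct (b # zs @ [a])" using cyc by (simp add: chordless_cycle_iff)
  note w = ins(2)
  have Dk: "D k x \<le> D k b \<and> D x k \<le> D a k" if "x \<in> set (b # zs @ [a])" for x
  proof -
    have "H x k = 0" if "x \<noteq> b" using that \<open>x \<in> _\<close> zs H_antisym[OF ka] by (auto simp: adjacent_def)
    moreover have "H k x = 0" if "x \<noteq> a" using that \<open>x \<in> _\<close> zs H_antisym[OF bk] by (auto simp: adjacent_def)
    ultimately show ?thesis using D_incident by (cases "x = a"; cases "x = b") auto
  qed
  have bound: "\<forall>x \<in> insert k (set cs). \<forall>y \<in> insert k (set cs). D x y \<le> m"
    if le: "\<forall>x \<in> set cs. \<forall>y \<in> set cs. H x y \<le> m" for m
  proof -
    have "H a b \<le> m" using le set by simp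
    then have km: "D k b \<le> m" "D a k \<le> m" using w by auto
    have "D x y \<le> m" if "x \<in> set cs" "y \<in> set cs" for x y
      using ins(3,4) ins(5)[of x y] le that unfolding set
      by (cases "(x, y) = (a, b) \<or> (x, y) = (b, a)") auto
    with km Dk show ?thesis unfolding set using le_trans by fastforce
  qed
  have T3D: "T3_cycle D ds"
    if ds: "chordless_cycle D ds" "set ds = insert k (set cs)"
      and last: "H (last cs) (hd cs) = 2 \<Longrightarrow> D (last ds) (hd ds) = 2" for ds
  proof -
    from T3 consider "\<forall>x \<in> set cs. \<forall>y \<in> set cs. H x y \<le> 1"
      | "\<forall>x \<in> set cs. \<forall>y \<in> set cs. H x y \<le> 2" "H (last cs) (hd cs) = 2"
      unfolding T3_cycle_iff by blast
    then show ?thesis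
    proof cases
      case 1
      from bound[OF 1] show ?thesis unfolding T3_cycle_iff ds(2) using ds(1) by blast
    next
      case 2
      from bound[OF 2(1)] last[OF 2(2)] show ?thesis unfolding T3_cycle_iff ds(2) using ds(1) by blast
    qed
  qed
  have cyc_rot: "chordless_cycle D (q @ p)" if "p @ q = b # (zs @ [a]) @ [k]" for p q
    using ins(1) that chordless_cycle_append_commute by metis
  obtain p q where pq: "cs = p @ q" "q @ p = b # zs @ [a]"
    using rot rotate_drop_take[of n cs] append_take_drop_id by metis
  have "cs = b # zs @ [a] \<or> (\<exists>p' q'. cs = p' @ a # b # q' \<and> zs = q' @ p')"
  proof (cases "p = [] \<or> q = []")
    case True
    then show ?thesis using pq by auto
  next
    case False
    then obtain p' x y q' where "p = p' @ [x]" "q = y # q'" by (metis neq_Nil_conv rev_exhaust)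
    then show ?thesis using pq by auto
  qed
  then show ?thesis
  proof
    assume cs: "cs = b # zs @ [a]"
    have tcs: "cycle_relation t cs \<longleftrightarrow> commutes (s b) (chain s zs (conjugate (s k) (s a)))"
      unfolding cs cycle_relation_Cons using tb ta chain_cong[of zs t s] tz by simp
    show ?thesis
    proof (cases "D a k = 1")
      case True
      have "T3_cycle D (b # (zs @ [a]) @ [k])"
        by (rule T3D[OF ins(1)]) (use w True in \<open>auto simp: cs\<close>)
      from D_cycle[OF this] have "commutes (s b) (chain s zs (conjugate (inv (s a)) (s k)))"
        unfolding cycle_relation_Cons by simp
      moreover have "conjugate (s k) (s a) = conjugate (inv (s a)) (s k)"
        using D_braid_3[OF True] by (intro braid_3_conjugate) auto
      ultimately show ?thesis unfolding tcs by simp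
    next
      case False
      then have v: "D k b = 1" "D a k = 2" "H a b = 2" using w by auto
      have "T3_cycle D (k # (b # zs) @ [a])"
        by (rule T3D) (use cyc_rot[of "b # zs @ [a]" "[k]"] v in \<open>auto simp: cs\<close>)
      from D_cycle[OF this] have "commutes (s k) (conjugate (inv (s b)) (chain s zs (s a)))"
        unfolding cycle_relation_Cons by simp
      then have "commutes (conjugate (s b) (s k)) (chain s zs (s a))"
        by (simp add: commutes_conjugate_left)
      moreover have "conjugate (s b) (s k) = conjugate (inv (s k)) (s b)"
        using D_braid_3[OF v(1)] by (intro braid_3_conjugate) auto
      ultimately have "commutes (s b) (conjugate (s k) (chain s zs (s a)))"
        by (simp add: commutes_conjugate_right)
      then show ?thesis unfolding tcs using chain_conjugate[of s "s k" "s a" zs] cz by simp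
    qed
  next
    assume "\<exists>p' q'. cs = p' @ a # b # q' \<and> zs = q' @ p'"
    then obtain p' q' where cs: "cs = p' @ a # b # q'" and zpq: "zs = q' @ p'" by blast
    have "chordless_cycle D (p' @ a # k # b # q')"
      using cyc_rot[of "b # q'" "p' @ [a, k]"] by (simp add: zpq)
    have Hba: "H b a = 0" using w by (intro H_antisym) auto
    \<comment> \<open>The last edge of the list is not the one into which \<open>k\<close> is inserted, so it keeps its weight.\<close>
    have ends: "D (last (b # q')) (hd (p' @ [a])) = 2" if "H (last (b # q')) (hd (p' @ [a])) = 2"
    proof -
      have "last (b # q') \<in> set (b # q')" "hd (p' @ [a]) \<in> set (p' @ [a])" by (rule last_in_set hd_in_set; simp)+
      moreover have "a \<notin> set (b # q')" using dist by (auto simp: zpq)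
      ultimately have "D (last (b # q')) (hd (p' @ [a])) = H (last (b # q')) (hd (p' @ [a]))"
        using Hba that by (intro ins(5)) (auto simp: zpq simp del: last.simps)
      with that show ?thesis by simp
    qed
    have ends': "last (xs @ b # q') = last (b # q')" "hd (p' @ a # ys) = hd (p' @ [a])" for xs ys
      by (simp, cases p', simp_all)
    have "last cs = last (b # q')" "hd cs = hd (p' @ [a])"
      unfolding cs using ends'(1)[of "p' @ [a]"] ends'(2) by simp_all
    moreover have "last (p' @ a # k # b # q') = last (b # q')" "hd (p' @ a # k # b # q') = hd (p' @ [a])"
      using ends'(1)[of "p' @ [a, k]"] ends'(2) by simp_all
    ultimately have rel: "cycle_relation s (p' @ a # k # b # q')"
      by (intro D_cycle T3D[OF \<open>chordless_cycle D (p' @ a # k # b # q')\<close>]) (use ends in \<open>auto simp: cs\<close>)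
    obtain us x where us: "b # q' = us @ [x]" by (cases "b # q'" rule: rev_cases) auto
    have eq: "t v = s v" "commutes (s k) (s v)" if "v \<in> set p'" for v
      using tz cz that by (auto simp: zpq)
    have eq': "t v = s v" if "v \<in> set us \<or> v = x" for v
    proof -
      have "v \<in> set (us @ [x])" using that by auto
      then show ?thesis using tz tb unfolding us[symmetric] by (auto simp: zpq)
    qed
    let ?X = "chain s us (s x)"
    have tX: "chain t us (t x) = ?X" using chain_cong[of us t s] eq' by simp
    show ?thesis
    proof (cases p')
      case Nil
      have "commutes (s a) (conjugate (inv (s k)) ?X)"
        using rel cycle_relation_Cons[of s a "k # us" x] by (simp add: Nil us)
      moreover have "cycle_relation t cs \<longleftrightarrow> commutes (conjugate (s k) (s a)) ?X"
        unfolding cs using cycle_relation_Cons[of t a us x] by (simp add: Nil us ta tX)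
      ultimately show ?thesis by (simp add: commutes_conjugate_left)
    next
      case (Cons v p'')
      let ?Y = "conjugate (inv (s a)) (conjugate (inv (s k)) ?X)"
      have Y: "commutes (s v) (chain s p'' ?Y)"
        using rel cycle_relation_Cons[of s v "p'' @ a # k # us" x] by (simp add: Cons us)
      have "cycle_relation t cs \<longleftrightarrow> commutes (s v) (chain s p'' (conjugate (s k) ?Y))"
        unfolding cs using cycle_relation_Cons[of t v "p'' @ a # us" x] eq(1) chain_cong[of p'' t s]
        by (simp add: Cons us ta tX inv_conjugate conjugate_by_conjugate)
      also have "\<dots> \<longleftrightarrow> commutes (s v) (conjugate (s k) (chain s p'' ?Y))"
        using chain_conjugate[of s "s k" ?Y p''] eq(2) by (simp add: Cons)
      also have "\<dots> \<longleftrightarrow> commutes (s v) (chain s p'' ?Y)"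
        using conjugate_fixes_iff[of "s k" "s v"] eq(2)[of v]
          commutes_conjugate[of "s k" "s v" "chain s p'' ?Y"] by (simp add: Cons)
      finally show ?thesis using Y by blast
    qed
  qed
qed

text \<open>
  Here the neighbours of \<open>k\<close> on the cycle are \<open>i \<rightarrow> k \<rightarrow> j\<close> and only \<open>s\<^sub>j\<close> is conjugated. The relation
  known in \<open>D\<close> is that of the cycle with \<open>k\<close> left out, which for a triangle is read as commutation of
  \<open>s\<^sub>i\<close> and \<open>s\<^sub>j\<close>. If \<open>k\<close> is the first or the last vertex, the condition on the weight of the last edge
  guarantees a relation of length three on the other side of \<open>k\<close>. The triangle with weights \<open>2, 2, 1\<close>
  is treated separately: there \<open>i\<close> and \<open>j\<close> remain joined in \<open>D\<close>.
\<close>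

lemma t_cycle_through:
  assumes T3: "T3_cycle H cs" and k: "k \<in> set cs"
  shows "cycle_relation t cs"
proof -
  have cyc: "chordless_cycle H cs" using T3 by (simp add: T3_cycle_iff)
  have dist: "distinct cs" and len: "length cs \<ge> 3" using cyc by (simp_all add: chordless_cycle_iff)
  obtain p q where cs: "cs = p @ k # q" using k by (meson split_list)
  have "length (q @ p) \<ge> 2" using len by (simp add: cs)
  then obtain j zs i where qp: "q @ p = j # zs @ [i]" using list_Cons_snoc by metis
  have cyc': "chordless_cycle H (k # (j # zs) @ [i])"
    using cyc chordless_cycle_append_commute[of H p "k # q"] by (simp add: cs qp)
  have dist': "distinct (k # j # zs @ [i])" using cyc' by (simp add: chordless_cycle_iff)
  have set: "set cs = set (k # j # zs @ [i])"
  proof -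
    have "set cs = insert k (set (q @ p))" by (auto simp: cs)
    then show ?thesis unfolding qp by simp
  qed
  have ikj: "H i k \<noteq> 0" "H k j \<noteq> 0"
    using chordless_cycleD[OF cyc', of i k] chordless_cycleD[OF cyc', of k j] by simp_all
  have tj: "t j = conjugate (s k) (s j)" using ikj D_incident by (simp add: t_conjugate)
  have ti: "t i = s i" using H_antisym[OF ikj(1)] D_incident by (simp add: t_other)
  have nadj: "\<not> adjacent H k z" if "z \<in> set zs" for z
  proof -
    have "z \<noteq> j" "z \<noteq> i" "z \<noteq> k" "k \<notin> set (j # zs @ [i])" using dist' that by auto
    then show ?thesis
      using chordless_cycleD[OF cyc', of z k] chordless_cycleD[OF cyc', of k z]
        arcs_notin[of k "j # zs @ [i]"] that by (auto simp: adjacent_def)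
  qed
  have tz: "t z = s z" "commutes (s k) (s z)" if "z \<in> set zs" for z
    using nadj[OF that] dist' that by (auto intro: t_unlinked commutes_unlinked)
  have cases_T3: "(\<forall>x \<in> set cs. \<forall>y \<in> set cs. H x y \<le> 1) \<or>
      (\<forall>x \<in> set cs. \<forall>y \<in> set cs. H x y \<le> 2) \<and> H (last cs) (hd cs) = 2"
    using T3 by (simp add: T3_cycle_iff)
  have main: "cycle_relation t cs"
    if rel: "cycle_relation s (p @ q)" and w: "(H i k, H k j) \<in> {(1,1), (1,2), (2,1)}"
  proof -
    consider "p = []" | "q = []" | "p \<noteq> []" "q \<noteq> []" by blast
    then show ?thesis
    proof cases
      case 1
      then have q: "q = j # zs @ [i]" using qp by simp
      have kj1: "D j k = 1"
        using cases_T3 w ikj set unfolding cs 1 q by (auto simp: D_incident)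
      have sw: "conjugate (s j) (s k) = conjugate (inv (s k)) (s j)"
        using D_braid_3[OF kj1] by (intro braid_3_conjugate) auto
      let ?X = "chain s zs (s i)"
      have X: "commutes (s j) ?X" using rel unfolding 1 q append_Nil cycle_relation_Cons .
      have "cycle_relation t cs \<longleftrightarrow> commutes (s k)
          (conjugate (s k) (conjugate (inv (s j)) (conjugate (inv (s k)) ?X)))"
        using cycle_relation_Cons[of t k "j # zs" i] chain_cong[of zs t s] tz
        by (simp add: cs 1 q tj ti inv_conjugate conjugate_by_conjugate)
      also have "\<dots> \<longleftrightarrow> commutes (s k) (conjugate (inv (s j)) (conjugate (inv (s k)) ?X))"
        using commutes_conjugate[of "s k" "s k"] by simp
      also have "\<dots> \<longleftrightarrow> commutes (conjugate (s j) (s k)) (conjugate (inv (s k)) ?X)"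
        by (simp add: commutes_conjugate_left)
      also have "\<dots> \<longleftrightarrow> commutes (s j) ?X"
        unfolding sw by (simp add: commutes_conjugate)
      finally show ?thesis using X by blast
    next
      case 2
      then have p: "p = j # zs @ [i]" using qp by simp
      have ik1: "D k i = 1"
        using cases_T3 w ikj set unfolding cs 2 p by (auto simp: D_incident)
      have sw: "conjugate (inv (s i)) (s k) = conjugate (s k) (s i)"
        using D_braid_3[OF ik1] by (intro braid_3_conjugate[symmetric]) auto
      let ?X = "chain s zs (s i)"
      have X: "commutes (s j) ?X" using rel unfolding 2 p append_Nil2 cycle_relation_Cons .
      have "cycle_relation t cs \<longleftrightarrow>
          commutes (conjugate (s k) (s j)) (chain s zs (conjugate (s k) (s i)))"
        using cycle_relation_Cons[of t j "zs @ [i]" k] chain_cong[of zs t s] tz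
        by (simp add: cs 2 p tj ti sw)
      also have "\<dots> \<longleftrightarrow> commutes (conjugate (s k) (s j)) (conjugate (s k) ?X)"
        using chain_conjugate[of s "s k" "s i" zs] tz(2) by simp
      also have "\<dots> \<longleftrightarrow> commutes (s j) ?X"
        by (simp add: commutes_conjugate)
      finally show ?thesis using X by blast
    next
      case 3
      then obtain p' q' where pq: "p = p' @ [i]" "q = j # q'" and zpq: "zs = q' @ p'"
        using qp by (cases p rule: rev_cases; cases q) auto
      obtain v us where v: "p' @ [i] = v # us" by (cases p') auto
      have tv: "t u = s u" if "u \<in> set (v # us)" for u
        using that tz(1) ti unfolding v[symmetric] by (auto simp: zpq)
      show ?thesis
      proof (cases q' rule: rev_cases)
        case Nil
        have "commutes (s v) (chain s us (s j))"
          using rel cycle_relation_Cons[of s v us j] by (simp add: pq Nil v)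
        moreover have "cycle_relation t cs \<longleftrightarrow> commutes (s v) (chain s us (s j))"
          using cycle_relation_Cons[of t v "us @ [k]" j] tv chain_cong[of us t s]
          by (simp add: cs pq Nil v tj)
        ultimately show ?thesis by blast
      next
        case (snoc us2 x)
        let ?X = "chain s us2 (s x)"
        have fixed: "conjugate (inv (s k)) ?X = ?X"
        proof -
          have "conjugate (s k) ?X = chain s us2 (conjugate (s k) (s x))"
            using chain_conjugate[of s "s k" "s x" us2] tz(2) by (simp add: zpq snoc)
          also have "conjugate (s k) (s x) = s x"
            using tz(2)[of x] by (simp add: conjugate_fixes_iff zpq snoc)
          finally show ?thesis using conjugate_cancel(2)[of "s k" ?X] by simp
        qed
        have X: "commutes (s v) (chain s us (conjugate (inv (s j)) ?X))"
          using rel cycle_relation_Cons[of s v "us @ j # us2" x] by (simp add: pq snoc v)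
        have "chain t us2 (t x) = ?X" using chain_cong[of us2 t s] tz(1) by (simp add: zpq snoc)
        then have "cycle_relation t cs \<longleftrightarrow> commutes (s v) (chain s us (conjugate (inv (s j)) ?X))"
          using cycle_relation_Cons[of t v "us @ k # j # us2" x] tv chain_cong[of us t s] fixed
          by (simp add: cs pq snoc v tj inv_conjugate conjugate_by_conjugate)
        with X show ?thesis by blast
      qed
    qed
  qed
  show ?thesis
  proof (cases "zs = []")
    case False
    note rem = cycle_remove[OF two_finite cyc' False]
    have setqp: "set (p @ q) = set (j # zs @ [i])" unfolding qp[symmetric] by auto
    have cpq: "chordless_cycle D (p @ q)"
      using rem(1) chordless_cycle_append_commute[of D p q] by (simp add: qp)
    have bound: "\<forall>x \<in> set (p @ q). \<forall>y \<in> set (p @ q). D x y \<le> m"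
      if le: "\<forall>x \<in> set cs. \<forall>y \<in> set cs. H x y \<le> m" for m
    proof -
      have "H i k \<le> m" "H k j \<le> m" using le set by simp_all
      then have "D i j \<le> m" using rem(2) by auto
      then show ?thesis
        using rem(3) rem(4) le unfolding set setqp by (metis insertCI le0 list.simps(15) prod.inject)
    qed
    \<comment> \<open>If \<open>k\<close> is at an end of the list, the new edge \<open>i \<rightarrow> j\<close> takes the place of the last one, with the same weight.\<close>
    have last: "D (last (p @ q)) (hd (p @ q)) = 2" if l: "H (last cs) (hd cs) = 2"
      and le: "\<forall>x \<in> set cs. \<forall>y \<in> set cs. H x y \<le> 2"
    proof -
      consider "p = []" | "q = []" | "p \<noteq> []" "q \<noteq> []" by blast
      then show ?thesis
      proof cases
        case 1
        then show ?thesis using l rem(2) qp by (auto simp: cs)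
      next
        case 2
        then show ?thesis using l rem(2) qp by (auto simp: cs)
      next
        case 3
        then obtain p' q' where pq: "p = p' @ [i]" "q = j # q'" and zpq: "zs = q' @ p'"
          using qp by (cases p rule: rev_cases; cases q) auto
        let ?l = "last (j # q')" and ?h = "hd (p' @ [i])"
        have lh: "?l \<in> set (j # q')" "?h \<in> set (p' @ [i])" by (rule last_in_set hd_in_set; simp)+
        have "(?l, ?h) \<noteq> (j, i)"
        proof
          assume eq: "(?l, ?h) = (j, i)"
          then have "q' = []" using dist' by (auto simp: zpq split: if_splits)
          moreover have "p' = []" using eq dist' by (cases p') (auto simp: zpq)
          ultimately show False using \<open>zs \<noteq> []\<close> zpq by simp
        qed
        moreover have "(?l, ?h) \<noteq> (i, j)" using lh(1) dist' by (auto simp: zpq simp del: last.simps)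
        ultimately have "D ?l ?h = H ?l ?h"
          using lh by (intro rem(4)) (auto simp: zpq simp del: last.simps)
        then show ?thesis using l unfolding cs pq by (cases p') (auto split: if_splits)
      qed
    qed
    have "T3_cycle D (p @ q)" unfolding T3_cycle_iff
      using cpq cases_T3 bound last by blast
    then have "cycle_relation s (p @ q)" by (rule D_cycle)
    then show ?thesis using main rem(2) by auto
  next
    case zs: True
    have ji: "H j i \<noteq> 0" using chordless_cycleD[OF cyc', of j i] dist' by (simp add: zs)
    note w = oriented_triangle_weights[OF two_finite ikj ji]
    show ?thesis
    proof (cases "D i j = 0")
      case True
      have ne: "i \<noteq> j" using dist' by auto
      have D0: "D i j = 0" "D j i = 0" using w True by auto
      have "commutes (s i) (s j)" "commutes (s j) (s i)"
        using D_commutes[OF ne D0] commutes_sym by auto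
      moreover have "p @ q = [i, j] \<or> p @ q = [j, i]"
        using qp unfolding zs by (cases p; cases q) (auto simp: append_eq_Cons_conv Cons_eq_append_conv)
      ultimately have "cycle_relation s (p @ q)" by (auto simp: cycle_relation_def)
      then show ?thesis using main w True by auto
    next
      case False
      then have v: "H i k = 2" "H k j = 2" "H j i = 1" "D i j = 1" "D j i = 0" using w by auto
      have v': "D k i = 2" "D j k = 2" using v D_incident by simp_all
      have tri: "commutes (s k) (conjugate (inv (s i)) (s j))"
        by (rule D_triangle) (use v v' in auto)
      have sw: "conjugate (s j) (s i) = conjugate (inv (s i)) (s j)"
        using D_braid_3[OF v(4)] by (intro braid_3_conjugate) auto
      have "cs = [k, j, i] \<or> cs = [j, i, k] \<or> cs = [i, k, j]"
        using qp unfolding zs cs by (cases p; cases q) (auto simp: append_eq_Cons_conv Cons_eq_append_conv)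
      moreover have "cs \<noteq> [i, k, j]" using cases_T3 v by auto
      ultimately consider "cs = [k, j, i]" | "cs = [j, i, k]" by blast
      then show ?thesis
      proof cases
        case 1
        have "commutes (s k) (conjugate (inv (s j)) (conjugate (inv (s k)) (s i)))"
          by (rule braid_4_commutes_twice_inv) (use D_braid_4[OF v'(2)] tri sw in auto)
        then have "commutes (s k) (conjugate (s k) (conjugate (inv (s j)) (conjugate (inv (s k)) (s i))))"
          using commutes_conjugate[of "s k" "s k"] by simp
        then show ?thesis
          using cycle_relation_Cons[of t k "[j]" i]
          by (simp add: 1 tj ti inv_conjugate conjugate_by_conjugate)
      next
        case 2
        have "commutes (s k) (conjugate (s i) (conjugate (s k) (s j)))"
          by (rule braid_4_commutes_twice) (use D_braid_4[OF v'(1)] tri in auto)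
        then have "commutes (conjugate (s i) (conjugate (s k) (s j))) (s k)"
          by (rule commutes_sym[THEN iffD1])
        then have "commutes (conjugate (s k) (s j)) (conjugate (inv (s i)) (s k))"
          using commutes_conjugate_left[of "s i" "conjugate (s k) (s j)" "s k"] by simp
        then show ?thesis
          using cycle_relation_Cons[of t j "[i]" k] by (simp add: 2 tj ti)
      qed
    qed
  qed
qed

lemma t_satisfies: "satisfies_artin H t"
  unfolding satisfies_artin_def
proof (intro conjI allI impI t_braid)
  fix cs assume T3: "T3_cycle H cs"
  have cyc: "chordless_cycle H cs" using T3 by (simp add: T3_cycle_iff)
  show "cycle_relation t cs"
  proof (cases "k \<in> set cs")
    case False
    from cycle_attachment[OF two_finite cyc False] show ?thesis
      using t_cycle_one_neighbour[OF T3 False] t_cycle_two_neighbours[OF T3 False] by blast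
  qed (rule t_cycle_through[OF T3])
qed

end

section \<open>Homomorphisms out of a presented group\<close>

context group
begin

definition letter_value :: "('v \<Rightarrow> 'a) \<Rightarrow> 'v \<times> bool \<Rightarrow> 'a" where
  "letter_value f l = (if snd l then f (fst l) else inv (f (fst l)))"

definition word_value :: "('v \<Rightarrow> 'a) \<Rightarrow> 'v word \<Rightarrow> 'a" where
  "word_value f w = foldr (\<lambda>l x. letter_value f l \<otimes> x) w \<one>"

lemma word_value_simps [simp]:
  "word_value f [] = \<one>" "word_value f (l # w) = letter_value f l \<otimes> word_value f w"
  by (simp_all add: word_value_def)

lemma letter_value_gen [simp]: "letter_value f (gen v) = f v"
  by (simp add: letter_value_def gen_def)

context
  fixes f :: "'v \<Rightarrow> 'a"
  assumes f [simp]: "\<And>v. f v \<in> carrier G"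
begin

lemma letter_value_closed [simp]: "letter_value f l \<in> carrier G"
  by (simp add: letter_value_def)

lemma word_value_closed [simp]: "word_value f w \<in> carrier G"
  by (induction w) simp_all

lemma word_value_append [simp]: "word_value f (u @ w) = word_value f u \<otimes> word_value f w"
  by (induction u) (simp_all add: m_assoc)

lemma letter_value_inv [simp]: "letter_value f (inv_letter l) = inv (letter_value f l)"
  by (simp add: letter_value_def inv_letter_def)

lemma word_value_inv_word [simp]: "word_value f (inv_word w) = inv (word_value f w)"
  by (induction w) (simp_all add: inv_word_def inv_mult_group)

lemma word_value_pres_eq:
  assumes "pres_eq R u w" and "\<And>u w. (u, w) \<in> R \<Longrightarrow> word_value f u = word_value f w"
  shows "word_value f u = word_value f w"
  using assms(1) by induction (simp_all add: assms(2))

lemma presented_group_hom: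
  assumes "\<And>u w. (u, w) \<in> R \<Longrightarrow> word_value f u = word_value f w"
  shows "\<exists>\<phi> \<in> hom (presented_group R) G. \<forall>w. \<phi> (word_class R w) = word_value f w"
proof -
  define \<phi> where "\<phi> X = word_value f (SOME u. word_class R u = X)" for X
  have \<phi>: "\<phi> (word_class R w) = word_value f w" for w
  proof -
    have "word_class R (SOME u. word_class R u = word_class R w) = word_class R w"
      by (rule someI) (rule HOL.refl)
    then have "pres_eq R (SOME u. word_class R u = word_class R w) w"
      by (simp only: word_class_eq_iff)
    then show ?thesis unfolding \<phi>_def by (rule word_value_pres_eq[OF _ assms])
  qed
  then have "\<phi> \<in> hom (presented_group R) G"
    unfolding hom_def carrier_presented_group by (auto simp: presented_group_mult)
  with \<phi> show ?thesis by blast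
qed

lemma word_value_alternating:
  "word_value f (alternating (gen i) (gen j) m) = alternating_product (f i) (f j) m"
  by (induction m arbitrary: i j) simp_all

lemma word_value_commutator:
  "word_value f (commutator_word u w) = \<one> \<longleftrightarrow> commutes (word_value f u) (word_value f w)"
proof -
  let ?x = "word_value f u" and ?y = "word_value f w"
  have "word_value f (commutator_word u w) = (?x \<otimes> ?y) \<otimes> inv (?y \<otimes> ?x)"
    by (simp add: commutator_word_def m_assoc inv_mult_group)
  also have "\<dots> = \<one> \<longleftrightarrow> ?x \<otimes> ?y = ?y \<otimes> ?x"
    using inv_solve_right'[of \<one> "?x \<otimes> ?y" "?y \<otimes> ?x"] by simp
  finally show ?thesis by (simp only: commutes_def)
qed

lemma word_value_chain:
  "word_value f (map (\<lambda>u. inv_letter (gen u)) us @ w @ rev (map gen us)) = chain f us (word_value f w)"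
proof (induction us)
  case (Cons u us)
  let ?y = "word_value f (map (\<lambda>u. inv_letter (gen u)) us @ w @ rev (map gen us))"
  have "word_value f (map (\<lambda>u. inv_letter (gen u)) (u # us) @ w @ rev (map gen (u # us))) =
      inv (f u) \<otimes> ?y \<otimes> f u"
    by (simp add: m_assoc)
  also have "\<dots> = chain f (u # us) (word_value f w)"
    unfolding Cons by (simp add: conjugate_def)
  finally show ?case .
qed simp

end

end

lemma p_word_Cons_snoc:
  "p_word (v # us @ [w]) 0 = map (\<lambda>u. inv_letter (gen u)) us @ [gen w] @ rev (map gen us)"
proof -
  let ?cs = "v # us @ [w]"
  have d: "length ?cs - 1 = Suc (length us)" by simp
  have us: "map (\<lambda>b. ?cs ! ((0 + b) mod length ?cs)) [1..<length ?cs - 1] = us"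
    unfolding d by (rule nth_equalityI) (auto simp: nth_append simp del: upt_Suc)
  have w: "?cs ! ((0 + (length ?cs - 1)) mod length ?cs) = w" by simp
  have "map (\<lambda>b. inv_letter (gen (?cs ! ((0 + b) mod length ?cs)))) [1..<length ?cs - 1] =
      map (\<lambda>u. inv_letter (gen u)) us"
    by (subst (2) us[symmetric]) (simp only: map_map o_def)
  moreover have "map (\<lambda>b. gen (?cs ! ((0 + b) mod length ?cs))) (rev [1..<length ?cs - 1]) = rev (map gen us)"
    by (subst (2) us[symmetric]) (simp only: map_map o_def rev_map)
  ultimately show ?thesis unfolding p_word_def Let_def w by simp
qed

text \<open>
  The defining relations in terms of words and their form as statements about group elements.
\<close>

lemma (in group) satisfies_artin_iff:
  assumes f: "\<And>v. f v \<in> carrier G"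
  shows "satisfies_artin D f \<longleftrightarrow>
    (\<forall>u w. (u, w) \<in> artin_relations D \<longrightarrow> word_value f u = word_value f w)"
proof -
  have T3: "word_value f (t_word cs 0) = word_value f [] \<longleftrightarrow> cycle_relation f cs" if "T3_cycle D cs" for cs
  proof -
    have "length cs \<ge> 2" using that by (simp add: T3_cycle_def chordless_cycle_def)
    then obtain v us w where cs: "cs = v # us @ [w]" using list_Cons_snoc by blast
    have "word_value f (p_word cs 0) = chain f us (f w)"
      unfolding cs p_word_Cons_snoc word_value_chain[of f, OF f] by (simp add: f)
    then show ?thesis
      using word_value_commutator[of f "[gen v]" "p_word cs 0"] f by (simp add: t_word_def cs)
  qed
  have "(\<forall>u w. (u, w) \<in> artin_relations D \<longrightarrow> word_value f u = word_value f w) \<longleftrightarrow>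
      (\<forall>i j. i \<noteq> j \<longrightarrow> word_value f (alternating (gen i) (gen j) (m_exponent D i j)) =
        word_value f (alternating (gen j) (gen i) (m_exponent D i j))) \<and>
      (\<forall>cs. T3_cycle D cs \<longrightarrow> word_value f (t_word cs 0) = word_value f [])"
    unfolding artin_relations_def by blast
  also have "\<dots> \<longleftrightarrow> satisfies_artin D f"
    using T3 unfolding satisfies_artin_def braid_def word_value_alternating[of f, OF f] by blast
  finally show ?thesis by (rule HOL.sym)
qed

section \<open>The isomorphism\<close>

lemma group_artin_group: "group (artin_group D)"
  by (simp add: artin_group_def group_presented_group)

definition artin_generator :: "'v diagram \<Rightarrow> 'v \<Rightarrow> 'v word set" where
  "artin_generator D v = word_class (artin_relations D) [gen v]"

lemma artin_generator_closed [simp]: "artin_generator D v \<in> carrier (artin_group D)"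
  by (simp add: artin_generator_def artin_group_def carrier_presented_group)

lemma word_value_artin_generator:
  "group.word_value (artin_group D) (artin_generator D) w = word_class (artin_relations D) w"
proof -
  interpret group "artin_group D" by (rule group_artin_group)
  have letter: "letter_value (artin_generator D) l = word_class (artin_relations D) [l]" for l
  proof (cases "snd l")
    case True
    then show ?thesis by (cases l) (simp add: letter_value_def artin_generator_def gen_def)
  next
    case False
    have l: "l = inv_letter (gen (fst l))"
      using False by (cases l) (simp add: inv_letter_def gen_def)
    let ?g = "gen (fst l)"
    have "word_class (artin_relations D) [l] \<otimes>\<^bsub>artin_group D\<^esub> artin_generator D (fst l) = \<one>\<^bsub>artin_group D\<^esub>"
      using pres_eq.cancel[of "artin_relations D" "inv_letter ?g"]
      by (subst l) (simp add: artin_generator_def artin_group_def presented_group_mult one_presented_group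
          word_class_eq_iff)
    then have "inv\<^bsub>artin_group D\<^esub> (artin_generator D (fst l)) = word_class (artin_relations D) [l]"
      by (intro inv_equality) (simp_all add: artin_group_def carrier_presented_group artin_generator_def)
    then show ?thesis using False by (simp add: letter_value_def)
  qed
  show ?thesis
  proof (induction w)
    case Nil
    show ?case unfolding word_value_simps by (simp add: artin_group_def one_presented_group)
  next
    case (Cons l w)
    have "word_class (artin_relations D) [l] \<otimes>\<^bsub>artin_group D\<^esub> word_class (artin_relations D) w =
        word_class (artin_relations D) (l # w)"
      by (simp add: artin_group_def presented_group_mult)
    with Cons show ?case by (simp add: letter)
  qed
qed

lemma carrier_artin_group:
  "x \<in> carrier (artin_group D) \<longleftrightarrow> (\<exists>w. x = group.word_value (artin_group D) (artin_generator D) w)"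
  unfolding word_value_artin_generator by (auto simp: artin_group_def carrier_presented_group)

lemma artin_generator_satisfies:
  "group.satisfies_artin (artin_group D) D (artin_generator D)"
proof -
  interpret group "artin_group D" by (rule group_artin_group)
  show ?thesis
    by (subst satisfies_artin_iff[of "artin_generator D", OF artin_generator_closed])
       (auto simp: word_value_artin_generator word_class_eq_iff intro: pres_eq.relator)
qed

text \<open>
  Homomorphisms that agree on the generators therefore agree on every element of the group.
\<close>

lemma hom_word_value:
  assumes "group K" "group L" "\<phi> \<in> hom K L" "\<And>v. f v \<in> carrier K"
  shows "\<phi> (group.word_value K f w) = group.word_value L (\<lambda>v. \<phi> (f v)) w"
proof -
  interpret group_hom K L \<phi>
    using assms by (simp add: group_hom_def group_hom_axioms_def)
  show ?thesis
  proof (induction w)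
    case (Cons l w)
    have "\<phi> (G.letter_value f l) = H.letter_value (\<lambda>v. \<phi> (f v)) l"
      using assms(4) by (simp add: G.letter_value_def H.letter_value_def)
    then show ?case using Cons assms(4) by simp
  qed simp
qed

definition mutated_generator :: "'v::finite diagram \<Rightarrow> 'v \<Rightarrow> 'v \<Rightarrow> 'v word set" where
  "mutated_generator D k v =
     (if D v k \<noteq> 0 then group.conjugate (artin_group D) (artin_generator D k) (artin_generator D v)
      else artin_generator D v)"

definition mutation_hom :: "int ^ 'v ^ 'v::finite \<Rightarrow> 'v \<Rightarrow> ('v word set \<Rightarrow> 'v word set) \<Rightarrow> bool" where
  "mutation_hom C k \<phi> \<longleftrightarrow>
     \<phi> \<in> hom (artin_group (diagram_of C)) (artin_group (diagram_of (mutate k C))) \<and>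
     (\<forall>v. \<phi> (artin_generator (diagram_of C) v) = mutated_generator (diagram_of (mutate k C)) k v)"

lemma mutation_hom_exists:
  assumes "two_finite C"
  shows "\<exists>\<phi>. mutation_hom C k \<phi>"
proof -
  let ?H = "diagram_of C" and ?D = "diagram_of (mutate k C)"
  interpret mutated_generators "artin_group ?D" C k "artin_generator ?D"
    using assms artin_generator_satisfies
    by (simp add: mutated_generators_def mutated_generators_axioms_def group_artin_group)
  have t: "t = mutated_generator ?D k"
    by (rule ext) (simp add: t_def mutated_generator_def)
  have rel: "word_value t u = word_value t w" if "(u, w) \<in> artin_relations ?H" for u w
    using t_satisfies that satisfies_artin_iff[of t, OF t_closed] by blast
  obtain \<phi> where \<phi>: "\<phi> \<in> hom (artin_group ?H) (artin_group ?D)"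
    "\<And>w. \<phi> (word_class (artin_relations ?H) w) = word_value t w"
    using presented_group_hom[of t, OF t_closed rel] unfolding artin_group_def[of ?H] by blast
  have "\<phi> (artin_generator ?H v) = t v" for v
    using \<phi>(2)[of "[gen v]"] by (simp add: artin_generator_def[of ?H])
  with \<phi>(1) show ?thesis unfolding mutation_hom_def t by blast
qed

text \<open>
  Both sides are endomorphisms, so it suffices to compare them on generators. An arrow \<open>v \<rightarrow> k\<close> of \<open>H\<close>
  makes \<open>\<psi>\<close> conjugate, an arrow \<open>k \<rightarrow> v\<close> makes \<open>\<phi>\<close> conjugate, and if there is neither, \<open>s\<^sub>k\<close> commutes
  with \<open>s\<^sub>v\<close>.
\<close>

lemma mutation_hom_composite:
  assumes tf: "two_finite C"
    and \<phi>: "mutation_hom C k \<phi>" and \<psi>: "mutation_hom (mutate k C) k \<psi>"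
    and x: "x \<in> carrier (artin_group (diagram_of (mutate k C)))"
  shows "\<phi> (\<psi> x) = group.conjugate (artin_group (diagram_of (mutate k C)))
    (artin_generator (diagram_of (mutate k C)) k) x"
proof -
  let ?H = "diagram_of C" and ?D = "diagram_of (mutate k C)"
  let ?g = "artin_generator ?D k"
  have undo: "mutate k (mutate k C) = C"
    by (rule mutate_mutate[OF skew_symmetrisable_diag[OF two_finite_skew[OF tf]]])
  interpret mutated_generators "artin_group ?D" C k "artin_generator ?D"
    using tf artin_generator_satisfies
    by (simp add: mutated_generators_def mutated_generators_axioms_def group_artin_group)
  have \<phi>1: "\<phi> \<in> hom (artin_group ?H) (artin_group ?D)"
    and \<phi>2: "\<And>v. \<phi> (artin_generator ?H v) = t v"
    using \<phi> by (auto simp: mutation_hom_def t_def mutated_generator_def)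
  have \<psi>1: "\<psi> \<in> hom (artin_group ?D) (artin_group ?H)"
    and \<psi>2: "\<And>v. \<psi> (artin_generator ?D v) = mutated_generator ?H k v"
    using \<psi> by (auto simp: mutation_hom_def undo)
  interpret \<phi>: group_hom "artin_group ?H" "artin_group ?D" \<phi>
    using \<phi>1 by (simp add: group_hom_def group_hom_axioms_def group_artin_group)
  have gen: "\<phi> (\<psi> (artin_generator ?D v)) = conjugate ?g (artin_generator ?D v)" for v
  proof (cases "?H v k = 0")
    case True
    then have "\<phi> (\<psi> (artin_generator ?D v)) = t v" by (simp add: \<psi>2 mutated_generator_def \<phi>2)
    then show ?thesis using True D_incident t_conjugate_unlinked by simp
  next
    case False
    then have "t v = artin_generator ?D v"
      using H_antisym[of v k] D_incident by (simp add: t_other)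
    moreover have "\<phi> (\<psi> (artin_generator ?D v)) = conjugate (t k) (t v)"
      using False by (simp add: \<psi>2 mutated_generator_def \<phi>.G.conjugate_def conjugate_def \<phi>2)
    ultimately show ?thesis by simp
  qed
  have conj: "conjugate ?g \<in> hom (artin_group ?D) (artin_group ?D)"
    unfolding hom_def by (auto simp: conjugate_mult)
  have comp: "\<phi> \<circ> \<psi> \<in> hom (artin_group ?D) (artin_group ?D)"
    by (rule Group.hom_compose[OF \<psi>1 \<phi>1])
  obtain w where w: "x = word_value (artin_generator ?D) w"
    using x unfolding carrier_artin_group by blast
  have "(\<phi> \<circ> \<psi>) x = word_value (\<lambda>v. (\<phi> \<circ> \<psi>) (artin_generator ?D v)) w"
    unfolding w by (rule hom_word_value[OF is_group is_group comp]) simp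
  also have "\<dots> = word_value (\<lambda>v. conjugate ?g (artin_generator ?D v)) w"
    by (simp add: gen)
  also have "\<dots> = conjugate ?g x"
    unfolding w by (rule hom_word_value[OF is_group is_group conj, symmetric]) simp
  finally show ?thesis by simp
qed

lemma mutation_hom_iso:
  assumes tf: "two_finite C" and \<phi>: "mutation_hom C k \<phi>"
  shows "\<phi> \<in> iso (artin_group (diagram_of C)) (artin_group (diagram_of (mutate k C)))"
proof -
  let ?H = "diagram_of C" and ?D = "diagram_of (mutate k C)"
  have tf': "two_finite (mutate k C)" by (rule two_finite_mutate[OF tf])
  have undo: "mutate k (mutate k C) = C"
    by (rule mutate_mutate[OF skew_symmetrisable_diag[OF two_finite_skew[OF tf]]])
  obtain \<psi> where \<psi>: "mutation_hom (mutate k C) k \<psi>" using mutation_hom_exists[OF tf'] by blast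
  interpret H: group "artin_group ?H" by (rule group_artin_group)
  interpret D: group "artin_group ?D" by (rule group_artin_group)
  note \<phi>\<psi> = mutation_hom_composite[OF tf \<phi> \<psi>]
  have \<psi>\<phi>: "\<psi> (\<phi> x) = H.conjugate (artin_generator ?H k) x" if "x \<in> carrier (artin_group ?H)" for x
    using mutation_hom_composite[OF tf' \<psi>, of \<phi> x] \<phi> that by (simp add: undo)
  have hom: "\<phi> \<in> hom (artin_group ?H) (artin_group ?D)" "\<psi> \<in> hom (artin_group ?D) (artin_group ?H)"
    using \<phi> \<psi> by (simp_all add: mutation_hom_def undo)
  have "inj_on \<phi> (carrier (artin_group ?H))"
  proof (rule inj_onI)
    fix x y assume xy: "x \<in> carrier (artin_group ?H)" "y \<in> carrier (artin_group ?H)" "\<phi> x = \<phi> y"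
    then have "H.conjugate (artin_generator ?H k) x = H.conjugate (artin_generator ?H k) y"
      using \<psi>\<phi> by metis
    then show "x = y" using xy by (simp add: H.conjugate_eq_iff)
  qed
  moreover have "\<phi> ` carrier (artin_group ?H) = carrier (artin_group ?D)"
  proof (rule equalityI)
    show "\<phi> ` carrier (artin_group ?H) \<subseteq> carrier (artin_group ?D)"
      using hom(1) by (auto simp: hom_def)
    show "carrier (artin_group ?D) \<subseteq> \<phi> ` carrier (artin_group ?H)"
    proof
      fix y assume y: "y \<in> carrier (artin_group ?D)"
      let ?z = "D.conjugate (inv\<^bsub>artin_group ?D\<^esub> (artin_generator ?D k)) y"
      have z: "?z \<in> carrier (artin_group ?D)" using y by simp
      have "\<phi> (\<psi> ?z) = y" using \<phi>\<psi>[OF z] y by simp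
      moreover have "\<psi> ?z \<in> carrier (artin_group ?H)" using hom(2) z by (auto simp: hom_def)
      ultimately show "y \<in> \<phi> ` carrier (artin_group ?H)" by (metis imageI)
    qed
  qed
  ultimately show ?thesis using hom(1) by (simp add: iso_def bij_betw_def)
qed

theorem theorem1p1:
  fixes \<Gamma> \<Gamma>' :: "'v::finite diagram" and k :: 'v
  assumes "finite_type \<Gamma>"
    and "is_diagram_mutation k \<Gamma> \<Gamma>'"
  shows "artin_group \<Gamma> \<cong> artin_group \<Gamma>'"
proof -
  from assms(1) obtain B where B: "skew_symmetrisable B" "\<Gamma> = diagram_of B"
    "finite (mutation_class (indeterminate, B))"
    unfolding finite_type_def by blast
  from assms(2) obtain C where C: "skew_symmetrisable C" "\<Gamma> = diagram_of C" "\<Gamma>' = diagram_of (mutate k C)"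
    unfolding is_diagram_mutation_def by blast
  have "two_finite C"
    using two_finite_cong[OF finite_type_imp_two_finite[OF B(1,3)] C(1)] B(2) C(2) by simp
  then obtain \<phi> where "\<phi> \<in> iso (artin_group \<Gamma>) (artin_group \<Gamma>')"
    using mutation_hom_exists mutation_hom_iso unfolding C(2,3) by blast
  then show ?thesis by (auto simp: is_iso_def)
qed

end
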